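(* Let $m\ge 3$ and let $G=W(C_m)$ be the whiskered cycle. Then $\operatorname{reg}\bigl(I(G)^{[2]}\bigr)= 4+\left\lfloor\frac{m-3}{2}\right\rfloor$.
   Context: All graphs are finite and simple. Fix a field $\mathbb{K}$. For a graph $G$ with vertex set $V(G)$ (vertices are identified with indeterminates), $R=\mathbb{K}[x\mid x\in V(G)]$ and $I(G)=\langle xy\mid \{x,y\}\in E(G)\rangle\subseteq R$ is the edge ideal. The second square-free power $I(G)^{[2]}$ is the ideal of $R$ generated by the square-free monomials of $I(G)^2$; equivalently it is generated by the products $abcd$ over all pairs of disjoint edges $\{a,b\},\{c,d\}$ of $G$. For a nonzero graded ideal $J\subseteq R$ with graded Betti numbers $\beta_{i,j}(J)$ (of $J$ as an $R$-module), $\operatorname{reg}(J)=\max\{j-i\mid \beta_{i,j}(J)\ne 0\}$. The whiskered cycle $W(C_m)$ has vertices $x_1,\dots,x_m,y_1,\dots,y_m$ and edges $\{x_i,x_{i+1}\}$ ($1\le i\le m-1$), $\{x_1,x_m\}$, and $\{x_i,y_i\}$ ($1\le i\le m$). *)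

theory Defs
  imports
    Complex_Main
    "HOL-Library.Poly_Mapping"
    "HOL-Algebra.Ideal_Product"
    "Jordan_Normal_Form.Matrix"
begin

type_synonym 'v monomial = "'v \<Rightarrow>\<^sub>0 nat"
type_synonym ('v, 'k) mpoly = "'v monomial \<Rightarrow>\<^sub>0 'k"

definition monomial :: "'v monomial \<Rightarrow> ('v, 'k::field) mpoly" where
  "monomial t = Poly_Mapping.single t 1"

definition indet :: "'v \<Rightarrow> ('v, 'k::field) mpoly" where
  "indet x = monomial (Poly_Mapping.single x 1)"

definition total_deg :: "'v monomial \<Rightarrow> nat" where
  "total_deg t = (\<Sum>x\<in>Poly_Mapping.keys t. Poly_Mapping.lookup t x)"

definition squarefree_monomial :: "'v monomial \<Rightarrow> bool" where
  "squarefree_monomial t \<longleftrightarrow> (\<forall>x. Poly_Mapping.lookup t x \<le> 1)"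

text \<open>The ring of polynomials in the indeterminates \<open>V\<close>: its elements are those polynomials over
  the type \<open>'v\<close> whose monomials only involve elements of \<open>V\<close>.\<close>

definition poly_ring :: "'v set \<Rightarrow> ('v, 'k::field) mpoly ring" where
  "poly_ring V =
     \<lparr>carrier = {p. \<forall>t\<in>Poly_Mapping.keys p. Poly_Mapping.keys t \<subseteq> V},
      monoid.mult = (*), one = 1, zero = 0, add = (+)\<rparr>"

lemma cring_poly_ring: "cring (poly_ring V :: ('v, 'k::field) mpoly ring)"
proof (rule cringI)
  show "abelian_group (poly_ring V :: ('v, 'k) mpoly ring)"
  proof (rule abelian_groupI)
    fix p :: "('v, 'k) mpoly"
    assume p: "p \<in> carrier (poly_ring V)"
    then show "\<exists>q\<in>carrier (poly_ring V). q \<oplus>\<^bsub>poly_ring V\<^esub> p = \<zero>\<^bsub>poly_ring V\<^esub>"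
      by (intro bexI[of _ "- p"]) (auto simp: poly_ring_def)
  qed (use keys_add in \<open>fastforce simp: poly_ring_def algebra_simps\<close>)+
  show "Group.comm_monoid (poly_ring V :: ('v, 'k) mpoly ring)"
  proof (rule comm_monoidI)
    fix p q :: "('v, 'k) mpoly"
    assume pq: "p \<in> carrier (poly_ring V)" "q \<in> carrier (poly_ring V)"
    have "Poly_Mapping.keys t \<subseteq> V" if "t \<in> Poly_Mapping.keys (p * q)" for t
    proof -
      obtain a b where t: "t = a + b" "a \<in> Poly_Mapping.keys p" "b \<in> Poly_Mapping.keys q"
        using \<open>t \<in> Poly_Mapping.keys (p * q)\<close> keys_mult[of p q] by blast
      then show ?thesis
        using pq keys_add[of a b] by (fastforce simp: poly_ring_def)
    qed
    then show "p \<otimes>\<^bsub>poly_ring V\<^esub> q \<in> carrier (poly_ring V)"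
      by (simp add: poly_ring_def)
  qed (auto simp: poly_ring_def algebra_simps)
qed (auto simp: poly_ring_def algebra_simps)

type_synonym 'v graph = "'v set \<times> 'v set set"

definition edge_ideal :: "'v graph \<Rightarrow> ('v, 'k::field) mpoly set" where
  "edge_ideal G = Idl\<^bsub>poly_ring (fst G)\<^esub> {indet x * indet y |x y. {x, y} \<in> snd G}"

definition second_squarefree_power ::
    "'v set \<Rightarrow> ('v, 'k::field) mpoly set \<Rightarrow> ('v, 'k) mpoly set" where
  "second_squarefree_power V I =
     Idl\<^bsub>poly_ring V\<^esub>
       {monomial t |t. squarefree_monomial t \<and> monomial t \<in> ideal_prod (poly_ring V) I I}"

definition free_module :: "'v set \<Rightarrow> nat \<Rightarrow> ('v, 'k::field) mpoly vec set" where
  "free_module V n = {v \<in> carrier_vec n. set\<^sub>v v \<subseteq> carrier (poly_ring V)}"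

text \<open>A minimal graded free resolution
  \<open>\<cdots> \<rightarrow> F 2 \<rightarrow> F 1 \<rightarrow> F 0 \<rightarrow> J \<rightarrow> 0\<close> of a graded ideal \<open>J\<close> over the polynomial ring \<open>R\<close> in \<open>V\<close>.
  Here \<open>F i\<close> is free of rank \<open>b i\<close>, its \<open>k\<close>-th basis element has degree \<open>d i k\<close>
  (that is, \<open>F i\<close> is the direct sum of the \<open>R(- d i k)\<close> for \<open>k < b i\<close>),
  \<open>\<phi> (Suc i)\<close> is the matrix of the map from \<open>F (Suc i)\<close> to \<open>F i\<close>, and the one-row matrix
  \<open>\<phi> 0\<close> is the augmentation from \<open>F 0\<close> onto \<open>J\<close>.
  The third and fifth conditions say that these maps are homogeneous of degree 0, the sixth that
  each matrix entry \<open>\<phi> (Suc i) $$ (k, l)\<close> lies in the homogeneous maximal ideal (minimality).\<close>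

definition minimal_graded_free_resolution ::
    "'v set \<Rightarrow> ('v, 'k::field) mpoly set \<Rightarrow>
     (nat \<Rightarrow> nat) \<Rightarrow> (nat \<Rightarrow> nat \<Rightarrow> nat) \<Rightarrow> (nat \<Rightarrow> ('v, 'k) mpoly mat) \<Rightarrow> bool" where
  "minimal_graded_free_resolution V J b d \<phi> \<longleftrightarrow>
     (\<forall>i. elements_mat (\<phi> i) \<subseteq> carrier (poly_ring V)) \<and>
     \<phi> 0 \<in> carrier_mat 1 (b 0) \<and>
     (\<forall>k<b 0. \<forall>t\<in>Poly_Mapping.keys (\<phi> 0 $$ (0, k)). total_deg t = d 0 k) \<and>
     (\<forall>i. \<phi> (Suc i) \<in> carrier_mat (b i) (b (Suc i))) \<and>
     (\<forall>i. \<forall>k<b i. \<forall>l<b (Suc i). \<forall>t\<in>Poly_Mapping.keys (\<phi> (Suc i) $$ (k, l)).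
        d i k + total_deg t = d (Suc i) l) \<and>
     (\<forall>i. \<forall>k<b i. \<forall>l<b (Suc i). Poly_Mapping.lookup (\<phi> (Suc i) $$ (k, l)) 0 = 0) \<and>
     {(\<phi> 0 *\<^sub>v v) $ 0 |v. v \<in> free_module V (b 0)} = J \<and>
     (\<forall>i. {v \<in> free_module V (b i). \<phi> i *\<^sub>v v = 0\<^sub>v (dim_row (\<phi> i))} =
          {\<phi> (Suc i) *\<^sub>v w |w. w \<in> free_module V (b (Suc i))})"

text \<open>The minimal graded free resolution is unique up to isomorphism, so the number of basis
  elements of degree \<open>j\<close> in homological degree \<open>i\<close> does not depend on its choice. The definition
  is meaningful for graded ideals \<open>J\<close> of the polynomial ring in a finite set \<open>V\<close>.\<close>

definition graded_betti :: "'v set \<Rightarrow> ('v, 'k::field) mpoly set \<Rightarrow> nat \<Rightarrow> nat \<Rightarrow> nat" where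
  "graded_betti V J i j =
     (THE n. \<exists>b d \<phi>. minimal_graded_free_resolution V J b d \<phi> \<and> n = card {k. k < b i \<and> d i k = j})"

text \<open>For a nonzero graded ideal \<open>J\<close> and finite \<open>V\<close> the set below is nonempty, and it is finite by
  Hilbert's syzygy theorem.\<close>

definition regularity :: "'v set \<Rightarrow> ('v, 'k::field) mpoly set \<Rightarrow> int" where
  "regularity V J = Max {int j - int i |i j. graded_betti V J i j \<noteq> 0}"

datatype whisker_vertex = X nat | Y nat

definition whiskered_cycle :: "nat \<Rightarrow> whisker_vertex graph" where
  "whiskered_cycle m =
     (X ` {1..m} \<union> Y ` {1..m},
      {{X i, X (i + 1)} |i. 1 \<le> i \<and> i < m} \<union> {{X 1, X m}} \<union> {{X i, Y i} |i. 1 \<le> i \<and> i \<le> m})"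

end

theory Submission
  imports Defs "HOL-Library.Countable" "HOL-Library.Function_Algebras"
begin

text \<open>
  A square-free monomial ideal corresponds to an up-closed family \<open>U\<close> of vertex sets, and its Betti
  number in multidegree \<open>S\<close> is the homology of the simplicial complex of all \<open>\<sigma> \<subseteq> S\<close> with
  \<open>S - \<sigma> \<in> U\<close>. Splitting this complex at a vertex \<open>x\<close> into deletion and link shows that the
  regularity of an ideal \<open>I\<close> is at most the maximum of \<open>reg I\<^sub>0\<close> and \<open>reg (I : x) + 1\<close>, where
  \<open>I\<^sub>0\<close> is generated by the generators of \<open>I\<close> not involving \<open>x\<close>. Splitting at the cycle vertices
  reduces the upper bound to whiskered paths and to edge ideals, whose regularity is at most one more
  than the number of cliques needed to partition some vertex cover.

  For the lower bound restrict to the path \<open>y\<^sub>1 x\<^sub>1 x\<^sub>2 y\<^sub>2\<close> and the whiskers at \<open>x\<^sub>4, x\<^sub>6, \<dots>\<close>.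
  There \<open>I(G)\<^sup>[\<^sup>2\<^sup>]\<close> lies in the complete intersection generated by \<open>x\<^sub>1 y\<^sub>1 x\<^sub>2 y\<^sub>2\<close> and these
  whiskers, and a cycle whose class survives in the homology of the complete intersection already
  lives in the complex of \<open>I(G)\<^sup>[\<^sup>2\<^sup>]\<close>; each further whisker suspends it.
\<close>

section \<open>Koszul chains\<close>

text \<open>\<open>graded_betti\<close> is a definite description over all minimal resolutions by
  polynomial matrices. So before homology can say anything about \<open>regularity\<close>, one
  resolution has to be built and its ranks shown to be unique. Building it is finite linear algebra,
  because a square-free module is determined by its pieces in the degrees
  \<open>S \<subseteq> V\<close>; the monomials are put back afterwards. The link to Koszul homology
  is dimension shifting along the resolution. The constants: 4 is the degree of the generator on the
  whiskers at 1 and 2, in homological degree 0, and each further whisker adds two to the degree and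
  one to the homological degree. The cycle has room for (m - 3) div 2 further whiskers that are
  joined neither to each other nor to these two. The obstacle to the upper bound is parity. After
  the splits at \<open>X m\<close> and \<open>X 1\<close> there remains an edge ideal whose evident
  covering path is one vertex too long when m is even; a further split at \<open>X 2\<close> repairs
  this.\<close>

definition sg :: "'v::countable \<Rightarrow> 'v set \<Rightarrow> 'a::ab_group_add \<Rightarrow> 'a" where
  "sg v \<sigma> a = (if even (card {u \<in> \<sigma>. to_nat u < to_nat v}) then a else - a)"

text \<open>A chain is stored as its coefficient function on faces, so the coefficient of the
  boundary at \<sigma> collects the faces with one more vertex. The order behind the signs is the
  one induced by \<open>to_nat\<close>.\<close>

definition bd :: "'v::countable set \<Rightarrow> ('v set \<Rightarrow> 'a::ab_group_add) \<Rightarrow> 'v set \<Rightarrow> 'a" where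
  "bd S f \<sigma> = (if \<sigma> \<subseteq> S then \<Sum>v\<in>S - \<sigma>. sg v \<sigma> (f (insert v \<sigma>)) else 0)"

text \<open>The join with the apex x. The sign is chosen such that the boundary of the cone over a
  chain f without x is f minus the cone over the boundary of f.\<close>

definition cone :: "'v::countable \<Rightarrow> ('v set \<Rightarrow> 'a::ab_group_add) \<Rightarrow> 'v set \<Rightarrow> 'a" where
  "cone x f \<sigma> = (if x \<in> \<sigma> then sg x (\<sigma> - {x}) (f (\<sigma> - {x})) else 0)"

text \<open>The part of multidegree S of the Koszul complex with coefficients in M: the exterior
  generator of a face \<sigma> uses up the degree \<sigma>, which leaves
  \<open>M (S - \<sigma>)\<close>. Multiplication by a variable is the inclusion of
  \<open>M S\<close> in \<open>M T\<close>. The index p counts vertices, so the empty face sits in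
  degree 0.\<close>

definition chains :: "'v set \<Rightarrow> ('v set \<Rightarrow> 'a::ab_group_add set) \<Rightarrow> nat \<Rightarrow> ('v set \<Rightarrow> 'a) set" where
  "chains S M p = {f. \<forall>\<sigma>. f \<sigma> \<noteq> 0 \<longrightarrow> \<sigma> \<subseteq> S \<and> card \<sigma> = p \<and> f \<sigma> \<in> M (S - \<sigma>)}"

text \<open>For finite S, exactness at 0 means that \<open>M S\<close> is spanned by the smaller
  pieces \<open>M (S - {v})\<close>, i.e. that no minimal generator has degree S.\<close>

definition exact_at :: "('v::countable set \<Rightarrow> 'a::ab_group_add set) \<Rightarrow> nat \<Rightarrow> 'v set \<Rightarrow> bool" where
  "exact_at M p S \<longleftrightarrow> (\<forall>f\<in>chains S M p. bd S f = 0 \<longrightarrow> (\<exists>g\<in>chains S M (Suc p). bd S g = f))"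

definition subgroup_family :: "('v set \<Rightarrow> 'a::ab_group_add set) \<Rightarrow> bool" where
  "subgroup_family M \<longleftrightarrow>
     (\<forall>S. 0 \<in> M S \<and> (\<forall>a\<in>M S. \<forall>b\<in>M S. a - b \<in> M S)) \<and> (\<forall>S T. S \<subseteq> T \<longrightarrow> M S \<subseteq> M T)"

lemma sg_add: "sg v \<sigma> (a + b) = sg v \<sigma> a + sg v \<sigma> b"
  and sg_minus: "sg v \<sigma> (- a) = - sg v \<sigma> a"
  and sg_diff: "sg v \<sigma> (a - b) = sg v \<sigma> a - sg v \<sigma> b"
  and sg_zero [simp]: "sg v \<sigma> 0 = 0"
  and sg_sg [simp]: "sg v \<sigma> (sg v \<sigma> a) = a"
  and sg_eq_0_iff [simp]: "sg v \<sigma> a = 0 \<longleftrightarrow> a = 0"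
  by (auto simp: sg_def)

lemma sg_sum: "sg v \<sigma> (sum f A) = (\<Sum>i\<in>A. sg v \<sigma> (f i))"
  by (auto simp: sg_def sum_negf)

lemma sg_hom:
  assumes "\<And>a. h (- a) = - h a"
  shows "h (sg v \<sigma> a) = sg v \<sigma> (h a)"
  by (simp add: sg_def assms)

lemma sg_insert:
  assumes "finite \<sigma>" "x \<notin> \<sigma>"
  shows "sg v (insert x \<sigma>) a = (if to_nat x < to_nat v then - sg v \<sigma> a else sg v \<sigma> a)"
proof -
  have "{u \<in> insert x \<sigma>. to_nat u < to_nat v} =
    (if to_nat x < to_nat v then insert x {u \<in> \<sigma>. to_nat u < to_nat v} else {u \<in> \<sigma>. to_nat u < to_nat v})"
    by auto
  then show ?thesis
    using assms by (simp add: sg_def)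
qed

text \<open>Exactly one of x and v precedes the other, so inserting them in the two possible orders
  produces opposite signs. This is the cancellation behind \<open>bd_bd\<close>.\<close>

lemma sg_swap:
  assumes "finite \<rho>" "x \<notin> \<rho>" "v \<notin> \<rho>" "x \<noteq> v"
  shows "sg v (insert x \<rho>) (sg x (insert v \<rho>) a) = - sg x \<rho> (sg v \<rho> a)"
proof -
  have "to_nat x < to_nat v \<longleftrightarrow> \<not> to_nat v < to_nat x"
    using assms(4) by (metis from_nat_to_nat linorder_neqE_nat order_less_asym)
  then show ?thesis
    using assms by (simp add: sg_insert sg_minus) (simp add: sg_def)
qed

lemma sg_mem:
  "subgroup_family M \<Longrightarrow> a \<in> M S \<Longrightarrow> sg v \<sigma> a \<in> M S"
  by (auto simp: sg_def subgroup_family_def) (metis diff_0)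

lemma subgroup_family_add:
  "subgroup_family M \<Longrightarrow> a \<in> M S \<Longrightarrow> b \<in> M S \<Longrightarrow> a + b \<in> M S"
  unfolding subgroup_family_def by (metis diff_0 diff_minus_eq_add)

lemma subgroup_family_sum:
  assumes "subgroup_family M" "\<And>i. i \<in> A \<Longrightarrow> f i \<in> M S"
  shows "sum f A \<in> M S"
  using assms(2)
  by (induction A rule: infinite_finite_induct)
    (use assms(1) in \<open>auto simp: subgroup_family_add\<close>, auto simp: subgroup_family_def)

lemma bd_add: "bd S (\<lambda>\<sigma>. f \<sigma> + g \<sigma>) \<tau> = bd S f \<tau> + bd S g \<tau>"
  by (simp add: bd_def sg_add sum.distrib)

lemma bd_diff: "bd S (\<lambda>\<sigma>. f \<sigma> - g \<sigma>) \<tau> = bd S f \<tau> - bd S g \<tau>"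
  by (simp add: bd_def sg_diff sum_subtractf)

lemma bd_hom:
  fixes f :: "'v::countable set \<Rightarrow> 'a::ab_group_add" and h :: "'a \<Rightarrow> 'b::ab_group_add"
  assumes "\<And>a b. h (a + b) = h a + h b" "\<And>a. h (- a) = - h a" "h 0 = 0"
  shows "h (bd S f \<sigma>) = bd S (\<lambda>\<tau>. h (f \<tau>)) \<sigma>"
proof -
  have "h (sum k A) = (\<Sum>v\<in>A. h (k v))" for k and A :: "'v set"
    by (induction A rule: infinite_finite_induct) (auto simp: assms)
  then show ?thesis
    by (simp add: bd_def sg_hom[of h] assms)
qed

lemma bd_cong:
  assumes "\<And>v. v \<in> S - \<sigma> \<Longrightarrow> f (insert v \<sigma>) = g (insert v \<sigma>)"
  shows "bd S f \<sigma> = bd S g \<sigma>"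
  unfolding bd_def using assms by (intro if_cong sum.cong refl) simp

lemma bd_zero [simp]: "bd S (\<lambda>_. 0) \<sigma> = 0"
  by (simp add: bd_def)

text \<open>A chain over \<open>insert x S\<close> is a pair: its values on faces without x and its
  values on faces with x, its link part. This lemma and the next express the boundary through the
  pair; all later arguments that split at a vertex rest on them.\<close>

lemma bd_insert:
  assumes "x \<notin> S" "finite S" "\<sigma> \<subseteq> S"
  shows "bd (insert x S) f \<sigma> = sg x \<sigma> (f (insert x \<sigma>)) + bd S f \<sigma>"
proof -
  have "insert x S - \<sigma> = insert x (S - \<sigma>)"
    using assms by auto
  then show ?thesis
    using assms by (auto simp: bd_def)
qed

lemma bd_insert':
  assumes "x \<notin> S" "finite S" "\<sigma> \<subseteq> S"
  shows "bd (insert x S) f (insert x \<sigma>) = - sg x \<sigma> (bd S (\<lambda>\<rho>. sg x \<rho> (f (insert x \<rho>))) \<sigma>)"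
proof -
  have fin: "finite \<sigma>" and x: "x \<notin> \<sigma>"
    using assms finite_subset by auto
  have "insert x S - insert x \<sigma> = S - \<sigma>"
    using assms by auto
  then have "bd (insert x S) f (insert x \<sigma>) = (\<Sum>v\<in>S - \<sigma>. sg v (insert x \<sigma>) (f (insert v (insert x \<sigma>))))"
    using assms by (auto simp: bd_def)
  also have "\<dots> = (\<Sum>v\<in>S - \<sigma>. - sg x \<sigma> (sg v \<sigma> (sg x (insert v \<sigma>) (f (insert x (insert v \<sigma>))))))"
  proof (rule sum.cong)
    fix v assume v: "v \<in> S - \<sigma>"
    then have "v \<noteq> x" using assms by auto
    then show "sg v (insert x \<sigma>) (f (insert v (insert x \<sigma>))) =
       - sg x \<sigma> (sg v \<sigma> (sg x (insert v \<sigma>) (f (insert x (insert v \<sigma>)))))"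
      using sg_swap[OF fin x, of v "sg x (insert v \<sigma>) (f (insert x (insert v \<sigma>)))"] v
      by (simp add: insert_commute)
  qed simp
  also have "\<dots> = - sg x \<sigma> (bd S (\<lambda>\<rho>. sg x \<rho> (f (insert x \<rho>))) \<sigma>)"
    using assms by (simp add: bd_def sg_sum sum_negf)
  finally show ?thesis .
qed

lemma bd_outside: "\<not> \<sigma> \<subseteq> S \<Longrightarrow> bd S f \<sigma> = 0"
  by (simp add: bd_def)

lemma bd_eq_zeroI: "(\<And>\<sigma>. \<sigma> \<subseteq> S \<Longrightarrow> bd S f \<sigma> = 0) \<Longrightarrow> bd S f = 0"
  by (rule ext) (metis bd_outside zero_fun_apply)

text \<open>Induction on S. With F the link part of f at x, the boundary is F plus
  \<open>bd S f\<close> on faces without x, and its link part is the negative of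
  \<open>bd S F\<close>. Applying the boundary once more, the two copies of \<open>bd S F\<close>
  cancel.\<close>

lemma bd_bd:
  assumes "finite S"
  shows "bd S (bd S f) = 0"
  using assms
proof (induction S arbitrary: f)
  case empty
  then show ?case by (auto simp: bd_def)
next
  case (insert x S)
  show ?case
  proof (rule bd_eq_zeroI)
    fix \<sigma> assume \<sigma>: "\<sigma> \<subseteq> insert x S"
    define \<tau> where "\<tau> = \<sigma> - {x}"
    have \<tau>: "\<tau> \<subseteq> S" using \<sigma> \<tau>_def by auto
    define F where "F = (\<lambda>\<rho>. sg x \<rho> (f (insert x \<rho>)))"
    have A: "bd S (\<lambda>\<rho>. sg x \<rho> (bd (insert x S) f (insert x \<rho>))) \<rho> = 0" for \<rho>
    proof -
      have "bd S (\<lambda>\<rho>. sg x \<rho> (bd (insert x S) f (insert x \<rho>))) \<rho> = bd S (\<lambda>\<rho>. - bd S F \<rho>) \<rho>"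
        unfolding bd_def[of S _ \<rho>]
        by (intro if_cong sum.cong refl arg_cong[where f = "sg _ _"])
          (use insert.hyps in \<open>auto simp: bd_insert' sg_minus F_def\<close>)
      also have "\<dots> = - bd S (bd S F) \<rho>"
        by (rule bd_hom[symmetric]) auto
      finally show ?thesis using insert.IH[of F] by simp
    qed
    show "bd (insert x S) (bd (insert x S) f) \<sigma> = 0"
    proof (cases "x \<in> \<sigma>")
      case True
      then have "\<sigma> = insert x \<tau>" by (auto simp: \<tau>_def)
      then show ?thesis
        using bd_insert'[OF insert.hyps(2,1) \<tau>, of "bd (insert x S) f"] A by simp
    next
      case False
      then have [simp]: "\<sigma> = \<tau>" by (auto simp: \<tau>_def)
      have "bd S (bd (insert x S) f) \<tau> = bd S (\<lambda>\<rho>. F \<rho> + bd S f \<rho>) \<tau>"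
        unfolding bd_def[of S _ \<tau>]
        by (intro if_cong sum.cong refl arg_cong[where f = "sg _ _"])
          (use insert.hyps in \<open>auto simp: bd_insert F_def\<close>)
      also have "\<dots> = bd S F \<tau>"
        using insert.IH[of f] by (simp add: bd_add)
      finally show ?thesis
        using bd_insert[OF insert.hyps(2,1) \<tau>, of "bd (insert x S) f"]
          bd_insert'[OF insert.hyps(2,1) \<tau>, of f]
        by (simp add: F_def sg_minus)
    qed
  qed
qed

lemma bd_cone_notin:
  assumes "x \<notin> S" "finite S" "\<sigma> \<subseteq> S"
  shows "bd (insert x S) (cone x f) \<sigma> = f \<sigma>"
proof -
  have "bd S (cone x f) \<sigma> = 0"
    using assms by (auto simp: bd_def cone_def intro!: sum.neutral)
  moreover have "x \<notin> \<sigma>" using assms by auto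
  ultimately show ?thesis
    using assms by (simp add: bd_insert cone_def)
qed

lemma bd_cone_in:
  assumes "x \<notin> S" "finite S" "\<sigma> \<subseteq> S"
  shows "bd (insert x S) (cone x f) (insert x \<sigma>) = - sg x \<sigma> (bd S f \<sigma>)"
proof -
  have "sg x \<rho> (cone x f (insert x \<rho>)) = f \<rho>" if "x \<notin> \<rho>" for \<rho>
    using that by (simp add: cone_def)
  moreover have "x \<notin> \<sigma>" using assms by auto
  ultimately have "bd S (\<lambda>\<rho>. sg x \<rho> (cone x f (insert x \<rho>))) \<sigma> = bd S f \<sigma>"
    using assms(1) by (intro bd_cong) (metis DiffD1 insertE)
  then show ?thesis
    using assms by (simp add: bd_insert')
qed

text \<open>The cone only sees the values of f on faces without x. For a cycle these determine the
  values on faces with x, so the boundary of the cone returns all of f.\<close>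

lemma bd_cone_cycle:
  assumes "finite S" "x \<in> S" "bd S f = 0" "\<And>\<sigma>. f \<sigma> \<noteq> 0 \<Longrightarrow> \<sigma> \<subseteq> S"
  shows "bd S (cone x f) = f"
proof
  fix \<sigma>
  define T where "T = S - {x}"
  have S: "S = insert x T" "x \<notin> T" "finite T"
    using assms by (auto simp: T_def)
  show "bd S (cone x f) \<sigma> = f \<sigma>"
  proof (cases "\<sigma> \<subseteq> S")
    case False
    then show ?thesis using assms(4) by (auto simp: bd_def)
  next
    case sub: True
    define \<tau> where "\<tau> = \<sigma> - {x}"
    have \<tau>: "\<tau> \<subseteq> T" using sub by (auto simp: \<tau>_def T_def)
    show ?thesis
    proof (cases "x \<in> \<sigma>")
      case False
      then have "\<sigma> = \<tau>" by (auto simp: \<tau>_def)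
      then show ?thesis using bd_cone_notin[OF S(2,3) \<tau>] S(1) by simp
    next
      case True
      then have \<sigma>: "\<sigma> = insert x \<tau>" by (auto simp: \<tau>_def)
      have "0 = sg x \<tau> (f (insert x \<tau>)) + bd T f \<tau>"
        using bd_insert[OF S(2,3) \<tau>, of f] assms(3) S(1) by (simp add: fun_eq_iff)
      then have "bd T f \<tau> = - sg x \<tau> (f (insert x \<tau>))"
        by (simp add: eq_neg_iff_add_eq_0 add.commute)
      then show ?thesis
        using bd_cone_in[OF S(2,3) \<tau>, of f] S(1) \<sigma> by (simp add: sg_minus)
    qed
  qed
qed

lemma chains_bd:
  assumes "finite S" "subgroup_family M" "f \<in> chains S M (Suc p)"
  shows "bd S f \<in> chains S M p"
  unfolding chains_def
proof safe
  fix \<sigma> assume nz: "bd S f \<sigma> \<noteq> 0"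
  then show sub: "\<And>x. x \<in> \<sigma> \<Longrightarrow> x \<in> S"
    by (auto simp: bd_def split: if_splits)
  from sub have sub': "\<sigma> \<subseteq> S" by auto
  have fin: "finite \<sigma>" using sub' assms(1) finite_subset by auto
  obtain v where "v \<in> S - \<sigma>" "f (insert v \<sigma>) \<noteq> 0"
    using nz sub' by (auto simp: bd_def intro!: sum.neutral split: if_splits)
      (metis (mono_tags, lifting) DiffI Diff_iff sg_zero sum.neutral)
  then show "card \<sigma> = p"
    using assms(3) fin by (auto simp: chains_def)
  have "sg v \<sigma> (f (insert v \<sigma>)) \<in> M (S - \<sigma>)" if "v \<in> S - \<sigma>" for v
  proof (cases "f (insert v \<sigma>) = 0")
    case True
    then show ?thesis using assms(2) by (simp add: subgroup_family_def)
  next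
    case False
    then have "f (insert v \<sigma>) \<in> M (S - insert v \<sigma>)"
      using assms(3) by (auto simp: chains_def)
    moreover have "S - insert v \<sigma> \<subseteq> S - \<sigma>"
      by auto
    then have "M (S - insert v \<sigma>) \<subseteq> M (S - \<sigma>)"
      using assms(2) unfolding subgroup_family_def by blast
    ultimately show ?thesis using sg_mem[OF assms(2)] by blast
  qed
  then show "bd S f \<sigma> \<in> M (S - \<sigma>)"
    using sub' by (auto simp: bd_def intro: subgroup_family_sum[OF assms(2)])
qed

lemma chains_diff:
  assumes "subgroup_family M" "f \<in> chains S M p" "g \<in> chains S M p"
  shows "(\<lambda>\<sigma>. f \<sigma> - g \<sigma>) \<in> chains S M p"
proof -
  have 0: "0 \<in> M T" for T using assms(1) by (auto simp: subgroup_family_def)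
  have d: "a \<in> M T \<Longrightarrow> b \<in> M T \<Longrightarrow> a - b \<in> M T" for a b T
    using assms(1) by (auto simp: subgroup_family_def)
  show ?thesis
    unfolding chains_def
  proof safe
    fix \<sigma> assume "f \<sigma> - g \<sigma> \<noteq> 0"
    then have *: "f \<sigma> \<noteq> 0 \<or> g \<sigma> \<noteq> 0" by auto
    then show "\<And>x. x \<in> \<sigma> \<Longrightarrow> x \<in> S" "card \<sigma> = p"
      using assms(2,3) by (auto simp: chains_def)
    have "f \<sigma> \<in> M (S - \<sigma>)" "g \<sigma> \<in> M (S - \<sigma>)"
      using assms(2,3) 0 unfolding chains_def by (metis (mono_tags, lifting) mem_Collect_eq)+
    then show "f \<sigma> - g \<sigma> \<in> M (S - \<sigma>)" by (rule d)
  qed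
qed

text \<open>The hypothesis on M keeps the cone with apex x inside the complex, so every cycle bounds
  its own cone.\<close>

lemma exact_at_cone:
  assumes "finite S" "subgroup_family M" "x \<in> S" "\<And>T. T \<subseteq> S \<Longrightarrow> M (insert x T) \<subseteq> M T"
  shows "exact_at M p S"
  unfolding exact_at_def
proof safe
  fix f assume f: "f \<in> chains S M p" "bd S f = 0"
  have "cone x f \<in> chains S M (Suc p)"
    unfolding chains_def
  proof safe
    fix \<sigma> assume nz: "cone x f \<sigma> \<noteq> 0"
    then have x: "x \<in> \<sigma>" and nz': "f (\<sigma> - {x}) \<noteq> 0"
      by (auto simp: cone_def split: if_splits)
    then have 1: "\<sigma> - {x} \<subseteq> S" "card (\<sigma> - {x}) = p" "f (\<sigma> - {x}) \<in> M (S - (\<sigma> - {x}))"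
      using f(1) by (auto simp: chains_def)
    then show "\<And>y. y \<in> \<sigma> \<Longrightarrow> y \<in> S" using assms(3) by auto
    have "finite (\<sigma> - {x})" using 1 assms(1) finite_subset by blast
    then show "card \<sigma> = Suc p" using 1 x by (metis card.remove finite_Diff_insert finite.emptyI Diff_empty)
    have "S - (\<sigma> - {x}) = insert x (S - \<sigma>)" using x assms(3) by auto
    with 1 have "f (\<sigma> - {x}) \<in> M (S - \<sigma>)"
      using assms(4)[of "S - \<sigma>"] by auto
    then show "cone x f \<sigma> \<in> M (S - \<sigma>)"
      using x sg_mem[OF assms(2)] by (auto simp: cone_def)
  qed
  moreover have "bd S (cone x f) = f"
    using bd_cone_cycle[OF assms(1,3) f(2)] f(1) by (auto simp: chains_def)
  ultimately show "\<exists>g\<in>chains S M (Suc p). bd S g = f" by blast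
qed

lemma subgroup_family_zero: "subgroup_family M \<Longrightarrow> 0 \<in> M S"
  by (simp add: subgroup_family_def)

lemma subgroup_family_diff: "subgroup_family M \<Longrightarrow> a \<in> M S \<Longrightarrow> b \<in> M S \<Longrightarrow> a - b \<in> M S"
  by (simp add: subgroup_family_def)

lemma subgroup_family_mono: "subgroup_family M \<Longrightarrow> S \<subseteq> T \<Longrightarrow> a \<in> M S \<Longrightarrow> a \<in> M T"
  unfolding subgroup_family_def by blast

lemma chainsD:
  assumes "f \<in> chains S M p" "f \<sigma> \<noteq> 0"
  shows "\<sigma> \<subseteq> S" "card \<sigma> = p" "f \<sigma> \<in> M (S - \<sigma>)"
  using assms by (auto simp: chains_def)

lemma chains_mem:
  assumes "subgroup_family M" "f \<in> chains S M p"
  shows "f \<sigma> \<in> M (S - \<sigma>)"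
  using assms by (cases "f \<sigma> = 0") (auto simp: subgroup_family_zero chains_def)

lemma chainsI:
  assumes "\<And>\<sigma>. f \<sigma> \<noteq> 0 \<Longrightarrow> \<sigma> \<subseteq> S" "\<And>\<sigma>. f \<sigma> \<noteq> 0 \<Longrightarrow> \<sigma> \<subseteq> S \<Longrightarrow> card \<sigma> = p"
    "\<And>\<sigma>. f \<sigma> \<noteq> 0 \<Longrightarrow> \<sigma> \<subseteq> S \<Longrightarrow> f \<sigma> \<in> M (S - \<sigma>)"
  shows "f \<in> chains S M p"
  unfolding chains_def using assms by blast

section \<open>Splitting the complex at a vertex\<close>

lemma exact_at_cong:
  assumes "\<And>T. T \<subseteq> S \<Longrightarrow> M T = N T"
  shows "exact_at M p S \<longleftrightarrow> exact_at N p S"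
proof -
  have "chains S M q = chains S N q" for q
    using assms by (auto simp: chains_def)
  then show ?thesis by (simp add: exact_at_def)
qed

text \<open>The relevant piece of the long exact sequence of a vertex: the homology at p lies
  between that of the deletion (faces without x, coefficients in \<open>M (insert x T)\<close>) and
  that of the link, whose degree is lower by one.\<close>

lemma exact_at_insert:
  assumes "finite S" "x \<notin> S" and M: "subgroup_family M"
    and del: "exact_at (\<lambda>T. M (insert x T)) p S"
    and link: "p = 0 \<or> exact_at M (p - 1) S"
  shows "exact_at M p (insert x S)"
  unfolding exact_at_def
proof safe
  fix f assume f: "f \<in> chains (insert x S) M p" and bf: "bd (insert x S) f = 0"
  have finS: "\<sigma> \<subseteq> S \<Longrightarrow> finite \<sigma>" and xS: "\<sigma> \<subseteq> S \<Longrightarrow> x \<notin> \<sigma>" for \<sigma>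
    using assms(1,2) finite_subset by auto
  have D1: "insert x S - insert x \<sigma> = S - \<sigma>" if "\<sigma> \<subseteq> S" for \<sigma>
    using assms(2) that by auto
  have D2: "insert x S - \<sigma> = insert x (S - \<sigma>)" if "\<sigma> \<subseteq> S" for \<sigma>
    using assms(2) that by auto
  have dich: "\<sigma> \<subseteq> S \<or> (\<exists>\<tau>\<subseteq>S. \<sigma> = insert x \<tau>)" if "\<sigma> \<subseteq> insert x S" for \<sigma>
    by (cases "x \<in> \<sigma>") (use that in \<open>auto intro!: exI[of _ "\<sigma> - {x}"]\<close>)
  \<comment> \<open>The link part of f, a cycle of the link because f is a cycle.\<close>
  define b where "b \<sigma> = (if \<sigma> \<subseteq> S then sg x \<sigma> (f (insert x \<sigma>)) else 0)" for \<sigma>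
  have bdb: "bd S b = 0"
  proof (rule bd_eq_zeroI)
    fix \<sigma> assume \<sigma>: "\<sigma> \<subseteq> S"
    have "bd S b \<sigma> = bd S (\<lambda>\<rho>. sg x \<rho> (f (insert x \<rho>))) \<sigma>"
      using \<sigma> by (intro bd_cong) (auto simp: b_def)
    then show "bd S b \<sigma> = 0"
      using bd_insert'[OF assms(2,1) \<sigma>, of f] bf by simp
  qed
  obtain b' where b': "b' \<in> chains S M p" "bd S b' = b"
  proof (cases p)
    case 0
    \<comment> \<open>In degree 0 only the empty face occurs, so there is no link part and nothing
      is asked of the link.\<close>
    have "b = 0"
    proof
      fix \<sigma>
      have "f (insert x \<sigma>) = 0" if "\<sigma> \<subseteq> S"
        using chainsD(2)[OF f, of "insert x \<sigma>"] 0 finS[OF that] by auto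
      then show "b \<sigma> = 0 \<sigma>" by (auto simp: b_def)
    qed
    moreover have "0 \<in> chains S M p" by (auto simp: chains_def)
    moreover have "bd S (0::'a set \<Rightarrow> 'b) = 0" by (auto simp: bd_def fun_eq_iff)
    ultimately show ?thesis using that by metis
  next
    case (Suc q)
    have "b \<in> chains S M q"
    proof (rule chainsI)
      fix \<sigma> assume nz: "b \<sigma> \<noteq> 0"
      then show sub: "\<sigma> \<subseteq> S" by (auto simp: b_def split: if_splits)
      have nz': "f (insert x \<sigma>) \<noteq> 0" using nz by (auto simp: b_def split: if_splits)
      show "card \<sigma> = q"
        using chainsD(2)[OF f nz'] finS[OF sub] xS[OF sub] Suc by simp
      show "b \<sigma> \<in> M (S - \<sigma>)"
        using chainsD(3)[OF f nz'] D1[OF sub] sub sg_mem[OF M] by (auto simp: b_def)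
    qed
    then show ?thesis
      using link Suc bdb that unfolding exact_at_def by auto
  qed
  define C where "C = cone x b'"
  have C: "C \<in> chains (insert x S) M (Suc p)"
  proof (rule chainsI)
    fix \<sigma> assume nz: "C \<sigma> \<noteq> 0"
    then have x: "x \<in> \<sigma>" and nz': "b' (\<sigma> - {x}) \<noteq> 0"
      by (auto simp: C_def cone_def split: if_splits)
    note * = chainsD[OF b'(1) nz']
    from *(1) show "\<sigma> \<subseteq> insert x S" by auto
    show "card \<sigma> = Suc p"
      using *(2) x finS[OF *(1)] card.remove[of \<sigma> x] by simp
    have "insert x S - \<sigma> = S - (\<sigma> - {x})" using x assms(2) by auto
    then show "C \<sigma> \<in> M (insert x S - \<sigma>)"
      using *(3) x sg_mem[OF M] by (auto simp: C_def cone_def)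
  qed
  have C1: "bd (insert x S) C \<sigma> = b' \<sigma>" if "\<sigma> \<subseteq> S" for \<sigma>
    unfolding C_def by (rule bd_cone_notin[OF assms(2,1) that])
  have C2: "bd (insert x S) C (insert x \<sigma>) = - f (insert x \<sigma>)" if "\<sigma> \<subseteq> S" for \<sigma>
    unfolding C_def using bd_cone_in[OF assms(2,1) that, of b'] b'(2) that by (simp add: b_def)
  \<comment> \<open>Adding the boundary of the cone over a filling of the link part cancels f on all
    faces with x. What is left is a cycle of the deletion.\<close>
  define c where "c \<sigma> = f \<sigma> + bd (insert x S) C \<sigma>" for \<sigma>
  have c1: "c \<sigma> = f \<sigma> + b' \<sigma>" if "\<sigma> \<subseteq> S" for \<sigma>
    using C1[OF that] by (simp add: c_def)
  have c2: "c (insert x \<sigma>) = 0" if "\<sigma> \<subseteq> S" for \<sigma>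
    using C2[OF that] by (simp add: c_def)
  have c3: "c \<sigma> = 0" if "\<not> \<sigma> \<subseteq> S" for \<sigma>
  proof (cases "\<sigma> \<subseteq> insert x S")
    case True
    then show ?thesis using dich[OF True] that c2 by auto
  next
    case False
    then show ?thesis using chainsD(1)[OF f] by (auto simp: c_def bd_outside)
  qed
  have cc: "c \<in> chains S (\<lambda>T. M (insert x T)) p"
  proof (rule chainsI)
    fix \<sigma> assume nz: "c \<sigma> \<noteq> 0"
    show sub: "\<sigma> \<subseteq> S" using c3 nz by auto
    show "card \<sigma> = p"
      using nz c1[OF sub] chainsD(2)[OF f, of \<sigma>] chainsD(2)[OF b'(1), of \<sigma>] by force
    have "b' \<sigma> \<in> M (insert x (S - \<sigma>))"
      using chains_mem[OF M b'(1)] by (rule subgroup_family_mono[OF M, rotated]) auto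
    then show "c \<sigma> \<in> M (insert x (S - \<sigma>))"
      using chains_mem[OF M f, of \<sigma>] D2[OF sub] by (simp add: c1[OF sub] subgroup_family_add[OF M])
  qed
  have bdc: "bd S c = 0"
  proof (rule bd_eq_zeroI)
    fix \<sigma> assume \<sigma>: "\<sigma> \<subseteq> S"
    have "bd (insert x S) c \<sigma> = 0"
      using bf bd_bd[of "insert x S" C] assms(1) bd_add[of "insert x S" f "bd (insert x S) C" \<sigma>]
      by (simp add: c_def[abs_def])
    then show "bd S c \<sigma> = 0"
      using bd_insert[OF assms(2,1) \<sigma>, of c] c2[OF \<sigma>] by simp
  qed
  obtain g where g: "g \<in> chains S (\<lambda>T. M (insert x T)) (Suc p)" "bd S g = c"
    using del cc bdc by (auto simp: exact_at_def)
  have gx: "g (insert x \<sigma>) = 0" for \<sigma>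
    using chainsD(1)[OF g(1), of "insert x \<sigma>"] assms(2) by auto
  have "g \<in> chains (insert x S) M (Suc p)"
  proof (rule chainsI)
    fix \<sigma> assume nz: "g \<sigma> \<noteq> 0"
    note * = chainsD[OF g(1) nz]
    show "\<sigma> \<subseteq> insert x S" "card \<sigma> = Suc p" using * by auto
    show "g \<sigma> \<in> M (insert x S - \<sigma>)" using * D2 by simp
  qed
  then have "(\<lambda>\<sigma>. g \<sigma> - C \<sigma>) \<in> chains (insert x S) M (Suc p)"
    by (rule chains_diff[OF M _ C])
  moreover have "bd (insert x S) (\<lambda>\<sigma>. g \<sigma> - C \<sigma>) = f"
  proof
    fix \<sigma>
    show "bd (insert x S) (\<lambda>\<sigma>. g \<sigma> - C \<sigma>) \<sigma> = f \<sigma>"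
    proof (cases "\<sigma> \<subseteq> insert x S")
      case False
      then show ?thesis using chainsD(1)[OF f, of \<sigma>] by (auto simp: bd_outside)
    next
      case True
      from dich[OF True] show ?thesis
      proof (elim disjE exE conjE)
        assume \<sigma>: "\<sigma> \<subseteq> S"
        show ?thesis
          using C1[OF \<sigma>] bd_insert[OF assms(2,1) \<sigma>, of g] g(2) gx c1[OF \<sigma>]
          by (simp add: bd_diff)
      next
        fix \<tau> assume \<tau>: "\<tau> \<subseteq> S" "\<sigma> = insert x \<tau>"
        have "bd (insert x S) g (insert x \<tau>) = 0"
          using bd_insert'[OF assms(2,1) \<tau>(1), of g] gx by simp
        then show ?thesis
          using C2[OF \<tau>(1)] \<tau>(2) by (simp add: bd_diff)
      qed
    qed
  qed
  ultimately show "\<exists>g\<in>chains (insert x S) M (Suc p). bd (insert x S) g = f" by blast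
qed

section \<open>Dimension shifting and free modules\<close>

lemma chains_lift:
  assumes f: "f \<in> chains S M p" and img: "\<And>T. T \<subseteq> S \<Longrightarrow> M T \<subseteq> h ` F T" and h0: "h 0 = 0"
  shows "\<exists>k\<in>chains S F p. \<forall>\<sigma>. h (k \<sigma>) = f \<sigma>"
proof -
  have "\<exists>u. u \<in> F (S - \<sigma>) \<and> h u = f \<sigma>" if "f \<sigma> \<noteq> 0" for \<sigma>
    using subsetD[OF img[of "S - \<sigma>"] chainsD(3)[OF f that]]
    by (metis Diff_subset imageE)
  then obtain u where u: "\<And>\<sigma>. f \<sigma> \<noteq> 0 \<Longrightarrow> u \<sigma> \<in> F (S - \<sigma>) \<and> h (u \<sigma>) = f \<sigma>"
    by metis
  have "(\<lambda>\<sigma>. if f \<sigma> = 0 then 0 else u \<sigma>) \<in> chains S F p"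
    by (rule chainsI) (use u chainsD[OF f] in \<open>auto split: if_splits\<close>)
  then show ?thesis
    by (rule bexI[rotated]) (use u h0 in auto)
qed

text \<open>The connecting homomorphism of the sequence 0, Z, F, M, 0. Exactness of F at p is
  replaced by \<open>ex0\<close>, about cycles with values in Z only: for p = 0 a free module does
  have homology, coming from its generators of degree S, and minimality of the resolution keeps Z
  away from it.\<close>

lemma exact_at_shift:
  fixes h :: "'a::ab_group_add \<Rightarrow> 'b::ab_group_add" and M :: "'v::countable set \<Rightarrow> 'b set"
  assumes fin: "finite S"
    and sub: "subgroup_family M" "subgroup_family F" "subgroup_family Z"
    and add: "\<And>a b. h (a + b) = h a + h b"
    and img: "\<And>T. T \<subseteq> S \<Longrightarrow> M T = h ` F T"
    and ker: "\<And>T. T \<subseteq> S \<Longrightarrow> Z T = {u \<in> F T. h u = 0}"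
    and ex: "exact_at F (Suc p) S"
    and ex0: "\<And>f. f \<in> chains S Z p \<Longrightarrow> bd S f = 0 \<Longrightarrow> \<exists>g\<in>chains S F (Suc p). bd S g = f"
  shows "exact_at M (Suc p) S \<longleftrightarrow> exact_at Z p S"
proof -
  have h0: "h 0 = 0" using add[of 0 0] by simp
  have hm: "h (- a) = - h a" for a
    using add[of a "- a"] h0 by (simp add: eq_neg_iff_add_eq_0 add.commute)
  have hd: "h (a - b) = h a - h b" for a b
    using add[of a "- b"] hm by simp
  have hbd: "h (bd S f \<sigma>) = bd S (\<lambda>\<tau>. h (f \<tau>)) \<sigma>" for f \<sigma>
    by (rule bd_hom[OF add hm h0])
  have img_ch: "(\<lambda>\<sigma>. h (f \<sigma>)) \<in> chains S M q" if f: "f \<in> chains S F q" for f q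
  proof (rule chainsI)
    fix \<sigma> assume "h (f \<sigma>) \<noteq> 0"
    then have nz: "f \<sigma> \<noteq> 0" using h0 by auto
    note * = chainsD[OF f nz]
    show "\<sigma> \<subseteq> S" "card \<sigma> = q" using * by auto
    show "h (f \<sigma>) \<in> M (S - \<sigma>)" using *(3) img[of "S - \<sigma>"] by auto
  qed
  have ker_ch: "f \<in> chains S Z q" if f: "f \<in> chains S F q" and "\<And>\<sigma>. \<sigma> \<subseteq> S \<Longrightarrow> h (f \<sigma>) = 0" for f q
    by (rule chainsI) (use chainsD[OF f] ker that(2) in \<open>auto\<close>)
  have ZF: "f \<in> chains S F q" if f: "f \<in> chains S Z q" for f q
  proof (rule chainsI)
    fix \<sigma> assume nz: "f \<sigma> \<noteq> 0"
    note * = chainsD[OF f nz]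
    show "\<sigma> \<subseteq> S" "card \<sigma> = q" using * by auto
    show "f \<sigma> \<in> F (S - \<sigma>)" using *(3) ker[of "S - \<sigma>"] by auto
  qed
  have Zh: "h (f \<sigma>) = 0" if f: "f \<in> chains S Z q" for f q \<sigma>
    using chainsD(3)[OF f, of \<sigma>] ker[of "S - \<sigma>"] h0 by (cases "f \<sigma> = 0") auto
  have lift: "\<exists>k\<in>chains S F q. \<forall>\<sigma>. h (k \<sigma>) = f \<sigma>" if fM: "f \<in> chains S M q" for f q
    by (rule chains_lift[OF fM]) (use img h0 in auto)
  show ?thesis
  proof
    assume M: "exact_at M (Suc p) S"
    show "exact_at Z p S"
      unfolding exact_at_def
    proof safe
      fix z assume z: "z \<in> chains S Z p" "bd S z = 0"
      obtain f where f: "f \<in> chains S F (Suc p)" "bd S f = z" using ex0[OF z] by blast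
      have "bd S (\<lambda>\<sigma>. h (f \<sigma>)) = 0"
        by (rule ext) (use hbd[of f] f(2) Zh[OF z(1)] in auto)
      then obtain m where m: "m \<in> chains S M (Suc (Suc p))" "bd S m = (\<lambda>\<sigma>. h (f \<sigma>))"
        using M img_ch[OF f(1)] unfolding exact_at_def by blast
      obtain f' where f': "f' \<in> chains S F (Suc (Suc p))" "\<And>\<sigma>. h (f' \<sigma>) = m \<sigma>"
        using lift[OF m(1)] by blast
      \<comment> \<open>The correction by a boundary leaves \<open>bd S w = z\<close> and makes the
        image under h vanish, so w has values in Z.\<close>
      define w where "w = (\<lambda>\<sigma>. f \<sigma> - bd S f' \<sigma>)"
      have w: "w \<in> chains S F (Suc p)"
        unfolding w_def by (intro chains_diff sub f(1) chains_bd fin f'(1))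
      moreover have "h (w \<sigma>) = 0" for \<sigma>
        using hbd[of f' \<sigma>] f'(2) m(2) by (simp add: w_def hd)
      ultimately have "w \<in> chains S Z (Suc p)" by (intro ker_ch) auto
      moreover have "bd S w = z"
        by (rule ext) (use f(2) bd_bd[OF fin, of f'] in \<open>auto simp: w_def bd_diff\<close>)
      ultimately show "\<exists>g\<in>chains S Z (Suc p). bd S g = z" by blast
    qed
  next
    assume Z: "exact_at Z p S"
    show "exact_at M (Suc p) S"
      unfolding exact_at_def
    proof safe
      fix m assume m: "m \<in> chains S M (Suc p)" "bd S m = 0"
      obtain f where f: "f \<in> chains S F (Suc p)" "\<And>\<sigma>. h (f \<sigma>) = m \<sigma>"
        using lift[OF m(1)] by blast
      have "bd S f \<in> chains S Z p"
        using chains_bd[OF fin sub(2) f(1)] hbd[of f] f(2) m(2) by (intro ker_ch) auto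
      then obtain z where z: "z \<in> chains S Z (Suc p)" "bd S z = bd S f"
        using Z bd_bd[OF fin, of f] unfolding exact_at_def by blast
      define w where "w = (\<lambda>\<sigma>. f \<sigma> - z \<sigma>)"
      have w: "w \<in> chains S F (Suc p)"
        unfolding w_def by (rule chains_diff[OF sub(2) f(1) ZF[OF z(1)]])
      moreover have "bd S w = 0"
        unfolding w_def using z(2) by (simp add: bd_diff fun_eq_iff)
      ultimately obtain f' where f': "f' \<in> chains S F (Suc (Suc p))" "bd S f' = w"
        using ex by (auto simp: exact_at_def)
      have "bd S (\<lambda>\<sigma>. h (f' \<sigma>)) = m"
        by (rule ext) (use hbd[of f'] f'(2) f(2) Zh[OF z(1)] in \<open>auto simp: w_def hd\<close>)
      then show "\<exists>g\<in>chains S M (Suc (Suc p)). bd S g = m"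
        using img_ch[OF f'(1)] by blast
    qed
  qed
qed

text \<open>The piece of degree S of a free module with basis degrees \<open>D k\<close>: the k-th
  summand contributes one dimension as soon as \<open>D k \<subseteq> S\<close>, so an element is
  its vector of coefficients.\<close>

definition free_family :: "nat \<Rightarrow> (nat \<Rightarrow> 'v set) \<Rightarrow> 'v set \<Rightarrow> (nat \<Rightarrow> 'a::zero) set" where
  "free_family b D S = {u. \<forall>k. u k \<noteq> 0 \<longrightarrow> k < b \<and> D k \<subseteq> S}"

lemma subgroup_family_free:
  "subgroup_family (free_family b D :: 'v set \<Rightarrow> (nat \<Rightarrow> 'a::ab_group_add) set)"
  unfolding subgroup_family_def free_family_def
proof (intro conjI allI ballI impI)
  fix S and u w :: "nat \<Rightarrow> 'a"
  assume "u \<in> {u. \<forall>k. u k \<noteq> 0 \<longrightarrow> k < b \<and> D k \<subseteq> S}" "w \<in> {u. \<forall>k. u k \<noteq> 0 \<longrightarrow> k < b \<and> D k \<subseteq> S}"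
  then have *: "u k \<noteq> 0 \<Longrightarrow> k < b \<and> D k \<subseteq> S" "w k \<noteq> 0 \<Longrightarrow> k < b \<and> D k \<subseteq> S" for k
    by auto
  have "u k \<noteq> 0 \<or> w k \<noteq> 0" if "(u - w) k \<noteq> 0" for k
    using that by auto
  then show "u - w \<in> {u. \<forall>k. u k \<noteq> 0 \<longrightarrow> k < b \<and> D k \<subseteq> S}"
    using * by blast
qed auto

text \<open>Each coordinate k is treated separately, by a cone whose apex is a vertex of S outside
  \<open>D k\<close>. Such an apex is missing only if \<open>D k = S\<close>; then only the empty
  face can carry the coordinate, which forces p = 0, the case excluded by the last
  hypothesis.\<close>

lemma free_family_boundary:
  assumes fin: "finite S" and f: "f \<in> chains S (free_family b D) p" "bd S f = 0"
    and p: "0 < p \<or> (\<forall>k. D k = S \<longrightarrow> f {} k = 0)"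
  shows "\<exists>g\<in>chains S (free_family b D) (Suc p). bd S g = f"
proof -
  define x where "x k = (SOME v. v \<in> S - D k)" for k
  have x: "x k \<in> S" "x k \<notin> D k" if "D k \<subset> S" for k
    using that someI_ex[of "\<lambda>v. v \<in> S - D k"] by (auto simp: x_def)
  have fk: "\<sigma> \<subseteq> S" "card \<sigma> = p" "k < b" "D k \<subseteq> S - \<sigma>" if "f \<sigma> k \<noteq> 0" for \<sigma> k
    using that chainsD[OF f(1), of \<sigma>] by (auto simp: free_family_def fun_eq_iff)
  define g where "g \<sigma> k = (if D k \<subset> S then cone (x k) (\<lambda>\<tau>. f \<tau> k) \<sigma> else 0)" for \<sigma> k
  have g: "\<sigma> \<subseteq> S" "card \<sigma> = Suc p" "k < b" "D k \<subseteq> S - \<sigma>" if "g \<sigma> k \<noteq> 0" for \<sigma> k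
  proof -
    have k: "D k \<subset> S" "x k \<in> \<sigma>" "f (\<sigma> - {x k}) k \<noteq> 0"
      using that by (auto simp: g_def cone_def split: if_splits)
    note * = fk[OF k(3)] and ** = x[OF k(1)]
    show "\<sigma> \<subseteq> S" "k < b" using * ** by auto
    show "card \<sigma> = Suc p"
      using *(2) k(2) finite_subset[OF *(1) fin] card.remove[of \<sigma> "x k"] by simp
    show "D k \<subseteq> S - \<sigma>" using *(4) **(2) by auto
  qed
  have "g \<in> chains S (free_family b D) (Suc p)"
  proof (rule chainsI)
    fix \<sigma> assume "g \<sigma> \<noteq> 0"
    then obtain k where k: "g \<sigma> k \<noteq> 0" by (auto simp: fun_eq_iff)
    show "\<sigma> \<subseteq> S" "card \<sigma> = Suc p" using g[OF k] by auto
    show "g \<sigma> \<in> free_family b D (S - \<sigma>)" using g[of \<sigma>] by (auto simp: free_family_def)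
  qed
  moreover have "bd S g = f"
  proof (intro ext)
    fix \<sigma> k
    have ev: "(bd S q \<sigma>) k = bd S (\<lambda>\<tau>. q \<tau> k) \<sigma>" for q :: "'a set \<Rightarrow> nat \<Rightarrow> 'b" and \<sigma>
      by (rule bd_hom[of "\<lambda>u. u k"]) auto
    show "bd S g \<sigma> k = f \<sigma> k"
    proof (cases "D k \<subset> S")
      case True
      have "bd S (cone (x k) (\<lambda>\<tau>. f \<tau> k)) = (\<lambda>\<tau>. f \<tau> k)"
      proof (rule bd_cone_cycle[OF fin x(1)[OF True]])
        show "bd S (\<lambda>\<tau>. f \<tau> k) = 0"
          by (rule ext) (use ev[of f] f(2) in \<open>auto simp: fun_eq_iff\<close>)
      qed (use fk in auto)
      then show ?thesis using ev[of g] True by (simp add: g_def)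
    next
      case False
      have "f \<sigma> k = 0"
      proof (rule ccontr)
        assume nz: "f \<sigma> k \<noteq> 0"
        note * = fk[OF nz]
        have "D k = S" "\<sigma> = {}" using False *(1,4) by auto
        then show False using p * nz by auto
      qed
      then show ?thesis using ev[of g] False by (simp add: g_def)
    qed
  qed
  ultimately show ?thesis by blast
qed

section \<open>Up-closed families and the regularity bound\<close>

definition upset :: "('v set \<Rightarrow> bool) \<Rightarrow> bool" where
  "upset U \<longleftrightarrow> (\<forall>S T. S \<subseteq> T \<longrightarrow> U S \<longrightarrow> U T)"

text \<open>The chains of the family of \<open>U\<close> at \<open>S\<close> are the simplicial chains of the complex of all
  \<open>\<sigma> \<subseteq> S\<close> with \<open>U (S - \<sigma>)\<close>, where a face with \<open>p\<close> vertices has degree \<open>p\<close>.\<close>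

definition upset_family :: "('v set \<Rightarrow> bool) \<Rightarrow> 'v set \<Rightarrow> 'a::zero set" where
  "upset_family U S = (if U S then UNIV else {0})"

text \<open>The bound j - i \<le> r for all nonzero Betti numbers. Quantifying over every finite S
  instead of the subsets of one vertex set lets the bound survive the removal of vertices.\<close>

definition reg_le :: "'a::ab_group_add itself \<Rightarrow> ('v::countable set \<Rightarrow> bool) \<Rightarrow> nat \<Rightarrow> bool" where
  "reg_le K U r \<longleftrightarrow>
     (\<forall>S p. finite S \<longrightarrow> \<not> exact_at (upset_family U :: 'v set \<Rightarrow> 'a set) p S \<longrightarrow> card S \<le> p + r)"

lemma upsetD: "upset U \<Longrightarrow> U S \<Longrightarrow> S \<subseteq> T \<Longrightarrow> U T"
  unfolding upset_def by blast

lemma subgroup_family_upset: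
  "upset U \<Longrightarrow> subgroup_family (upset_family U :: 'v set \<Rightarrow> 'a::ab_group_add set)"
  unfolding subgroup_family_def upset_family_def by (auto dest: upsetD)

lemma reg_le_mono: "reg_le K U r \<Longrightarrow> r \<le> s \<Longrightarrow> reg_le K U s"
  unfolding reg_le_def by (meson add_left_mono le_trans)

text \<open>The roles cross over: the deletion of x in the complex carries the colon ideal, the link
  carries the ideal of the generators without x. Passing to the deletion lowers
  \<open>card S\<close> but not p, hence the extra 1 for the colon ideal; passing to the link lowers
  both.\<close>

lemma reg_le_split:
  fixes K :: "'a::ab_group_add itself" and U :: "'v::countable set \<Rightarrow> bool"
  assumes U: "upset U"
    and del: "reg_le K (\<lambda>S. U (S - {x})) (Suc r)"
    and colon: "reg_le K (\<lambda>S. U (insert x S)) r"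
  shows "reg_le K U (Suc r)"
  unfolding reg_le_def
proof (intro allI impI)
  fix S p
  let ?F = "upset_family :: _ \<Rightarrow> _ \<Rightarrow> 'a set"
  assume fin: "finite S" and ne: "\<not> exact_at (?F U) p S"
  show "card S \<le> p + Suc r"
  proof (cases "x \<in> S")
    case False
    have "exact_at (?F U) p S = exact_at (?F (\<lambda>S. U (S - {x}))) p S"
    proof (rule exact_at_cong)
      fix T assume "T \<subseteq> S"
      with False have "T - {x} = T" by auto
      then show "?F U T = ?F (\<lambda>S. U (S - {x})) T" by (simp add: upset_family_def)
    qed
    then show ?thesis using del fin ne by (auto simp: reg_le_def)
  next
    case True
    define T where "T = S - {x}"
    have S: "S = insert x T" "x \<notin> T" "finite T" using True fin by (auto simp: T_def)
    have 1: "(\<lambda>T. ?F U (insert x T)) = ?F (\<lambda>S. U (insert x S))"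
      by (auto simp: upset_family_def fun_eq_iff)
    have "\<not> exact_at (?F (\<lambda>S. U (insert x S))) p T \<or> p \<noteq> 0 \<and> \<not> exact_at (?F U) (p - 1) T"
      using exact_at_insert[OF S(3,2) subgroup_family_upset[OF U], of p] ne S(1) 1 by metis
    then show ?thesis
    proof (elim disjE conjE)
      assume "\<not> exact_at (?F (\<lambda>S. U (insert x S))) p T"
      then show ?thesis using colon S by (auto simp: reg_le_def)
    next
      assume *: "p \<noteq> 0" "\<not> exact_at (?F U) (p - 1) T"
      have "exact_at (?F U) (p - 1) T = exact_at (?F (\<lambda>S. U (S - {x}))) (p - 1) T"
      proof (rule exact_at_cong)
        fix T' assume "T' \<subseteq> T"
        with S have "T' - {x} = T'" by auto
        then show "?F U T' = ?F (\<lambda>S. U (S - {x})) T'" by (simp add: upset_family_def)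
      qed
      then have "card T \<le> p - 1 + Suc r"
        using del[unfolded reg_le_def, rule_format, OF S(3), of "p - 1"] * by simp
      then show ?thesis using S *(1) by simp
    qed
  qed
qed

lemma reg_le_True:
  fixes K :: "'a::ab_group_add itself"
  shows "reg_le K (\<lambda>_. True) r"
  unfolding reg_le_def
proof (intro allI impI)
  fix S p
  let ?F = "upset_family (\<lambda>_. True) :: _ \<Rightarrow> 'a set"
  assume fin: "finite S" and ne: "\<not> exact_at ?F p S"
  have sub: "subgroup_family ?F" by (rule subgroup_family_upset) (simp add: upset_def)
  have "S = {}"
  proof (rule ccontr)
    assume "S \<noteq> {}"
    then obtain x where "x \<in> S" by auto
    then show False using exact_at_cone[OF fin sub, of x p] ne by (auto simp: upset_family_def)
  qed
  then show "card S \<le> p + r" by simp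
qed

lemma reg_le_False:
  fixes K :: "'a::ab_group_add itself"
  shows "reg_le K (\<lambda>_. False) r"
  unfolding reg_le_def
proof (intro allI impI)
  fix S p
  let ?F = "upset_family (\<lambda>_. False) :: _ \<Rightarrow> 'a set"
  assume fin: "finite S" and ne: "\<not> exact_at ?F p S"
  have "f = 0" if "f \<in> chains S ?F p" for f
    using chainsD(3)[OF that] by (auto simp: upset_family_def fun_eq_iff)
  moreover have "0 \<in> chains S ?F (Suc p)" "bd S (0 :: _ \<Rightarrow> 'a) = 0"
    by (auto simp: chains_def bd_def fun_eq_iff)
  ultimately have "exact_at ?F p S" unfolding exact_at_def by metis
  with ne show "card S \<le> p + r" by simp
qed

text \<open>Splitting at a variable of the ideal has the unit ideal as colon, so adding new
  variables costs nothing. The bound is a successor because an ideal generated by variables already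
  has regularity 1.\<close>

lemma reg_le_variables:
  assumes "upset U" "\<And>S. U (S - N) = U S" "reg_le K U (Suc r)" "finite A" "A \<subseteq> N"
  shows "reg_le K (\<lambda>S. S \<inter> A \<noteq> {} \<or> U S) (Suc r)"
  using assms(4,5)
proof (induction A rule: finite_induct)
  case empty
  then show ?case using assms(3) by simp
next
  case (insert x A)
  have U': "U (S - {x}) = U S" for S
  proof -
    have "S - {x} - N = S - N" using insert.prems by auto
    then show ?thesis using assms(2)[of S] assms(2)[of "S - {x}"] by simp
  qed
  show ?case
  proof (rule reg_le_split[where x = x])
    show "upset (\<lambda>S. S \<inter> insert x A \<noteq> {} \<or> U S)"
      using assms(1) unfolding upset_def by blast
    have "(\<lambda>S. (S - {x}) \<inter> insert x A \<noteq> {} \<or> U (S - {x})) = (\<lambda>S. S \<inter> A \<noteq> {} \<or> U S)"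
      using insert.hyps U' by (intro ext) auto
    then show "reg_le K (\<lambda>S. (S - {x}) \<inter> insert x A \<noteq> {} \<or> U (S - {x})) (Suc r)"
      using insert by simp
  qed (simp add: reg_le_True)
qed

section \<open>Minimal multigraded free resolutions\<close>

text \<open>The vector \<open>c l\<close> is the image of the l-th basis element, so this is the
  linear map with columns \<open>c l\<close>.\<close>

definition lincomb :: "nat \<Rightarrow> (nat \<Rightarrow> nat \<Rightarrow> 'k::field) \<Rightarrow> (nat \<Rightarrow> 'k) \<Rightarrow> nat \<Rightarrow> 'k" where
  "lincomb b c w k = (\<Sum>l<b. w l * c l k)"

definition subspace_family :: "('v set \<Rightarrow> (nat \<Rightarrow> 'k::field) set) \<Rightarrow> bool" where
  "subspace_family M \<longleftrightarrow> subgroup_family M \<and> (\<forall>S a. \<forall>u\<in>M S. (\<lambda>k. a * u k) \<in> M S)"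

interpretation fun_vs: vector_space "\<lambda>(a::'k::field) (u::nat \<Rightarrow> 'k) k. a * u k"
  by unfold_locales (auto simp: fun_eq_iff algebra_simps)

lemma sum_fun_apply: "(\<Sum>i\<in>A. f i) k = (\<Sum>i\<in>A. f i k)"
  for f :: "'i \<Rightarrow> 'x \<Rightarrow> 'a::comm_monoid_add"
  by (induction A rule: infinite_finite_induct) auto

lemma lincomb_add: "lincomb b c (u + w) = lincomb b c u + lincomb b c w"
  by (auto simp: lincomb_def fun_eq_iff sum.distrib algebra_simps)

lemma lincomb_diff: "lincomb b c (u - w) = lincomb b c u - lincomb b c w"
  by (auto simp: lincomb_def fun_eq_iff sum_subtractf algebra_simps)

lemma lincomb_scale: "lincomb b c (\<lambda>l. a * w l) = (\<lambda>k. a * lincomb b c w k)"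
  by (auto simp: lincomb_def sum_distrib_left algebra_simps)

lemma lincomb_zero: "lincomb b c 0 = 0"
  by (auto simp: lincomb_def)

lemma subspace_family_free:
  "subspace_family (free_family b D :: 'v set \<Rightarrow> (nat \<Rightarrow> 'k::field) set)"
  by (simp add: subspace_family_def subgroup_family_free) (auto simp: free_family_def)

lemma subspace_family_kernel:
  "subspace_family (\<lambda>S :: 'v set. {w \<in> free_family b D S. lincomb b c w = 0})"
proof -
  have F: "subgroup_family (free_family b D :: 'v set \<Rightarrow> (nat \<Rightarrow> 'a) set)"
    by (rule subgroup_family_free)
  have "subgroup_family (\<lambda>S :: 'v set. {w \<in> free_family b D S. lincomb b c w = 0})"
    unfolding subgroup_family_def
    using subgroup_family_zero[OF F] subgroup_family_diff[OF F] subgroup_family_mono[OF F]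
    by (auto simp: lincomb_zero lincomb_diff)
  moreover have "(\<lambda>k. a * u k) \<in> free_family b D S" if "u \<in> free_family b D S"
    for a and u :: "nat \<Rightarrow> 'a" and S :: "'v set"
    using that by (auto simp: free_family_def)
  ultimately show ?thesis
    by (auto simp: subspace_family_def lincomb_scale)
qed

definition generated :: "('v set \<times> (nat \<Rightarrow> 'k::field)) set \<Rightarrow> 'v set \<Rightarrow> (nat \<Rightarrow> 'k) set" where
  "generated P S = {\<Sum>x\<in>P. (\<lambda>k. w x * snd x k) |w. \<forall>x. w x \<noteq> 0 \<longrightarrow> fst x \<subseteq> S}"

lemma generated_subset:
  assumes M: "subspace_family M" and P: "\<And>T u. (T, u) \<in> P \<Longrightarrow> u \<in> M T"
  shows "generated P S \<subseteq> M S"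
proof
  fix u assume "u \<in> generated P S"
  then obtain w where u: "u = (\<Sum>x\<in>P. (\<lambda>k. w x * snd x k))" and w: "\<And>x. w x \<noteq> 0 \<Longrightarrow> fst x \<subseteq> S"
    unfolding generated_def by blast
  have sg: "subgroup_family M" using M by (simp add: subspace_family_def)
  have "(\<lambda>k. w x * snd x k) \<in> M S" if "x \<in> P" for x
  proof (cases "w x = 0")
    case True
    then show ?thesis using subgroup_family_zero[OF sg, of S] by (simp add: zero_fun_def)
  next
    case False
    then have "snd x \<in> M S"
      using P[of "fst x" "snd x"] that subgroup_family_mono[OF sg w[OF False]] by simp
    then show ?thesis using M by (auto simp: subspace_family_def)
  qed
  then show "u \<in> M S" unfolding u by (rule subgroup_family_sum[OF sg])
qed

text \<open>The bound n on the coordinates makes every piece finite-dimensional and V has finitely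
  many subsets, so the union of bases of all pieces is finite.\<close>

lemma ex_generating_set:
  assumes V: "finite V" and M: "subspace_family M" and bd: "\<forall>S. \<forall>u\<in>M S. \<forall>k. u k \<noteq> 0 \<longrightarrow> k < n"
  shows "\<exists>P. finite P \<and> (\<forall>(T, u)\<in>P. T \<subseteq> V \<and> u \<in> M T) \<and> (\<forall>S\<subseteq>V. M S = generated P S)"
proof -
  define e where "e i = (\<lambda>k. if k = i then 1 else 0 :: 'b)" for i :: nat
  have "\<exists>B. finite B \<and> B \<subseteq> M S \<and> M S \<subseteq> fun_vs.span B" for S
  proof -
    obtain B where B: "B \<subseteq> M S" "fun_vs.independent B" "M S \<subseteq> fun_vs.span B"
      using fun_vs.basis_exists[of "M S"] by metis
    have "M S \<subseteq> fun_vs.span (e ` {..<n})"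
    proof
      fix u assume u: "u \<in> M S"
      have "u = (\<Sum>i<n. (\<lambda>k. u i * e i k))"
      proof
        fix k
        have "(\<Sum>i<n. u i * e i k) = (\<Sum>i<n. if i = k then u k else 0)"
          by (rule sum.cong) (auto simp: e_def)
        also have "\<dots> = u k" using bd u by auto
        finally show "u k = (\<Sum>i<n. (\<lambda>k. u i * e i k)) k"
          by (simp add: sum_fun_apply)
      qed
      also have "\<dots> \<in> fun_vs.span (e ` {..<n})"
        by (intro fun_vs.span_sum fun_vs.span_scale fun_vs.span_base) auto
      finally show "u \<in> fun_vs.span (e ` {..<n})" .
    qed
    then have "finite B"
      using B fun_vs.independent_span_bound[of "e ` {..<n}" B] by auto
    then show ?thesis using B by blast
  qed
  then obtain B where B: "\<And>S. finite (B S)" "\<And>S. B S \<subseteq> M S" "\<And>S. M S \<subseteq> fun_vs.span (B S)"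
    by metis
  define P where "P = (SIGMA S:Pow V. B S)"
  have P: "finite P" using V B(1) by (auto simp: P_def)
  have PM: "u \<in> M T" if "(T, u) \<in> P" for T u using that B(2) by (auto simp: P_def)
  have "M S \<subseteq> generated P S" if S: "S \<subseteq> V" for S
  proof
    fix u assume "u \<in> M S"
    then have "u \<in> fun_vs.span (B S)" using B(3) by auto
    then obtain a where u: "u = (\<Sum>v\<in>B S. (\<lambda>k. a v * v k))"
      unfolding fun_vs.span_finite[OF B(1)] by auto
    define w where "w x = (if fst x = S then a (snd x) else 0)" for x
    have "(\<Sum>x\<in>P. (\<lambda>k. w x * snd x k)) = (\<Sum>T\<in>Pow V. \<Sum>v\<in>B T. (\<lambda>k. w (T, v) * v k))"
      unfolding P_def using V B(1) by (subst sum.Sigma) (auto simp: case_prod_unfold)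
    also have "\<dots> = (\<Sum>T\<in>Pow V. if T = S then u else 0)"
      unfolding u by (rule sum.cong) (auto simp: w_def fun_eq_iff)
    also have "\<dots> = u" using V S by simp
    finally show "u \<in> generated P S"
      unfolding generated_def by (intro CollectI exI[of _ w]) (simp add: w_def split: if_splits)
  qed
  then have "\<forall>S\<subseteq>V. M S = generated P S" using generated_subset[OF M PM] by blast
  moreover have "\<forall>(T, u)\<in>P. T \<subseteq> V \<and> u \<in> M T" using B(2) by (auto simp: P_def)
  ultimately show ?thesis using P by blast
qed

text \<open>A generating set of minimal cardinality admits no relation with a nonzero coefficient in its
  own degree: such a relation would express one generator through the others.\<close>

lemma ex_minimal_generating_set:
  assumes V: "finite V" and M: "subspace_family M" and bd: "\<forall>S. \<forall>u\<in>M S. \<forall>k. u k \<noteq> 0 \<longrightarrow> k < n"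
  shows "\<exists>P. finite P \<and> (\<forall>(T, u)\<in>P. T \<subseteq> V \<and> u \<in> M T) \<and> (\<forall>S\<subseteq>V. M S = generated P S) \<and>
    (\<forall>S\<subseteq>V. \<forall>w. (\<forall>x. w x \<noteq> 0 \<longrightarrow> fst x \<subseteq> S) \<longrightarrow> (\<Sum>x\<in>P. (\<lambda>k. w x * snd x k)) = 0 \<longrightarrow>
      (\<forall>x\<in>P. fst x = S \<longrightarrow> w x = 0))"
proof -
  define good where "good P \<longleftrightarrow> finite P \<and> (\<forall>(T, u)\<in>P. T \<subseteq> V \<and> u \<in> M T) \<and>
    (\<forall>S\<subseteq>V. M S = generated P S)" for P
  have "\<exists>P. good P" using ex_generating_set[OF assms] by (simp add: good_def)
  then obtain P where P: "good P" and min: "\<And>P'. good P' \<Longrightarrow> card P \<le> card P'"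
    using ex_has_least_nat[of good _ card] by metis
  have fin: "finite P" using P by (simp add: good_def)
  have key: "w x0 = 0"
    if S: "S \<subseteq> V" and w: "\<And>x. w x \<noteq> 0 \<Longrightarrow> fst x \<subseteq> S"
      and rel: "(\<Sum>x\<in>P. (\<lambda>k. w x * snd x k)) = 0" and x0: "x0 \<in> P" "fst x0 = S" for S w x0
  proof (rule ccontr)
    assume nz: "w x0 \<noteq> 0"
    have rel': "(\<Sum>x\<in>P. w x * snd x k) = 0" for k
      using fun_cong[OF rel, of k] by (simp add: sum_fun_apply)
    have "M T \<subseteq> generated (P - {x0}) T" if T: "T \<subseteq> V" for T
    proof
      fix u assume "u \<in> M T"
      then obtain v where u: "u = (\<Sum>x\<in>P. (\<lambda>k. v x * snd x k))" and v: "\<And>x. v x \<noteq> 0 \<Longrightarrow> fst x \<subseteq> T"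
        using P T unfolding good_def generated_def by blast
      \<comment> \<open>Subtracts the multiple of the relation that removes \<open>x0\<close>. All
        degrees stay inside T: the multiple is nonzero only if \<open>v x0 \<noteq> 0\<close>, and
        then T contains \<open>fst x0 = S\<close>, hence every degree occurring in the
        relation.\<close>
      define v' where "v' x = v x - v x0 / w x0 * w x" for x
      have "v' x0 = 0" using nz by (simp add: v'_def)
      have "fst x \<subseteq> T" if "v' x \<noteq> 0" for x
      proof (cases "v x = 0")
        case True
        then have "v x0 \<noteq> 0" "w x \<noteq> 0" using that by (auto simp: v'_def)
        then show ?thesis using v[of x0] w[of x] x0(2) by auto
      qed (use v in auto)
      moreover have "u = (\<Sum>x\<in>P - {x0}. (\<lambda>k. v' x * snd x k))"
      proof
        fix k
        have "(\<Sum>x\<in>P - {x0}. v' x * snd x k) = (\<Sum>x\<in>P. v' x * snd x k)"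
          using fin x0 \<open>v' x0 = 0\<close> by (intro sum.mono_neutral_left) auto
        also have "\<dots> = (\<Sum>x\<in>P. v x * snd x k) - v x0 / w x0 * (\<Sum>x\<in>P. w x * snd x k)"
          by (simp add: v'_def left_diff_distrib sum_subtractf sum_distrib_left mult.assoc)
        also have "\<dots> = u k" unfolding rel' by (simp add: u sum_fun_apply)
        finally show "u k = (\<Sum>x\<in>P - {x0}. (\<lambda>k. v' x * snd x k)) k"
          by (simp add: sum_fun_apply)
      qed
      ultimately show "u \<in> generated (P - {x0}) T" unfolding generated_def by blast
    qed
    moreover have "generated (P - {x0}) T \<subseteq> M T" for T
      using P by (intro generated_subset[OF M]) (auto simp: good_def)
    ultimately have "\<forall>T\<subseteq>V. M T = generated (P - {x0}) T" by blast
    then have "good (P - {x0})" using P by (auto simp: good_def)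
    then have "card P \<le> card (P - {x0})" by (rule min)
    then show False using x0(1) fin by (metis card_Diff1_less linorder_not_le)
  qed
  have m: "\<forall>S\<subseteq>V. \<forall>w. (\<forall>x. w x \<noteq> 0 \<longrightarrow> fst x \<subseteq> S) \<longrightarrow>
      (\<Sum>x\<in>P. (\<lambda>k. w x * snd x k)) = 0 \<longrightarrow> (\<forall>x\<in>P. fst x = S \<longrightarrow> w x = 0)"
  proof (intro allI impI ballI)
    fix S w x
    assume S: "S \<subseteq> V" and w: "\<forall>x. w x \<noteq> 0 \<longrightarrow> fst x \<subseteq> S"
      and rel: "(\<Sum>x\<in>P. (\<lambda>k. w x * snd x k)) = 0" and x: "x \<in> P" "fst x = S"
    show "w x = 0" by (rule key[OF S w[rule_format] rel x])
  qed
  show ?thesis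
    using P unfolding good_def by (elim conjE) (intro exI[of _ P] conjI m)
qed

text \<open>Numbers a minimal generating set, so that it becomes a free family with a linear map and
  minimality becomes a property of the kernel of that map.\<close>

lemma ex_minimal_generators:
  assumes V: "finite V" and M: "subspace_family M" and bd: "\<forall>S. \<forall>u\<in>M S. \<forall>k. u k \<noteq> 0 \<longrightarrow> k < n"
  shows "\<exists>b D c. (\<forall>l<b. D l \<subseteq> V \<and> c l \<in> M (D l)) \<and> (\<forall>S\<subseteq>V. M S = lincomb b c ` free_family b D S) \<and>
    (\<forall>S\<subseteq>V. \<forall>w\<in>free_family b D S. lincomb b c w = 0 \<longrightarrow> (\<forall>l. D l = S \<longrightarrow> w l = 0))"
proof -
  obtain P where P0: "finite P" "\<forall>(T, u)\<in>P. T \<subseteq> V \<and> u \<in> M T" "\<forall>S\<subseteq>V. M S = generated P S"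
    and min0: "\<forall>S\<subseteq>V. \<forall>w. (\<forall>x. w x \<noteq> 0 \<longrightarrow> fst x \<subseteq> S) \<longrightarrow> (\<Sum>x\<in>P. (\<lambda>k. w x * snd x k)) = 0 \<longrightarrow>
      (\<forall>x\<in>P. fst x = S \<longrightarrow> w x = 0)"
    using ex_minimal_generating_set[OF assms] by (elim exE conjE) (rule that)
  have P: "finite P" "\<And>T u. (T, u) \<in> P \<Longrightarrow> T \<subseteq> V \<and> u \<in> M T" "\<And>S. S \<subseteq> V \<Longrightarrow> M S = generated P S"
    using P0 by auto
  have min: "w x = 0" if "S \<subseteq> V" "\<forall>x. w x \<noteq> 0 \<longrightarrow> fst x \<subseteq> S"
    "(\<Sum>x\<in>P. (\<lambda>k. w x * snd x k)) = 0" "x \<in> P" "fst x = S" for S w x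
    by (rule min0[rule_format, OF that(1) _ that(3) that(4,5)]) (use that(2) in blast)
  obtain h where h: "bij_betw h {0..<card P} P"
    using ex_bij_betw_nat_finite[OF P(1)] by blast
  then have h: "bij_betw h {..<card P} P" by (simp add: atLeast0LessThan)
  define g where "g = the_inv_into {..<card P} h"
  have gh: "g (h l) = l" if "l < card P" for l
    unfolding g_def using h that by (intro the_inv_into_f_f) (auto simp: bij_betw_def)
  have hP: "h l \<in> P" if "l < card P" for l
    using h that by (auto simp: bij_betw_def)
  have gP: "g x < card P" "h (g x) = x" if "x \<in> P" for x
  proof -
    have "x \<in> h ` {..<card P}" using h that by (simp add: bij_betw_def)
    then show "g x < card P" "h (g x) = x" using gh by auto
  qed
  define D where "D l = fst (h l)" for l
  have gsub: "fst x \<subseteq> S" if "w \<in> free_family (card P) D S" "x \<in> P" "w (g x) \<noteq> 0" for w S x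
  proof -
    have "D (g x) \<subseteq> S" using that unfolding free_family_def by blast
    then show ?thesis using gP[OF that(2)] by (simp add: D_def)
  qed
  define c where "c l = snd (h l)" for l
  have lc: "lincomb (card P) c w = (\<Sum>x\<in>P. (\<lambda>k. w (g x) * snd x k))" for w
  proof
    fix k
    have "lincomb (card P) c w k = (\<Sum>l<card P. w (g (h l)) * snd (h l) k)"
      by (simp add: lincomb_def c_def gh)
    also have "\<dots> = (\<Sum>x\<in>P. w (g x) * snd x k)"
      by (rule sum.reindex_bij_betw[OF h])
    finally show "lincomb (card P) c w k = (\<Sum>x\<in>P. (\<lambda>k. w (g x) * snd x k)) k"
      by (simp add: sum_fun_apply)
  qed
  \<comment> \<open>The degree condition in the minimality statement ranges over all pairs, while g
    is meaningful only on P; hence the cutoff.\<close>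
  have lc': "lincomb (card P) c w = (\<Sum>x\<in>P. (\<lambda>k. (if x \<in> P then w (g x) else 0) * snd x k))" for w
    unfolding lc by (rule sum.cong) auto
  have "M S = lincomb (card P) c ` free_family (card P) D S" if S: "S \<subseteq> V" for S
  proof (intro equalityI subsetI)
    fix u assume "u \<in> M S"
    then obtain w where u: "u = (\<Sum>x\<in>P. (\<lambda>k. w x * snd x k))" "\<forall>x. w x \<noteq> 0 \<longrightarrow> fst x \<subseteq> S"
      using P(3)[OF S] unfolding generated_def by blast
    define w' where "w' l = (if l < card P then w (h l) else 0)" for l
    have "l < card P \<and> D l \<subseteq> S" if "w' l \<noteq> 0" for l
      using that u(2)[rule_format, of "h l"] by (simp add: w'_def D_def split: if_splits)
    then have "w' \<in> free_family (card P) D S" by (simp add: free_family_def)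
    moreover have "lincomb (card P) c w' = u"
      unfolding lc u by (rule sum.cong) (use gP in \<open>auto simp: w'_def\<close>)
    ultimately show "u \<in> lincomb (card P) c ` free_family (card P) D S" by blast
  next
    fix u assume "u \<in> lincomb (card P) c ` free_family (card P) D S"
    then obtain w where w: "w \<in> free_family (card P) D S" "u = lincomb (card P) c w" by blast
    have "\<forall>x. (if x \<in> P then w (g x) else 0) \<noteq> 0 \<longrightarrow> fst x \<subseteq> S"
      using gsub[OF w(1)] by (intro allI impI) (simp split: if_splits)
    then show "u \<in> M S"
      unfolding P(3)[OF S] generated_def w(2) lc'
      by (intro CollectI exI[of _ "\<lambda>x. if x \<in> P then w (g x) else 0"] conjI refl)
  qed
  moreover have "w l = 0" if S: "S \<subseteq> V" and w: "w \<in> free_family (card P) D S"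
    and z: "lincomb (card P) c w = 0" and l: "D l = S" for S w l
  proof (cases "l < card P")
    case False
    then show ?thesis using w by (auto simp: free_family_def)
  next
    case True
    have "(if h l \<in> P then w (g (h l)) else 0) = 0"
    proof (rule min[OF S, of "\<lambda>x. if x \<in> P then w (g x) else 0"])
      show "\<forall>x. (if x \<in> P then w (g x) else 0) \<noteq> 0 \<longrightarrow> fst x \<subseteq> S"
        using gsub[OF w] by (intro allI impI) (simp split: if_splits)
      show "(\<Sum>x\<in>P. (\<lambda>k. (if x \<in> P then w (g x) else 0) * snd x k)) = 0"
        using z lc' by simp
    qed (use hP True l in \<open>auto simp: D_def\<close>)
    then show ?thesis using True hP gh by simp
  qed
  moreover have "\<forall>l<card P. D l \<subseteq> V \<and> c l \<in> M (D l)"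
  proof (intro allI impI)
    fix l assume "l < card P"
    then have "(D l, c l) \<in> P" using hP by (simp add: D_def c_def)
    then show "D l \<subseteq> V \<and> c l \<in> M (D l)" by (rule P(2))
  qed
  ultimately show ?thesis by (intro exI[of _ "card P"] exI[of _ D] exI[of _ c]) blast
qed

text \<open>A frame is a multigraded free resolution of the square-free ideal of \<open>U\<close>, reduced to linear
  algebra: \<open>D i k\<close> is the degree of the \<open>k\<close>-th basis element of the \<open>i\<close>-th free module, the free
  module of index 0 is the ring itself, and \<open>M i S\<close> is the degree \<open>S\<close> part of the ideal (\<open>i = 0\<close>) or
  of the \<open>i\<close>-th syzygy module. These modules are determined by their square-free degrees.\<close>

definition frame :: "'v set \<Rightarrow> ('v set \<Rightarrow> bool) \<Rightarrow> (nat \<Rightarrow> nat) \<Rightarrow> (nat \<Rightarrow> nat \<Rightarrow> 'v set) \<Rightarrow>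
    (nat \<Rightarrow> nat \<Rightarrow> nat \<Rightarrow> 'k::field) \<Rightarrow> (nat \<Rightarrow> 'v set \<Rightarrow> (nat \<Rightarrow> 'k) set) \<Rightarrow> bool" where
  "frame V U b D c M \<longleftrightarrow>
     b 0 = 1 \<and> D 0 0 = {} \<and> (\<forall>S. M 0 S = (if U S then free_family 1 (\<lambda>_. {}) S else {0})) \<and>
     (\<forall>i. \<forall>l<b i. D i l \<subseteq> V) \<and>
     (\<forall>i. subspace_family (M i)) \<and>
     (\<forall>i S. M i S \<subseteq> free_family (b i) (D i) S) \<and>
     (\<forall>i. \<forall>l<b (Suc i). c i l \<in> M i (D (Suc i) l)) \<and>
     (\<forall>i. \<forall>S\<subseteq>V. M i S = lincomb (b (Suc i)) (c i) ` free_family (b (Suc i)) (D (Suc i)) S) \<and>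
     (\<forall>i S. M (Suc i) S = {w \<in> free_family (b (Suc i)) (D (Suc i)) S. lincomb (b (Suc i)) (c i) w = 0}) \<and>
     (\<forall>i. \<forall>S\<subseteq>V. \<forall>w\<in>M (Suc i) S. \<forall>l. D (Suc i) l = S \<longrightarrow> w l = 0)"

lemma frameD:
  "frame V U b D c M \<Longrightarrow> b 0 = 1"
  "frame V U b D c M \<Longrightarrow> D 0 0 = {}"
  "frame V U b D c M \<Longrightarrow> \<forall>S. M 0 S = (if U S then free_family 1 (\<lambda>_. {}) S else {0})"
  "frame V U b D c M \<Longrightarrow> \<forall>i. \<forall>l<b i. D i l \<subseteq> V"
  "frame V U b D c M \<Longrightarrow> \<forall>i. subspace_family (M i)"
  "frame V U b D c M \<Longrightarrow> \<forall>i S. M i S \<subseteq> free_family (b i) (D i) S"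
  "frame V U b D c M \<Longrightarrow> \<forall>i. \<forall>l<b (Suc i). c i l \<in> M i (D (Suc i) l)"
  "frame V U b D c M \<Longrightarrow> \<forall>i. \<forall>S\<subseteq>V. M i S = lincomb (b (Suc i)) (c i) ` free_family (b (Suc i)) (D (Suc i)) S"
  "frame V U b D c M \<Longrightarrow> \<forall>i S. M (Suc i) S = {w \<in> free_family (b (Suc i)) (D (Suc i)) S. lincomb (b (Suc i)) (c i) w = 0}"
  "frame V U b D c M \<Longrightarrow> \<forall>i. \<forall>S\<subseteq>V. \<forall>w\<in>M (Suc i) S. \<forall>l. D (Suc i) l = S \<longrightarrow> w l = 0"
  unfolding frame_def by (elim conjE, assumption)+

lemma frame_image: "frame V U b D c M \<Longrightarrow> S \<subseteq> V \<Longrightarrow>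
    M i S = lincomb (b (Suc i)) (c i) ` free_family (b (Suc i)) (D (Suc i)) S"
  by (drule frameD(8)) simp

lemma frame_kernel: "frame V U b D c M \<Longrightarrow>
    M (Suc i) S = {w \<in> free_family (b (Suc i)) (D (Suc i)) S. lincomb (b (Suc i)) (c i) w = 0}"
  by (drule frameD(9)) (erule allE, erule allE, assumption)

lemma frame_minimal: "frame V U b D c M \<Longrightarrow> S \<subseteq> V \<Longrightarrow> w \<in> M (Suc i) S \<Longrightarrow> D (Suc i) l = S \<Longrightarrow> w l = 0"
  using frameD(10)[rule_format] .

lemma frame_subspace: "frame V U b D c M \<Longrightarrow> subspace_family (M i)"
  by (drule frameD(5)) (erule allE, assumption)

text \<open>Dependent choice: each stage takes minimal generators of the current module and passes
  to the kernel of the map they define.\<close>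

lemma ex_frame:
  assumes V: "finite V" and U: "upset U"
  shows "\<exists>b D (c :: nat \<Rightarrow> nat \<Rightarrow> nat \<Rightarrow> 'k::field) M. frame V U b D c M"
proof -
  define M0 where "M0 S = (if U S then free_family 1 (\<lambda>_. {}) S else {0 :: nat \<Rightarrow> 'k})" for S
  define ok where "ok x \<longleftrightarrow> (case x of (b, D, c, M) \<Rightarrow> subspace_family M \<and> (\<forall>l<b. D l \<subseteq> V) \<and>
    (\<forall>S. M S \<subseteq> free_family b D S))"
    for x :: "nat \<times> (nat \<Rightarrow> 'a set) \<times> (nat \<Rightarrow> nat \<Rightarrow> 'k) \<times> ('a set \<Rightarrow> (nat \<Rightarrow> 'k) set)"
  define step where "step x y \<longleftrightarrow> (case x of (b, D, c, M) \<Rightarrow> case y of (b', D', c', M') \<Rightarrow>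
      (\<forall>l<b'. c' l \<in> M (D' l)) \<and>
      (\<forall>S\<subseteq>V. M S = lincomb b' c' ` free_family b' D' S) \<and>
      (\<forall>S. M' S = {w \<in> free_family b' D' S. lincomb b' c' w = 0}) \<and>
      (\<forall>S\<subseteq>V. \<forall>w\<in>M' S. \<forall>l. D' l = S \<longrightarrow> w l = 0))"
    for x y :: "nat \<times> (nat \<Rightarrow> 'a set) \<times> (nat \<Rightarrow> nat \<Rightarrow> 'k) \<times> ('a set \<Rightarrow> (nat \<Rightarrow> 'k) set)"
  have free0: "subspace_family (free_family 1 (\<lambda>_. {}) :: 'a set \<Rightarrow> (nat \<Rightarrow> 'k) set)"
    by (rule subspace_family_free)
  have const: "free_family 1 (\<lambda>_. {}) S = (free_family 1 (\<lambda>_. {}) T :: (nat \<Rightarrow> 'k) set)" for S T :: "'a set"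
    by (auto simp: free_family_def)
  have sg0: "subgroup_family M0"
    unfolding subgroup_family_def
  proof (intro conjI allI impI ballI)
    note F = free0[unfolded subspace_family_def, THEN conjunct1]
    show "0 \<in> M0 S" for S by (auto simp: M0_def free_family_def)
    show "a - a' \<in> M0 S" if "a \<in> M0 S" "a' \<in> M0 S" for S a a'
      using that subgroup_family_diff[OF F] by (auto simp: M0_def split: if_splits)
    show "M0 S \<subseteq> M0 T" if "S \<subseteq> T" for S T
      using that upsetD[OF U _ that] const[of S T] subgroup_family_zero[OF F] by (auto simp: M0_def)
  qed
  have "(\<lambda>k. a * u k) \<in> M0 S" if "u \<in> M0 S" for S a u
    using that free0 by (auto simp: M0_def subspace_family_def zero_fun_def split: if_splits)
  then have M0: "subspace_family M0" using sg0 by (simp add: subspace_family_def)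
  have "ok (1, \<lambda>_. {}, undefined, M0)"
    using M0 subgroup_family_zero[OF free0[unfolded subspace_family_def, THEN conjunct1]]
    by (auto simp: ok_def M0_def)
  moreover have "\<exists>y. ok y \<and> step x y" if "ok x" for x
  proof -
    obtain b D c M where x: "x = (b, D, c, M)" by (cases x) auto
    have M: "subspace_family M" "\<forall>S. M S \<subseteq> free_family b D S" using that by (auto simp: ok_def x)
    have bd: "\<forall>S. \<forall>u\<in>M S. \<forall>k. u k \<noteq> 0 \<longrightarrow> k < b"
      using M(2) by (auto simp: free_family_def)
    obtain b' D' c' where *: "\<forall>l<b'. D' l \<subseteq> V \<and> c' l \<in> M (D' l)"
      "\<forall>S\<subseteq>V. M S = lincomb b' c' ` free_family b' D' S"
      "\<forall>S\<subseteq>V. \<forall>w\<in>free_family b' D' S. lincomb b' c' w = 0 \<longrightarrow> (\<forall>l. D' l = S \<longrightarrow> w l = 0)"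
      using ex_minimal_generators[OF V M(1) bd] by (elim exE conjE) (rule that)
    show ?thesis
      by (intro exI[of _ "(b', D', c', \<lambda>S. {w \<in> free_family b' D' S. lincomb b' c' w = 0})"])
        (use * subspace_family_kernel[of b' D' c'] in \<open>auto simp: ok_def step_def x\<close>)
  qed
  ultimately obtain f where f: "\<And>n. ok (f n)" "\<And>n. step (f n) (f (Suc n))" "f 0 = (1, \<lambda>_. {}, undefined, M0)"
    using dependent_nat_choice[of "\<lambda>n x. ok x \<and> (n = 0 \<longrightarrow> x = (1, \<lambda>_. {}, undefined, M0))" "\<lambda>n. step"]
    by (metis nat.distinct(1))
  define b where "b i = fst (f i)" for i
  define D where "D i = fst (snd (f i))" for i
  \<comment> \<open>The map from module i + 1 to module i is chosen together with module i + 1.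
    Hence the shift, and the \<open>undefined\<close> entry at stage 0.\<close>
  define c where "c i = fst (snd (snd (f (Suc i))))" for i
  define M where "M i = snd (snd (snd (f i)))" for i
  have st: "(\<forall>l<b (Suc i). c i l \<in> M i (D (Suc i) l)) \<and>
      (\<forall>S\<subseteq>V. M i S = lincomb (b (Suc i)) (c i) ` free_family (b (Suc i)) (D (Suc i)) S) \<and>
      (\<forall>S. M (Suc i) S = {w \<in> free_family (b (Suc i)) (D (Suc i)) S. lincomb (b (Suc i)) (c i) w = 0}) \<and>
      (\<forall>S\<subseteq>V. \<forall>w\<in>M (Suc i) S. \<forall>l. D (Suc i) l = S \<longrightarrow> w l = 0)" for i
    using f(2)[of i] unfolding step_def case_prod_unfold b_def D_def c_def M_def .
  have ok: "subspace_family (M i) \<and> (\<forall>l<b i. D i l \<subseteq> V) \<and> (\<forall>S. M i S \<subseteq> free_family (b i) (D i) S)" for i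
    using f(1)[of i] unfolding ok_def case_prod_unfold b_def D_def M_def .
  have init: "b 0 = 1 \<and> D 0 0 = {} \<and> (\<forall>S. M 0 S = (if U S then free_family 1 (\<lambda>_. {}) S else {0}))"
    by (simp add: b_def D_def M_def f(3) M0_def)
  have "frame V U b D c M"
    unfolding frame_def
  proof (intro conjI)
    from init show "b 0 = 1" "D 0 0 = {}" "\<forall>S. M 0 S = (if U S then free_family 1 (\<lambda>_. {}) S else {0})"
      by simp_all
    from ok show "\<forall>i. \<forall>l<b i. D i l \<subseteq> V" "\<forall>i. subspace_family (M i)"
      "\<forall>i S. M i S \<subseteq> free_family (b i) (D i) S" by simp_all
    show "\<forall>i. \<forall>l<b (Suc i). c i l \<in> M i (D (Suc i) l)"
      by (rule allI) (rule st[THEN conjunct1])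
    show "\<forall>i. \<forall>S\<subseteq>V. M i S = lincomb (b (Suc i)) (c i) ` free_family (b (Suc i)) (D (Suc i)) S"
      by (rule allI) (rule st[THEN conjunct2, THEN conjunct1])
    show "\<forall>i S. M (Suc i) S = {w \<in> free_family (b (Suc i)) (D (Suc i)) S. lincomb (b (Suc i)) (c i) w = 0}"
      by (rule allI) (rule st[THEN conjunct2, THEN conjunct2, THEN conjunct1])
    show "\<forall>i. \<forall>S\<subseteq>V. \<forall>w\<in>M (Suc i) S. \<forall>l. D (Suc i) l = S \<longrightarrow> w l = 0"
      by (rule allI) (rule st[THEN conjunct2, THEN conjunct2, THEN conjunct2])
  qed
  then show ?thesis by blast
qed

lemma chains_free_incl:
  assumes "f \<in> chains S M p" "\<And>T. M T \<subseteq> F T"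
  shows "f \<in> chains S F p"
  by (rule chainsI) (auto dest: chainsD[OF assms(1)] intro!: subsetD[OF assms(2)])

lemma bd_empty_chain:
  assumes "finite S" "f \<in> chains S M 0"
  shows "bd S f = 0"
proof (rule bd_eq_zeroI)
  fix \<sigma> assume \<sigma>: "\<sigma> \<subseteq> S"
  have "f (insert v \<sigma>) = 0" for v
  proof (rule ccontr)
    assume "f (insert v \<sigma>) \<noteq> 0"
    then have "card (insert v \<sigma>) = 0" using chainsD[OF assms(2)] by blast
    then show False using \<sigma> assms(1) finite_subset by fastforce
  qed
  then show "bd S f \<sigma> = 0" by (simp add: bd_def)
qed

text \<open>A form of Nakayama's lemma: minimal generators of degree S exist exactly when the piece
  of degree S is not spanned by the smaller pieces.\<close>

lemma frame_generator_iff: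
  fixes c :: "nat \<Rightarrow> nat \<Rightarrow> nat \<Rightarrow> 'k::field" and V :: "'v::countable set"
  assumes fr: "frame V U b D c M" and V: "finite V" and S: "S \<subseteq> V"
  shows "(\<exists>l<b (Suc i). D (Suc i) l = S) \<longleftrightarrow> \<not> exact_at (M i) 0 S"
proof -
  let ?F = "free_family (b (Suc i)) (D (Suc i)) :: 'v set \<Rightarrow> (nat \<Rightarrow> 'k) set"
  let ?h = "lincomb (b (Suc i)) (c i)"
  have finS: "finite S" using S V finite_subset by blast
  have img: "\<And>T. T \<subseteq> V \<Longrightarrow> M i T = ?h ` ?F T"
    and sub: "\<And>i. subspace_family (M i)"
    and ker: "\<And>S. M (Suc i) S = {w \<in> ?F S. ?h w = 0}"
    and min: "\<And>S w l. S \<subseteq> V \<Longrightarrow> w \<in> M (Suc i) S \<Longrightarrow> D (Suc i) l = S \<Longrightarrow> w l = 0"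
    by (rule frame_image[OF fr] frame_subspace[OF fr] frame_kernel[OF fr] frame_minimal[OF fr]; assumption)+
  have subF: "subgroup_family ?F" by (rule subgroup_family_free)
  have hm: "?h (- a) = - ?h a" for a
    using lincomb_diff[of "b (Suc i)" "c i" 0 a] by (simp add: lincomb_zero)
  have hbd: "?h (bd S g \<sigma>) = bd S (\<lambda>\<tau>. ?h (g \<tau>)) \<sigma>" for g and \<sigma> :: "'v set"
    by (rule bd_hom[where h = ?h]) (simp_all add: lincomb_add hm lincomb_zero)
  have lift: "\<exists>k\<in>chains S ?F q. \<forall>\<sigma>. ?h (k \<sigma>) = f \<sigma>" if fM: "f \<in> chains S (M i) q" for f q
    by (rule chains_lift[OF fM, where h = ?h]) (simp add: img S[THEN subset_trans[rotated]], rule lincomb_zero)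
  show ?thesis
  proof
    assume "\<exists>l<b (Suc i). D (Suc i) l = S"
    then obtain l where l: "l < b (Suc i)" "D (Suc i) l = S" by blast
    show "\<not> exact_at (M i) 0 S"
    proof
      assume ex: "exact_at (M i) 0 S"
      define e where "e = (\<lambda>k. if k = l then 1 else 0 :: 'k)"
      have e: "e \<in> ?F S" using l by (auto simp: free_family_def e_def)
      define f where "f \<sigma> = (if \<sigma> = {} then ?h e else 0)" for \<sigma> :: "'v set"
      have f: "f \<in> chains S (M i) 0"
        by (rule chainsI) (use e img[OF S] in \<open>auto simp: f_def split: if_splits\<close>)
      then obtain g where g: "g \<in> chains S (M i) (Suc 0)" "bd S g = f"
        using ex bd_empty_chain[OF finS f] unfolding exact_at_def by blast
      obtain k where k: "k \<in> chains S ?F (Suc 0)" "\<And>\<sigma>. ?h (k \<sigma>) = g \<sigma>"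
        using lift[OF g(1)] by blast
      \<comment> \<open>If the image of the basis vector e came from smaller degrees, w would be a
        second preimage whose coefficient at l is 0. Then e - w is a syzygy of degree S with
        coefficient 1 at a generator of that same degree, against minimality.\<close>
      define w where "w = bd S k {}"
      have "w \<in> ?F S"
        using chains_mem[OF subF chains_bd[OF finS subF k(1)], of "{}"] by (simp add: w_def)
      moreover have "?h w = ?h e"
        unfolding w_def hbd k(2) using g(2) by (simp add: f_def)
      ultimately have "e - w \<in> M (Suc i) S"
        using e subgroup_family_diff[OF subF] by (auto simp: ker lincomb_diff)
      then have "(e - w) l = 0" using min[OF S _ l(2)] by blast
      moreover have "w l = 0"
      proof -
        have "w l = bd S (\<lambda>\<sigma>. k \<sigma> l) {}"
          unfolding w_def by (rule bd_hom[of "\<lambda>u. u l"]) auto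
        also have "\<dots> = bd S (\<lambda>_. 0) {}"
        proof (rule bd_cong)
          fix v assume v: "v \<in> S - {}"
          have "k {v} \<in> ?F (S - {v})" by (rule chains_mem[OF subF k(1)])
          then show "k (insert v {}) l = 0" using l v by (auto simp: free_family_def)
        qed
        finally show ?thesis by simp
      qed
      ultimately show False by (simp add: e_def)
    qed
  next
    assume ne: "\<not> exact_at (M i) 0 S"
    show "\<exists>l<b (Suc i). D (Suc i) l = S"
    proof (rule ccontr)
      assume no: "\<not> (\<exists>l<b (Suc i). D (Suc i) l = S)"
      have "exact_at (M i) 0 S"
        unfolding exact_at_def
      proof (intro ballI impI)
        fix f assume f: "f \<in> chains S (M i) 0"
        obtain k where k: "k \<in> chains S ?F 0" "\<And>\<sigma>. ?h (k \<sigma>) = f \<sigma>"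
          using lift[OF f] by blast
        have "k {} l = 0" if "D (Suc i) l = S" for l
          using chains_mem[OF subF k(1), of "{}"] no that by (auto simp: free_family_def)
        then obtain g where g: "g \<in> chains S ?F (Suc 0)" "bd S g = k"
          using free_family_boundary[OF finS k(1) bd_empty_chain[OF finS k(1)]] by blast
        have "(\<lambda>\<sigma>. ?h (g \<sigma>)) \<in> chains S (M i) (Suc 0)"
        proof (rule chainsI)
          fix \<sigma> assume "?h (g \<sigma>) \<noteq> 0"
          then have nz: "g \<sigma> \<noteq> 0" using lincomb_zero by metis
          note * = chainsD[OF g(1) nz]
          show "\<sigma> \<subseteq> S" "card \<sigma> = Suc 0" using * by auto
          show "?h (g \<sigma>) \<in> M i (S - \<sigma>)" using * img[of "S - \<sigma>"] S by auto
        qed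
        moreover have "bd S (\<lambda>\<sigma>. ?h (g \<sigma>)) = f"
          by (rule ext) (use hbd[of g] g(2) k(2) in simp)
        ultimately show "\<exists>g\<in>chains S (M i) (Suc 0). bd S g = f" by blast
      qed
      then show False using ne by simp
    qed
  qed
qed

lemma frame_shift:
  fixes c :: "nat \<Rightarrow> nat \<Rightarrow> nat \<Rightarrow> 'k::field" and V :: "'v::countable set"
  assumes fr: "frame V U b D c M" and V: "finite V" and S: "S \<subseteq> V"
  shows "exact_at (M i) (Suc p) S \<longleftrightarrow> exact_at (M (Suc i)) p S"
proof -
  let ?F = "free_family (b (Suc i)) (D (Suc i)) :: 'v set \<Rightarrow> (nat \<Rightarrow> 'k) set"
  let ?h = "lincomb (b (Suc i)) (c i)"
  have finS: "finite S" using S V finite_subset by blast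
  have img: "\<And>T. T \<subseteq> V \<Longrightarrow> M i T = ?h ` ?F T"
    and sub: "\<And>i. subspace_family (M i)"
    and ker: "\<And>S. M (Suc i) S = {w \<in> ?F S. ?h w = 0}"
    and min: "\<And>S w l. S \<subseteq> V \<Longrightarrow> w \<in> M (Suc i) S \<Longrightarrow> D (Suc i) l = S \<Longrightarrow> w l = 0"
    by (rule frame_image[OF fr] frame_subspace[OF fr] frame_kernel[OF fr] frame_minimal[OF fr]; assumption)+
  show ?thesis
  proof (rule exact_at_shift[OF finS, where h = ?h and F = ?F])
    show "subgroup_family (M i)" "subgroup_family (M (Suc i))" for i
      using sub by (auto simp: subspace_family_def)
    show "subgroup_family ?F" by (rule subgroup_family_free)
    show "?h (a + a') = ?h a + ?h a'" for a a' by (rule lincomb_add)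
    show "M i T = ?h ` ?F T" if "T \<subseteq> S" for T using img S that by auto
    show "M (Suc i) T = {u \<in> ?F T. ?h u = 0}" for T by (rule ker)
    show "exact_at ?F (Suc p) S"
      unfolding exact_at_def using free_family_boundary[OF finS] by blast
    \<comment> \<open>By minimality a syzygy of degree S has coefficient 0 at the generators of
      degree S, so the exceptional case of \<open>free_family_boundary\<close> does not arise even
      for p = 0.\<close>
    show "\<exists>g\<in>chains S ?F (Suc p). bd S g = f" if f: "f \<in> chains S (M (Suc i)) p" "bd S f = 0" for f
    proof -
      have "f {} \<in> M (Suc i) S"
        using chains_mem[OF _ f(1), of "{}"] sub by (simp add: subspace_family_def)
      then have "\<forall>k. D (Suc i) k = S \<longrightarrow> f {} k = 0" using min S by blast
      moreover have "f \<in> chains S ?F p" by (rule chains_free_incl[OF f(1)]) (auto simp: ker)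
      ultimately show ?thesis using free_family_boundary[OF finS _ f(2)] by blast
    qed
  qed
qed

text \<open>Serves to pass between scalars and vectors concentrated in coordinate 0, in both
  directions.\<close>

lemma exact_at_retract:
  fixes M :: "'v::countable set \<Rightarrow> 'a::ab_group_add set" and N :: "'v set \<Rightarrow> 'b::ab_group_add set"
  assumes h: "\<And>a b. h (a + b) = h a + h b" "\<And>a. h (- a) = - h a" "h 0 = 0"
    and g: "\<And>a b. g (a + b) = g a + g b" "\<And>a. g (- a) = - g a" "g 0 = 0"
    and hN: "\<And>f q. f \<in> chains S N q \<Longrightarrow> (\<lambda>\<sigma>. h (f \<sigma>)) \<in> chains S M q"
    and gM: "\<And>f q. f \<in> chains S M q \<Longrightarrow> (\<lambda>\<sigma>. g (f \<sigma>)) \<in> chains S N q"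
    and hg: "\<And>f q \<sigma>. f \<in> chains S M q \<Longrightarrow> h (g (f \<sigma>)) = f \<sigma>"
    and ex: "exact_at N p S"
  shows "exact_at M p S"
  unfolding exact_at_def
proof (intro ballI impI)
  fix f assume f: "f \<in> chains S M p" "bd S f = 0"
  have "bd S (\<lambda>\<tau>. g (f \<tau>)) = 0"
    by (rule ext) (use bd_hom[of g S f] g f(2) in simp)
  then obtain k where k: "k \<in> chains S N (Suc p)" "bd S k = (\<lambda>\<tau>. g (f \<tau>))"
    using ex gM[OF f(1)] unfolding exact_at_def by blast
  have "bd S (\<lambda>\<tau>. h (k \<tau>)) = f"
    by (rule ext) (use bd_hom[of h S k] h k(2) hg[OF f(1)] in simp)
  then show "\<exists>k\<in>chains S M (Suc p). bd S k = f" using hN[OF k(1)] by blast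
qed

lemma frame_exact_0:
  fixes c :: "nat \<Rightarrow> nat \<Rightarrow> nat \<Rightarrow> 'k::field" and V :: "'v::countable set"
  assumes fr: "frame V U b D c M"
  shows "exact_at (M 0) p S \<longleftrightarrow> exact_at (upset_family U :: 'v set \<Rightarrow> 'k set) p S"
proof -
  let ?U = "upset_family U :: 'v set \<Rightarrow> 'k set"
  have M0: "M 0 T = (if U T then free_family 1 (\<lambda>_. {}) T else {0})" for T
    using frameD(3)[OF fr] by simp
  define inj where "inj a = (\<lambda>k. if k = (0::nat) then a else (0::'k))" for a
  define ev where "ev u = u (0::nat)" for u :: "nat \<Rightarrow> 'k"
  have inj: "inj (a + a') = inj a + inj a'" "inj (- a) = - inj a" "inj 0 = 0" for a a'
    by (auto simp: inj_def fun_eq_iff)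
  have ev: "ev (a + a') = ev a + ev a'" "ev (- a) = - ev a" "ev 0 = 0" for a a'
    by (auto simp: ev_def)
  have ev_inj: "ev (inj a) = a" for a by (simp add: ev_def inj_def)
  have inj_ev: "inj (ev u) = u" if "u \<in> M 0 T" for u T
    using that by (auto simp: inj_def ev_def M0 free_family_def fun_eq_iff split: if_splits)
  have 1: "(\<lambda>\<sigma>. ev (f \<sigma>)) \<in> chains S ?U q" if f: "f \<in> chains S (M 0) q" for f q
  proof (rule chainsI)
    fix \<sigma> assume nz: "ev (f \<sigma>) \<noteq> 0"
    then have nz': "f \<sigma> \<noteq> 0" using ev by auto
    note * = chainsD[OF f nz']
    show "\<sigma> \<subseteq> S" "card \<sigma> = q" using * by auto
    show "ev (f \<sigma>) \<in> ?U (S - \<sigma>)" using *(3) nz' by (auto simp: upset_family_def M0 split: if_splits)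
  qed
  have 2: "(\<lambda>\<sigma>. inj (f \<sigma>)) \<in> chains S (M 0) q" if f: "f \<in> chains S ?U q" for f q
  proof (rule chainsI)
    fix \<sigma> assume nz: "inj (f \<sigma>) \<noteq> 0"
    then have nz': "f \<sigma> \<noteq> 0" using inj by auto
    note * = chainsD[OF f nz']
    show "\<sigma> \<subseteq> S" "card \<sigma> = q" using * by auto
    show "inj (f \<sigma>) \<in> M 0 (S - \<sigma>)"
      using *(3) nz' by (auto simp: upset_family_def M0 free_family_def inj_def split: if_splits)
  qed
  have inj_ev_chain: "inj (ev (f \<sigma>)) = f \<sigma>" if "f \<in> chains S (M 0) q" for f q \<sigma>
    using chainsD(3)[OF that, of \<sigma>] inj_ev inj(3) ev(3) by (cases "f \<sigma> = 0") auto
  show ?thesis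
  proof
    assume ex: "exact_at (M 0) p S"
    show "exact_at ?U p S"
      by (rule exact_at_retract[where h = ev and g = inj and N = "M 0", OF ev inj])
        (erule 1, erule 2, rule ev_inj, rule ex)
  next
    assume ex: "exact_at ?U p S"
    show "exact_at (M 0) p S"
      by (rule exact_at_retract[where h = inj and g = ev and N = ?U, OF inj ev])
        (erule 2, erule 1, erule inj_ev_chain, rule ex)
  qed
qed

text \<open>Shifting i times moves the homology at i of the ideal to the homology at 0 of its i-th
  syzygy module, where it detects generators. Their index is \<open>Suc i\<close> because the frame
  starts with the ring itself.\<close>

theorem frame_betti_iff:
  fixes c :: "nat \<Rightarrow> nat \<Rightarrow> nat \<Rightarrow> 'k::field" and V :: "'v::countable set"
  assumes fr: "frame V U b D c M" and V: "finite V" and S: "S \<subseteq> V"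
  shows "(\<exists>l<b (Suc i). D (Suc i) l = S) \<longleftrightarrow> \<not> exact_at (upset_family U :: 'v set \<Rightarrow> 'k set) i S"
proof -
  have "exact_at (M j) p S \<longleftrightarrow> exact_at (M 0) (j + p) S" for j p
  proof (induction j arbitrary: p)
    case (Suc j)
    then show ?case using frame_shift[OF fr V S, of j p] Suc[of "Suc p"] by simp
  qed simp
  from this[of i 0] show ?thesis
    using frame_generator_iff[OF fr V S] frame_exact_0[OF fr, of i S] by simp
qed

section \<open>From scalar frames to polynomial matrices\<close>

definition mat_apply :: "nat \<Rightarrow> nat \<Rightarrow> (nat \<Rightarrow> nat \<Rightarrow> 'r::comm_ring_1) \<Rightarrow> (nat \<Rightarrow> 'r) \<Rightarrow> nat \<Rightarrow> 'r" where
  "mat_apply m n P v k = (if k < m then \<Sum>l<n. P k l * v l else 0)"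

text \<open>Vectors of length n as functions that vanish from n on, so that equality of vectors is
  equality of functions and no dimensions have to be carried along.\<close>

definition free_fun :: "'v set \<Rightarrow> nat \<Rightarrow> (nat \<Rightarrow> ('v, 'k::field) mpoly) set" where
  "free_fun V n = {v. \<forall>k. v k \<in> carrier (poly_ring V) \<and> (n \<le> k \<longrightarrow> v k = 0)}"

definition upset_ideal :: "'v set \<Rightarrow> ('v set \<Rightarrow> bool) \<Rightarrow> ('v, 'k::field) mpoly set" where
  "upset_ideal V U = {p \<in> carrier (poly_ring V). \<forall>t\<in>Poly_Mapping.keys p. U (Poly_Mapping.keys t)}"

text \<open>Here \<open>b\<close> and \<open>d\<close> are shifted by one compared to \<^const>\<open>minimal_graded_free_resolution\<close>, so that
  the augmentation onto the ideal, seen inside the free module of rank \<open>b 0 = 1\<close>, is the map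
  \<open>P 0\<close>.\<close>

definition fun_resolution ::
    "'v set \<Rightarrow> ('v, 'k::field) mpoly set \<Rightarrow> (nat \<Rightarrow> nat) \<Rightarrow> (nat \<Rightarrow> nat \<Rightarrow> nat) \<Rightarrow>
     (nat \<Rightarrow> nat \<Rightarrow> nat \<Rightarrow> ('v, 'k) mpoly) \<Rightarrow> bool" where
  "fun_resolution V J b d P \<longleftrightarrow>
     b 0 = 1 \<and> d 0 0 = 0 \<and>
     (\<forall>i. \<forall>k<b i. \<forall>l<b (Suc i). P i k l \<in> carrier (poly_ring V)) \<and>
     (\<forall>i. \<forall>k<b i. \<forall>l<b (Suc i). \<forall>t\<in>Poly_Mapping.keys (P i k l). d i k + total_deg t = d (Suc i) l) \<and>
     (\<forall>i. \<forall>k<b (Suc i). \<forall>l<b (Suc (Suc i)). Poly_Mapping.lookup (P (Suc i) k l) 0 = 0) \<and>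
     (\<lambda>v. mat_apply 1 (b 1) (P 0) v 0) ` free_fun V (b 1) = J \<and>
     (\<forall>i. {v \<in> free_fun V (b (Suc i)). mat_apply (b i) (b (Suc i)) (P i) v = 0} =
       mat_apply (b (Suc i)) (b (Suc (Suc i))) (P (Suc i)) ` free_fun V (b (Suc (Suc i))))"

lemma carrier_poly_ring: "carrier (poly_ring V) = {p. \<forall>t\<in>Poly_Mapping.keys p. Poly_Mapping.keys t \<subseteq> V}"
  and add_poly_ring [simp]: "p \<oplus>\<^bsub>poly_ring V\<^esub> q = p + q"
  and mult_poly_ring [simp]: "p \<otimes>\<^bsub>poly_ring V\<^esub> q = p * q"
  and zero_poly_ring [simp]: "\<zero>\<^bsub>poly_ring V\<^esub> = 0"
  and one_poly_ring [simp]: "\<one>\<^bsub>poly_ring V\<^esub> = 1"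
  by (simp_all add: poly_ring_def)

lemma carrier_add: "p \<in> carrier (poly_ring V) \<Longrightarrow> q \<in> carrier (poly_ring V) \<Longrightarrow> p + q \<in> carrier (poly_ring V)"
  using cring.cring_simprules(1)[OF cring_poly_ring, of p V q] by simp

lemma carrier_mult: "p \<in> carrier (poly_ring V) \<Longrightarrow> q \<in> carrier (poly_ring V) \<Longrightarrow> p * q \<in> carrier (poly_ring V)"
  using cring.cring_simprules(5)[OF cring_poly_ring, of p V q] by simp

lemma carrier_zero: "0 \<in> carrier (poly_ring V)"
  by (simp add: carrier_poly_ring)

lemma carrier_sum: "(\<And>i. i \<in> A \<Longrightarrow> f i \<in> carrier (poly_ring V)) \<Longrightarrow> sum f A \<in> carrier (poly_ring V)"
  by (induction A rule: infinite_finite_induct) (auto simp: carrier_zero carrier_add)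

lemma carrier_uminus: "p \<in> carrier (poly_ring V) \<Longrightarrow> - p \<in> carrier (poly_ring V)"
  by (simp add: carrier_poly_ring)

lemma carrier_diff: "p \<in> carrier (poly_ring V) \<Longrightarrow> q \<in> carrier (poly_ring V) \<Longrightarrow> p - q \<in> carrier (poly_ring V)"
  using carrier_add[of p V "- q"] carrier_uminus[of q V] by simp

lemma mat_apply_free_fun:
  assumes "v \<in> free_fun V n" "\<And>k l. k < m \<Longrightarrow> l < n \<Longrightarrow> P k l \<in> carrier (poly_ring V)"
  shows "mat_apply m n P v \<in> free_fun V m"
  using assms by (auto simp: free_fun_def mat_apply_def carrier_zero intro!: carrier_sum carrier_mult)

definition indicator_monomial :: "'v set \<Rightarrow> 'v monomial" where
  "indicator_monomial A = (\<Sum>v\<in>A. Poly_Mapping.single v 1)"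

lemma lookup_indicator_monomial:
  assumes "finite A"
  shows "Poly_Mapping.lookup (indicator_monomial A) x = (if x \<in> A then 1 else 0)"
proof -
  have "Poly_Mapping.lookup (indicator_monomial A) x = (\<Sum>v\<in>A. if v = x then 1 else 0)"
    unfolding indicator_monomial_def lookup_sum
    by (rule sum.cong) (auto simp: lookup_single when_def)
  then show ?thesis using assms by simp
qed

lemma keys_indicator_monomial: "finite A \<Longrightarrow> Poly_Mapping.keys (indicator_monomial A) = A"
  by (auto simp: in_keys_iff lookup_indicator_monomial split: if_splits)

lemma total_deg_indicator_monomial: "finite A \<Longrightarrow> total_deg (indicator_monomial A) = card A"
  by (simp add: total_deg_def keys_indicator_monomial lookup_indicator_monomial)

lemma keys_monomial_add:
  fixes s t :: "'v monomial"
  shows "Poly_Mapping.keys (s + t) = Poly_Mapping.keys s \<union> Poly_Mapping.keys t"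
  by (auto simp: in_keys_iff lookup_add)

lemma indicator_monomial_diff:
  assumes "finite B" "A \<subseteq> B"
  shows "indicator_monomial B = indicator_monomial A + indicator_monomial (B - A)"
  using assms finite_subset[OF assms(2,1)]
  by (intro poly_mapping_eqI) (auto simp: lookup_add lookup_indicator_monomial)

lemma monomial_minus_indicator:
  assumes "finite A" "A \<subseteq> Poly_Mapping.keys a"
  shows "a - indicator_monomial A + indicator_monomial A = a"
proof (rule poly_mapping_eqI)
  fix x
  show "Poly_Mapping.lookup (a - indicator_monomial A + indicator_monomial A) x = Poly_Mapping.lookup a x"
    using assms by (auto simp: lookup_add lookup_minus lookup_indicator_monomial in_keys_iff)
qed

lemma lookup_single_mult_add:
  fixes p :: "('v, 'k::field) mpoly"
  shows "Poly_Mapping.lookup (Poly_Mapping.single s c * p) (s + u) = c * Poly_Mapping.lookup p u"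
  unfolding lookup_mult lookup_single by (simp add: when_mult)

lemma lookup_single_mult_eq_0:
  fixes p :: "('v, 'k::field) mpoly"
  assumes "\<And>u. t \<noteq> s + u"
  shows "Poly_Mapping.lookup (Poly_Mapping.single s c * p) t = 0"
proof (rule ccontr)
  assume "Poly_Mapping.lookup (Poly_Mapping.single s c * p) t \<noteq> 0"
  then have "t \<in> Poly_Mapping.keys (Poly_Mapping.single s c * p)" by (simp add: in_keys_iff)
  then obtain x y where "t = x + y" "x \<in> Poly_Mapping.keys (Poly_Mapping.single s c)"
    using keys_mult[of "Poly_Mapping.single s c" p] by blast
  then show False using assms by (auto split: if_splits)
qed

text \<open>The part of v of multidegree a as a scalar vector. The k-th basis element already has
  degree \<open>D k\<close>, so its coefficient stands at the monomial a divided by the product over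
  \<open>D k\<close>. Here a need not be square-free.\<close>

definition component :: "nat \<Rightarrow> (nat \<Rightarrow> 'v set) \<Rightarrow> (nat \<Rightarrow> ('v, 'k::field) mpoly) \<Rightarrow> 'v monomial \<Rightarrow> nat \<Rightarrow> 'k" where
  "component b D v a k =
     (if k < b \<and> D k \<subseteq> Poly_Mapping.keys a then Poly_Mapping.lookup (v k) (a - indicator_monomial (D k)) else 0)"

text \<open>The homogenization of the scalar matrix c. In a frame \<open>c l k \<noteq> 0\<close>
  forces \<open>D k \<subseteq> D' l\<close>, so the set difference in the exponent is the honest
  difference of degrees.\<close>

definition frame_mat :: "(nat \<Rightarrow> 'v set) \<Rightarrow> (nat \<Rightarrow> 'v set) \<Rightarrow> (nat \<Rightarrow> nat \<Rightarrow> 'k::field) \<Rightarrow> nat \<Rightarrow> nat \<Rightarrow> ('v, 'k) mpoly" where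
  "frame_mat D D' c k l = Poly_Mapping.single (indicator_monomial (D' l - D k)) (c l k)"

lemma component_add_indicator:
  "k < b \<Longrightarrow> finite (D k) \<Longrightarrow>
    component b D v (t + indicator_monomial (D k)) k = Poly_Mapping.lookup (v k) t"
  by (simp add: component_def keys_monomial_add keys_indicator_monomial)

text \<open>In each multidegree the polynomial matrix acts as its scalar matrix, because the
  monomial of an entry bridges exactly the difference of the two basis degrees.\<close>

lemma component_mat_apply:
  fixes c :: "nat \<Rightarrow> nat \<Rightarrow> 'k::field"
  assumes c: "\<And>l. l < b' \<Longrightarrow> c l \<in> free_family b D (D' l)"
    and fin: "\<And>k. k < b \<Longrightarrow> finite (D k)" "\<And>l. l < b' \<Longrightarrow> finite (D' l)"
  shows "component b D (mat_apply b b' (frame_mat D D' c) v) a = lincomb b' c (component b' D' v a)"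
proof
  fix k
  have cD: "k < b" "D k \<subseteq> D' l" if "l < b'" "c l k \<noteq> 0" for l
    using c[OF that(1)] that(2) by (auto simp: free_family_def)
  show "component b D (mat_apply b b' (frame_mat D D' c) v) a k = lincomb b' c (component b' D' v a) k"
  proof (cases "k < b \<and> D k \<subseteq> Poly_Mapping.keys a")
    case False
    have "component b' D' v a l * c l k = 0" if "l < b'" for l
      using cD[OF that] False that by (auto simp: component_def)
    then have "lincomb b' c (component b' D' v a) k = 0"
      unfolding lincomb_def by (intro sum.neutral) auto
    then show ?thesis using False by (auto simp: component_def)
  next
    case True
    define t where "t = a - indicator_monomial (D k)"
    have a: "a = t + indicator_monomial (D k)"
      using monomial_minus_indicator[of "D k" a] True fin(1) by (simp add: t_def)
    have "Poly_Mapping.lookup (frame_mat D D' c k l * v l) t = component b' D' v a l * c l k" if l: "l < b'" for l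
    proof (cases "c l k = 0")
      case True
      then show ?thesis by (simp add: frame_mat_def)
    next
      case nz: False
      note sub = cD(2)[OF l nz]
      show ?thesis
      proof (cases "D' l \<subseteq> Poly_Mapping.keys a")
        case sub': True
        define u where "u = a - indicator_monomial (D' l)"
        have "a = u + indicator_monomial (D' l)"
          using monomial_minus_indicator[of "D' l" a] sub' fin(2)[OF l] by (simp add: u_def)
        then have "t + indicator_monomial (D k) = (indicator_monomial (D' l - D k) + u) + indicator_monomial (D k)"
          using a indicator_monomial_diff[OF fin(2)[OF l] sub] by (simp add: ac_simps)
        then have t: "t = indicator_monomial (D' l - D k) + u" by simp
        show ?thesis
          unfolding t frame_mat_def lookup_single_mult_add using sub' l by (simp add: component_def u_def)
      next
        case False
        \<comment> \<open>The monomial a is not divisible by the degree of the l-th basis element.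
          The vertex x witnesses it: x lies in \<open>D' l - D k\<close> but not in t, so t is no
          multiple of the monomial of the entry.\<close>
        then obtain x where x: "x \<in> D' l" "x \<notin> Poly_Mapping.keys a" by blast
        then have "x \<notin> D k" using True by blast
        then have 1: "Poly_Mapping.lookup (indicator_monomial (D' l - D k)) x = 1"
          using x fin(2)[OF l] by (simp add: lookup_indicator_monomial)
        have 2: "Poly_Mapping.lookup t x = 0" using x(2) by (simp add: t_def lookup_minus in_keys_iff)
        have "t \<noteq> indicator_monomial (D' l - D k) + u" for u
          using 1 2 by (auto simp: lookup_add)
        then have "Poly_Mapping.lookup (frame_mat D D' c k l * v l) t = 0"
          unfolding frame_mat_def by (rule lookup_single_mult_eq_0)
        then show ?thesis using False by (simp add: component_def)
      qed
    qed
    then show ?thesis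
      using True by (simp add: component_def lincomb_def mat_apply_def lookup_sum t_def)
  qed
qed

lemma component_outside:
  assumes v: "v \<in> free_fun V b" and D: "\<And>k. k < b \<Longrightarrow> D k \<subseteq> V" "finite V"
    and a: "\<not> Poly_Mapping.keys a \<subseteq> V"
  shows "component b D v a = 0"
proof
  fix k
  show "component b D v a k = 0 k"
  proof (cases "k < b \<and> D k \<subseteq> Poly_Mapping.keys a")
    case True
    have finD: "finite (D k)" using True D finite_subset by blast
    have "a = (a - indicator_monomial (D k)) + indicator_monomial (D k)"
      using monomial_minus_indicator[of "D k" a] True finD by simp
    then have "Poly_Mapping.keys a = Poly_Mapping.keys (a - indicator_monomial (D k)) \<union> D k"
      using keys_monomial_add[of "a - indicator_monomial (D k)" "indicator_monomial (D k)"]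
        keys_indicator_monomial[OF finD] by simp
    then have "\<not> Poly_Mapping.keys (a - indicator_monomial (D k)) \<subseteq> V"
      using a D(1) True by blast
    then have "a - indicator_monomial (D k) \<notin> Poly_Mapping.keys (v k)"
      using v by (auto simp: free_fun_def carrier_poly_ring)
    then show ?thesis by (simp add: component_def in_keys_iff)
  qed (auto simp: component_def)
qed

lemma component_ext:
  assumes "v \<in> free_fun V b" "w \<in> free_fun V b" "\<And>k. k < b \<Longrightarrow> finite (D k)"
    "\<And>a. component b D v a = component b D w a"
  shows "v = w"
proof
  fix k
  show "v k = w k"
  proof (cases "k < b")
    case True
    show ?thesis
      by (rule poly_mapping_eqI)
        (metis True assms(3,4) component_add_indicator)
  next
    case False
    then show ?thesis using assms(1,2) by (simp add: free_fun_def)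
  qed
qed

lemma finite_component:
  assumes "\<And>k. k < b \<Longrightarrow> finite (D k)"
  shows "finite {a. component b D v a \<noteq> 0}"
proof -
  have "{a. component b D v a \<noteq> 0} \<subseteq>
    (\<Union>k<b. (\<lambda>t. t + indicator_monomial (D k)) ` Poly_Mapping.keys (v k))"
  proof
    fix a assume "a \<in> {a. component b D v a \<noteq> 0}"
    then obtain k where "component b D v a k \<noteq> 0" by (auto simp: fun_eq_iff)
    then have k: "k < b" "D k \<subseteq> Poly_Mapping.keys a"
      "a - indicator_monomial (D k) \<in> Poly_Mapping.keys (v k)"
      by (auto simp: component_def in_keys_iff split: if_splits)
    moreover have "a = (a - indicator_monomial (D k)) + indicator_monomial (D k)"
      using monomial_minus_indicator[of "D k" a] k assms by simp
    ultimately show "a \<in> (\<Union>k<b. (\<lambda>t. t + indicator_monomial (D k)) ` Poly_Mapping.keys (v k))"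
      by blast
  qed
  then show ?thesis by (rule finite_subset) auto
qed

text \<open>The square-free module with pieces M: its part in an arbitrary multidegree a depends on
  the support of a only.\<close>

definition multigraded_module :: "'v set \<Rightarrow> nat \<Rightarrow> (nat \<Rightarrow> 'v set) \<Rightarrow> ('v set \<Rightarrow> (nat \<Rightarrow> 'k::field) set) \<Rightarrow>
    (nat \<Rightarrow> ('v, 'k) mpoly) set" where
  "multigraded_module V b D M =
     {v \<in> free_fun V b. \<forall>a. Poly_Mapping.keys a \<subseteq> V \<longrightarrow> component b D v a \<in> M (Poly_Mapping.keys a)}"

lemma component_mem_free_family:
  "component b D v a \<in> free_family b D (Poly_Mapping.keys a)"
  by (auto simp: free_family_def component_def split: if_splits)

lemma frame_mat_carrier:
  assumes "finite V" "D' l \<subseteq> V"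
  shows "frame_mat D D' c k l \<in> carrier (poly_ring V)"
proof -
  have "finite (D' l - D k)" using assms finite_subset by blast
  then show ?thesis using assms(2)
    by (auto simp: frame_mat_def carrier_poly_ring keys_indicator_monomial split: if_splits)
qed

lemma kernel_frame_mat:
  fixes c :: "nat \<Rightarrow> nat \<Rightarrow> 'k::field"
  assumes V: "finite V" and D: "\<And>k. k < b \<Longrightarrow> D k \<subseteq> V" "\<And>l. l < b' \<Longrightarrow> D' l \<subseteq> V"
    and c: "\<And>l. l < b' \<Longrightarrow> c l \<in> free_family b D (D' l)"
    and M': "\<And>S. M' S = {w \<in> free_family b' D' S. lincomb b' c w = 0}"
  shows "{v \<in> free_fun V b'. mat_apply b b' (frame_mat D D' c) v = 0} = multigraded_module V b' D' M'"
proof -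
  have fin: "k < b \<Longrightarrow> finite (D k)" "l < b' \<Longrightarrow> finite (D' l)" for k l
    using finite_subset[OF D(1) V] finite_subset[OF D(2) V] by auto
  have comp: "component b D (mat_apply b b' (frame_mat D D' c) v) a = lincomb b' c (component b' D' v a)" for v a
    by (rule component_mat_apply) (simp_all add: c fin)
  have "mat_apply b b' (frame_mat D D' c) v = 0 \<longleftrightarrow>
    (\<forall>a. Poly_Mapping.keys a \<subseteq> V \<longrightarrow> component b' D' v a \<in> M' (Poly_Mapping.keys a))" if v: "v \<in> free_fun V b'" for v
  proof
    assume z: "mat_apply b b' (frame_mat D D' c) v = 0"
    have "component b D (mat_apply b b' (frame_mat D D' c) v) a = 0" for a
      unfolding z by (auto simp: component_def)
    then have "lincomb b' c (component b' D' v a) = 0" for a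
      using comp[of v a] by simp
    then show "\<forall>a. Poly_Mapping.keys a \<subseteq> V \<longrightarrow> component b' D' v a \<in> M' (Poly_Mapping.keys a)"
      by (simp add: M' component_mem_free_family)
  next
    assume *: "\<forall>a. Poly_Mapping.keys a \<subseteq> V \<longrightarrow> component b' D' v a \<in> M' (Poly_Mapping.keys a)"
    have "lincomb b' c (component b' D' v a) = 0" for a
    proof (cases "Poly_Mapping.keys a \<subseteq> V")
      case True
      then show ?thesis using * by (simp add: M')
    next
      case False
      have "component b' D' v a = 0" by (rule component_outside[OF v D(2) V False])
      then show ?thesis by (simp add: lincomb_zero)
    qed
    then have "component b D (mat_apply b b' (frame_mat D D' c) v) a = component b D 0 a" for a
      by (simp add: comp) (simp add: component_def fun_eq_iff)
    moreover have "mat_apply b b' (frame_mat D D' c) v \<in> free_fun V b"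
      by (rule mat_apply_free_fun[OF v]) (simp add: frame_mat_carrier V D(2))
    moreover have "0 \<in> free_fun V b" by (simp add: free_fun_def carrier_zero)
    ultimately show "mat_apply b b' (frame_mat D D' c) v = 0"
      using fin(1) by (intro component_ext[of _ V b _ D]) auto
  qed
  then show ?thesis by (auto simp: multigraded_module_def)
qed

text \<open>A preimage is found one multidegree at a time and the scalar solutions are reassembled
  into polynomials.\<close>

lemma image_frame_mat:
  fixes c :: "nat \<Rightarrow> nat \<Rightarrow> 'k::field"
  assumes V: "finite V" and D: "\<And>k. k < b \<Longrightarrow> D k \<subseteq> V" "\<And>l. l < b' \<Longrightarrow> D' l \<subseteq> V"
    and c: "\<And>l. l < b' \<Longrightarrow> c l \<in> free_family b D (D' l)"
    and M: "\<And>S. S \<subseteq> V \<Longrightarrow> M S = lincomb b' c ` free_family b' D' S"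
  shows "mat_apply b b' (frame_mat D D' c) ` free_fun V b' = multigraded_module V b D M"
proof (intro equalityI subsetI)
  have fin: "k < b \<Longrightarrow> finite (D k)" "l < b' \<Longrightarrow> finite (D' l)" for k l
    using finite_subset[OF D(1) V] finite_subset[OF D(2) V] by auto
  have comp: "component b D (mat_apply b b' (frame_mat D D' c) v) a = lincomb b' c (component b' D' v a)" for v a
    by (rule component_mat_apply) (simp_all add: c fin)
  have ff: "mat_apply b b' (frame_mat D D' c) v \<in> free_fun V b" if "v \<in> free_fun V b'" for v
    by (rule mat_apply_free_fun[OF that]) (simp add: frame_mat_carrier V D(2))
  {
    fix v assume "v \<in> mat_apply b b' (frame_mat D D' c) ` free_fun V b'"
    then obtain w where w: "w \<in> free_fun V b'" "v = mat_apply b b' (frame_mat D D' c) w" by blast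
    have "component b D v a \<in> M (Poly_Mapping.keys a)" if "Poly_Mapping.keys a \<subseteq> V" for a
      unfolding w(2) comp M[OF that] using component_mem_free_family by (rule imageI)
    then show "v \<in> multigraded_module V b D M"
      using ff[OF w(1)] by (simp add: multigraded_module_def w(2))
  next
    fix v assume "v \<in> multigraded_module V b D M"
    then have v: "v \<in> free_fun V b" "\<And>a. Poly_Mapping.keys a \<subseteq> V \<Longrightarrow> component b D v a \<in> M (Poly_Mapping.keys a)"
      by (auto simp: multigraded_module_def)
    have out: "Poly_Mapping.keys a \<subseteq> V" if "component b D v a \<noteq> 0" for a
      using that component_outside[OF v(1), of D a] D(1) V by blast
    \<comment> \<open>The vector 0 is lifted to 0. Thus only finitely many W a are nonzero, which
      makes each \<open>f l\<close> finitely supported and \<open>w l\<close> a polynomial.\<close>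
    have "\<exists>w. w \<in> free_family b' D' (Poly_Mapping.keys a) \<and> lincomb b' c w = component b D v a \<and>
        (component b D v a = 0 \<longrightarrow> w = 0)" for a
    proof (cases "component b D v a = 0")
      case True
      then show ?thesis by (intro exI[of _ 0]) (auto simp: lincomb_zero free_family_def)
    next
      case False
      then have "Poly_Mapping.keys a \<subseteq> V" by (rule out)
      then show ?thesis using v(2) M False by (metis imageE)
    qed
    then obtain W where W: "\<And>a. W a \<in> free_family b' D' (Poly_Mapping.keys a)"
      "\<And>a. lincomb b' c (W a) = component b D v a" "\<And>a. component b D v a = 0 \<Longrightarrow> W a = 0"
      by metis
    define f where "f l t = (if l < b' then W (t + indicator_monomial (D' l)) l else 0)" for l t
    have finf: "finite {t. f l t \<noteq> 0}" for l
    proof -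
      have "{t. f l t \<noteq> 0} \<subseteq> (\<lambda>a. a - indicator_monomial (D' l)) ` {a. component b D v a \<noteq> 0}"
      proof
        fix t assume "t \<in> {t. f l t \<noteq> 0}"
        then have "W (t + indicator_monomial (D' l)) \<noteq> 0" by (auto simp: f_def split: if_splits)
        then have "component b D v (t + indicator_monomial (D' l)) \<noteq> 0" using W(3) by blast
        moreover have "t = t + indicator_monomial (D' l) - indicator_monomial (D' l)" by simp
        ultimately show "t \<in> (\<lambda>a. a - indicator_monomial (D' l)) ` {a. component b D v a \<noteq> 0}" by blast
      qed
      then show ?thesis using finite_component[of b D v] fin(1) finite_subset by blast
    qed
    define w where "w l = Abs_poly_mapping (f l)" for l
    have lw: "Poly_Mapping.lookup (w l) = f l" for l
      using finf by (simp add: w_def)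
    have wff: "w \<in> free_fun V b'"
      unfolding free_fun_def carrier_poly_ring
    proof (intro CollectI allI conjI impI ballI)
      fix l t assume "t \<in> Poly_Mapping.keys (w l)"
      then have *: "l < b'" "W (t + indicator_monomial (D' l)) \<noteq> 0"
        by (auto simp: in_keys_iff lw f_def split: if_splits)
      then have "component b D v (t + indicator_monomial (D' l)) \<noteq> 0" using W(3) by blast
      then have "Poly_Mapping.keys (t + indicator_monomial (D' l)) \<subseteq> V"
        by (rule out)
      then show "Poly_Mapping.keys t \<subseteq> V" by (simp add: keys_monomial_add)
    next
      fix l assume "b' \<le> l"
      then show "w l = 0" by (intro poly_mapping_eqI) (simp add: lw f_def)
    qed
    have cw: "component b' D' w a = W a" for a
    proof
      fix l
      show "component b' D' w a l = W a l"
      proof (cases "l < b' \<and> D' l \<subseteq> Poly_Mapping.keys a")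
        case True
        then show ?thesis
          using monomial_minus_indicator[of "D' l" a] fin(2) by (simp add: component_def lw f_def)
      next
        case False
        then have "W a l = 0" using W(1)[of a] by (auto simp: free_family_def)
        then show ?thesis using False by (auto simp: component_def)
      qed
    qed
    have "mat_apply b b' (frame_mat D D' c) w = v"
    proof (rule component_ext[OF ff[OF wff] v(1), where D = D])
      show "component b D (mat_apply b b' (frame_mat D D' c) w) a = component b D v a" for a
        unfolding comp cw W(2) by (rule refl)
    qed (rule fin(1))
    then show "v \<in> mat_apply b b' (frame_mat D D' c) ` free_fun V b'" using wff by blast
  }
qed

lemma frame_resolution:
  fixes c :: "nat \<Rightarrow> nat \<Rightarrow> nat \<Rightarrow> 'k::field"
  assumes fr: "frame V U b D c M" and V: "finite V"
  shows "fun_resolution V (upset_ideal V U) b (\<lambda>i k. card (D i k)) (\<lambda>i. frame_mat (D i) (D (Suc i)) (c i))"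
proof -
  have D: "D i k \<subseteq> V" if "k < b i" for i k
    using frameD(4)[OF fr] that by blast
  have finD: "finite (D i k)" if "k < b i" for i k
    using D[OF that] V finite_subset by blast
  have cM: "c i l \<in> M i (D (Suc i) l)" if "l < b (Suc i)" for i l
    using frameD(7)[OF fr] that by blast
  have c: "c i l \<in> free_family (b i) (D i) (D (Suc i) l)" if "l < b (Suc i)" for i l
    using frameD(6)[OF fr] cM[OF that] by blast
  have b0: "b 0 = 1" "D 0 0 = {}" using frameD(1,2)[OF fr] by auto
  have cD: "D i k \<subseteq> D (Suc i) l" if "l < b (Suc i)" "c i l k \<noteq> 0" for i k l
    using c[OF that(1)] that(2) by (auto simp: free_family_def)
  have img: "mat_apply (b i) (b (Suc i)) (frame_mat (D i) (D (Suc i)) (c i)) ` free_fun V (b (Suc i)) =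
      multigraded_module V (b i) (D i) (M i)" for i
    by (rule image_frame_mat[OF V]) (simp_all add: D c frame_image[OF fr])
  have ker: "{v \<in> free_fun V (b (Suc i)). mat_apply (b i) (b (Suc i)) (frame_mat (D i) (D (Suc i)) (c i)) v = 0} =
      multigraded_module V (b (Suc i)) (D (Suc i)) (M (Suc i))" for i
    by (rule kernel_frame_mat[OF V]) (simp_all add: D c frame_kernel[OF fr])
  have "(\<lambda>v. v 0) ` multigraded_module V (b 0) (D 0) (M 0) = upset_ideal V U"
  proof -
    have comp: "component (b 0) (D 0) v a = (\<lambda>k. if k = 0 then Poly_Mapping.lookup (v 0) a else 0)"
      for v :: "nat \<Rightarrow> ('a, 'k) mpoly" and a
      by (auto simp: component_def b0 indicator_monomial_def fun_eq_iff)
    have mem: "(\<lambda>k. if k = 0 then x else 0) \<in> M 0 S \<longleftrightarrow> (x \<noteq> 0 \<longrightarrow> U S)" for x S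
      using frameD(3)[OF fr] by (auto simp: free_family_def fun_eq_iff)
    show ?thesis
    proof (intro equalityI subsetI)
      fix p assume "p \<in> (\<lambda>v. v 0) ` multigraded_module V (b 0) (D 0) (M 0)"
      then obtain v where vm: "v \<in> multigraded_module V (b 0) (D 0) (M 0)" and pv: "p = v 0" by blast
      have v: "v \<in> free_fun V 1" "p = v 0"
        "\<And>a. Poly_Mapping.keys a \<subseteq> V \<Longrightarrow> Poly_Mapping.lookup (v 0) a \<noteq> 0 \<Longrightarrow> U (Poly_Mapping.keys a)"
        using vm pv unfolding multigraded_module_def comp mem unfolding b0 by auto
      have p: "p \<in> carrier (poly_ring V)" using v by (simp add: free_fun_def)
      then show "p \<in> upset_ideal V U"
        using v(2,3) by (auto simp: upset_ideal_def in_keys_iff carrier_poly_ring)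
    next
      fix p :: "('a, 'k) mpoly" assume "p \<in> upset_ideal V U"
      then have p: "p \<in> carrier (poly_ring V)" "\<And>t. t \<in> Poly_Mapping.keys p \<Longrightarrow> U (Poly_Mapping.keys t)"
        by (auto simp: upset_ideal_def)
      have "(\<lambda>k. if k = 0 then p else 0) \<in> multigraded_module V (b 0) (D 0) (M 0)"
        using p unfolding multigraded_module_def comp mem unfolding b0
        by (auto simp: free_fun_def carrier_zero in_keys_iff)
      then show "p \<in> (\<lambda>v. v 0) ` multigraded_module V (b 0) (D 0) (M 0)"
        by (rule image_eqI[rotated]) simp
    qed
  qed
  then have J: "(\<lambda>v. mat_apply 1 (b 1) (frame_mat (D 0) (D 1) (c 0)) v 0) ` free_fun V (b 1) = upset_ideal V U"
    using img[of 0] b0(1) by (simp add: image_image[symmetric, of "\<lambda>v. v 0"])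
  show ?thesis
    unfolding fun_resolution_def
  proof (intro conjI)
    show "b 0 = 1" "card (D 0 0) = 0" using b0 by simp_all
    show "\<forall>i. \<forall>k<b i. \<forall>l<b (Suc i). frame_mat (D i) (D (Suc i)) (c i) k l \<in> carrier (poly_ring V)"
      using frame_mat_carrier[OF V] D by blast
    show "\<forall>i. \<forall>k<b i. \<forall>l<b (Suc i). \<forall>t\<in>Poly_Mapping.keys (frame_mat (D i) (D (Suc i)) (c i) k l).
        card (D i k) + total_deg t = card (D (Suc i) l)"
    proof (intro allI impI ballI)
      fix i k l t
      assume k: "k < b i" and l: "l < b (Suc i)"
        and "t \<in> Poly_Mapping.keys (frame_mat (D i) (D (Suc i)) (c i) k l)"
      then have t: "t = indicator_monomial (D (Suc i) l - D i k)" "c i l k \<noteq> 0"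
        by (auto simp: frame_mat_def split: if_splits)
      have "finite (D (Suc i) l - D i k)" using finD[OF l] by simp
      then show "card (D i k) + total_deg t = card (D (Suc i) l)"
        using cD[OF l t(2)] finD[OF k] finD[OF l] card_mono[OF finD[OF l] cD[OF l t(2)]]
        by (simp add: t(1) total_deg_indicator_monomial card_Diff_subset)
    qed
    show "\<forall>i. \<forall>k<b (Suc i). \<forall>l<b (Suc (Suc i)).
        Poly_Mapping.lookup (frame_mat (D (Suc i)) (D (Suc (Suc i))) (c (Suc i)) k l) 0 = 0"
    proof (intro allI impI)
      fix i k l assume k: "k < b (Suc i)" and l: "l < b (Suc (Suc i))"
      show "Poly_Mapping.lookup (frame_mat (D (Suc i)) (D (Suc (Suc i))) (c (Suc i)) k l) 0 = 0"
      proof (rule ccontr)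
        assume "Poly_Mapping.lookup (frame_mat (D (Suc i)) (D (Suc (Suc i))) (c (Suc i)) k l) 0 \<noteq> 0"
        then have *: "indicator_monomial (D (Suc (Suc i)) l - D (Suc i) k) = 0" "c (Suc i) l k \<noteq> 0"
          by (auto simp: frame_mat_def lookup_single when_def split: if_splits)
        have "D (Suc (Suc i)) l - D (Suc i) k = {}"
          using keys_indicator_monomial[of "D (Suc (Suc i)) l - D (Suc i) k"] finD[OF l] *(1) by simp
        \<comment> \<open>A nonzero constant entry would make column l a syzygy with nonzero
          coefficient at a generator of its own degree.\<close>
        then have "D (Suc i) k = D (Suc (Suc i)) l" using cD[OF l *(2)] by blast
        then show False
          using frame_minimal[OF fr D[OF l] cM[OF l]] *(2) by blast
      qed
    qed
    show "(\<lambda>v. mat_apply 1 (b 1) (frame_mat (D 0) (D (Suc 0)) (c 0)) v 0) ` free_fun V (b 1) = upset_ideal V U"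
      using J by simp
    show "\<forall>i. {v \<in> free_fun V (b (Suc i)). mat_apply (b i) (b (Suc i)) (frame_mat (D i) (D (Suc i)) (c i)) v = 0} =
        mat_apply (b (Suc i)) (b (Suc (Suc i))) (frame_mat (D (Suc i)) (D (Suc (Suc i))) (c (Suc i))) `
          free_fun V (b (Suc (Suc i)))"
      using img ker by simp
  qed
qed

section \<open>Uniqueness of graded Betti numbers\<close>

definition mat_mult :: "nat \<Rightarrow> (nat \<Rightarrow> nat \<Rightarrow> 'r::comm_ring_1) \<Rightarrow> (nat \<Rightarrow> nat \<Rightarrow> 'r) \<Rightarrow> nat \<Rightarrow> nat \<Rightarrow> 'r" where
  "mat_mult n A B k l = (\<Sum>s<n. A k s * B s l)"

lemma mat_mult_assoc: "mat_mult n A (mat_mult m B C) k l = mat_mult m (mat_mult n A B) C k l"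
proof -
  have "mat_mult n A (mat_mult m B C) k l = (\<Sum>s<n. \<Sum>t<m. A k s * B s t * C t l)"
    by (simp add: mat_mult_def sum_distrib_left mult.assoc)
  also have "\<dots> = (\<Sum>t<m. \<Sum>s<n. A k s * B s t * C t l)" by (rule sum.swap)
  also have "\<dots> = mat_mult m (mat_mult n A B) C k l"
    by (simp add: mat_mult_def sum_distrib_right)
  finally show ?thesis .
qed

lemma mat_mult_cong:
  assumes "\<And>s. s < n \<Longrightarrow> A k s = A' k s" "\<And>s. s < n \<Longrightarrow> B s l = B' s l"
  shows "mat_mult n A B k l = mat_mult n A' B' k l"
  unfolding mat_mult_def by (rule sum.cong) (auto simp: assms)

lemma mat_mult_diff_left: "mat_mult n (\<lambda>k s. A k s - A' k s) B k l = mat_mult n A B k l - mat_mult n A' B k l"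
  by (simp add: mat_mult_def left_diff_distrib sum_subtractf)

lemma mat_mult_diff_right: "mat_mult n A (\<lambda>s l. B s l - B' s l) k l = mat_mult n A B k l - mat_mult n A B' k l"
  by (simp add: mat_mult_def right_diff_distrib sum_subtractf)

lemma mat_mult_id_left: "k < n \<Longrightarrow> mat_mult n (\<lambda>k s. if k = s then 1 else 0) B k l = B k l"
  unfolding mat_mult_def by (simp add: if_distrib[of "\<lambda>x. x * _"] cong: if_cong)

lemma mat_mult_id_right: "l < n \<Longrightarrow> mat_mult n A (\<lambda>s l. if s = l then 1 else 0) k l = A k l"
  unfolding mat_mult_def by (simp add: if_distrib[of "\<lambda>x. _ * x"] cong: if_cong)

lemma mat_mult_carrier:
  assumes "\<And>s. s < n \<Longrightarrow> A k s \<in> carrier (poly_ring V)" "\<And>s. s < n \<Longrightarrow> B s l \<in> carrier (poly_ring V)"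
  shows "mat_mult n A B k l \<in> carrier (poly_ring V)"
  unfolding mat_mult_def using assms by (intro carrier_sum carrier_mult) auto

lemma total_deg_add: "total_deg (s + t) = total_deg s + total_deg t"
  unfolding total_deg_def
  by (rule setsum_keys_plus_distrib) auto

text \<open>The part of p of degree e - \<delta>, written additively to avoid truncated subtraction:
  it is empty if e < \<delta>.\<close>

definition homogeneous_part :: "nat \<Rightarrow> nat \<Rightarrow> ('v, 'k::field) mpoly \<Rightarrow> ('v, 'k) mpoly" where
  "homogeneous_part \<delta> e p = Abs_poly_mapping (\<lambda>t. if \<delta> + total_deg t = e then Poly_Mapping.lookup p t else 0)"

lemma lookup_homogeneous_part:
  "Poly_Mapping.lookup (homogeneous_part \<delta> e p) t = (if \<delta> + total_deg t = e then Poly_Mapping.lookup p t else 0)"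
proof -
  have "finite {t. (if \<delta> + total_deg t = e then Poly_Mapping.lookup p t else 0) \<noteq> 0}"
    by (rule finite_subset[of _ "Poly_Mapping.keys p"]) (auto simp: in_keys_iff split: if_splits)
  then show ?thesis by (simp add: homogeneous_part_def)
qed

lemma keys_homogeneous_part:
  "t \<in> Poly_Mapping.keys (homogeneous_part \<delta> e p) \<longleftrightarrow> t \<in> Poly_Mapping.keys p \<and> \<delta> + total_deg t = e"
  by (simp add: in_keys_iff lookup_homogeneous_part)

lemma homogeneous_part_sum: "homogeneous_part \<delta> e (sum f A) = (\<Sum>i\<in>A. homogeneous_part \<delta> e (f i))"
  by (rule poly_mapping_eqI) (simp add: lookup_homogeneous_part lookup_sum)

lemma homogeneous_part_single_mult:
  assumes "c \<noteq> 0 \<Longrightarrow> \<delta> + total_deg s = \<delta>'"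
  shows "homogeneous_part \<delta> e (Poly_Mapping.single s c * q) = Poly_Mapping.single s c * homogeneous_part \<delta>' e q"
proof (cases "c = 0")
  case False
  show ?thesis
  proof (rule poly_mapping_eqI)
    fix t
    show "Poly_Mapping.lookup (homogeneous_part \<delta> e (Poly_Mapping.single s c * q)) t =
      Poly_Mapping.lookup (Poly_Mapping.single s c * homogeneous_part \<delta>' e q) t"
    proof (cases "\<exists>u. t = s + u")
      case True
      then obtain u where "t = s + u" by blast
      then show ?thesis
        using assms[OF False]
        by (auto simp: lookup_homogeneous_part lookup_single_mult_add total_deg_add)
    next
      case no: False
      then show ?thesis by (simp add: lookup_homogeneous_part lookup_single_mult_eq_0)
    qed
  qed
next
  case True
  then show ?thesis by (intro poly_mapping_eqI) (simp add: lookup_homogeneous_part)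
qed

lemma sum_single: "(\<Sum>t\<in>Poly_Mapping.keys p. Poly_Mapping.single t (Poly_Mapping.lookup p t)) = p"
proof (rule poly_mapping_eqI)
  fix t
  have "Poly_Mapping.lookup (\<Sum>t\<in>Poly_Mapping.keys p. Poly_Mapping.single t (Poly_Mapping.lookup p t)) t =
    (\<Sum>s\<in>Poly_Mapping.keys p. if s = t then Poly_Mapping.lookup p t else 0)"
    unfolding lookup_sum by (rule sum.cong) (auto simp: lookup_single when_def)
  also have "\<dots> = Poly_Mapping.lookup p t" by (simp add: in_keys_iff)
  finally show "Poly_Mapping.lookup (\<Sum>t\<in>Poly_Mapping.keys p. Poly_Mapping.single t (Poly_Mapping.lookup p t)) t =
    Poly_Mapping.lookup p t" .
qed

lemma homogeneous_part_mult:
  assumes "\<And>t. t \<in> Poly_Mapping.keys p \<Longrightarrow> \<delta> + total_deg t = \<delta>'"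
  shows "homogeneous_part \<delta> e (p * q) = p * homogeneous_part \<delta>' e q"
proof -
  let ?s = "\<lambda>t. Poly_Mapping.single t (Poly_Mapping.lookup p t)"
  have "homogeneous_part \<delta> e (p * q) = homogeneous_part \<delta> e (\<Sum>t\<in>Poly_Mapping.keys p. ?s t * q)"
    using sum_single[of p] by (simp add: sum_distrib_right[symmetric])
  also have "\<dots> = (\<Sum>t\<in>Poly_Mapping.keys p. ?s t * homogeneous_part \<delta>' e q)"
    unfolding homogeneous_part_sum
    by (intro sum.cong refl homogeneous_part_single_mult assms)
  also have "\<dots> = p * homogeneous_part \<delta>' e q"
    using sum_single[of p] by (simp add: sum_distrib_right[symmetric])
  finally show ?thesis .
qed

lemma homogeneous_part_id:
  "(\<And>t. t \<in> Poly_Mapping.keys p \<Longrightarrow> \<delta> + total_deg t = e) \<Longrightarrow> homogeneous_part \<delta> e p = p"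
  by (rule poly_mapping_eqI) (auto simp: lookup_homogeneous_part in_keys_iff)

lemma homogeneous_part_carrier: "p \<in> carrier (poly_ring V) \<Longrightarrow> homogeneous_part \<delta> e p \<in> carrier (poly_ring V)"
  by (simp add: carrier_poly_ring keys_homogeneous_part)

text \<open>Taking constant terms is a ring homomorphism. It turns identities between polynomial
  matrices into identities over the field, where the entries of the differentials vanish by
  minimality.\<close>

lemma lookup_mult_zero:
  fixes p q :: "('v, 'k::field) mpoly"
  shows "Poly_Mapping.lookup (p * q) 0 = Poly_Mapping.lookup p 0 * Poly_Mapping.lookup q 0"
proof -
  let ?s = "\<lambda>t. Poly_Mapping.single t (Poly_Mapping.lookup p t)"
  have single: "Poly_Mapping.lookup (Poly_Mapping.single s c * q) 0 = (if s = 0 then c * Poly_Mapping.lookup q 0 else 0)"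
    for s :: "'v monomial" and c :: 'k
  proof (cases "s = 0")
    case True
    then show ?thesis using lookup_single_mult_add[of s c q 0] by simp
  next
    case False
    have "0 \<noteq> s + u" for u
    proof
      assume "0 = s + u"
      then have "Poly_Mapping.keys s = {}" using keys_monomial_add[of s u] by (metis Un_empty keys_zero)
      then show False using False by simp
    qed
    then show ?thesis using False by (simp add: lookup_single_mult_eq_0)
  qed
  have "p * q = (\<Sum>t\<in>Poly_Mapping.keys p. ?s t * q)"
    using sum_single[of p] by (simp add: sum_distrib_right[symmetric])
  then have "Poly_Mapping.lookup (p * q) 0 = (\<Sum>t\<in>Poly_Mapping.keys p. Poly_Mapping.lookup (?s t * q) 0)"
    by (simp only: lookup_sum)
  also have "\<dots> = Poly_Mapping.lookup p 0 * Poly_Mapping.lookup q 0"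
    unfolding single by (simp add: in_keys_iff)
  finally show ?thesis .
qed

lemma lookup_mat_mult_zero:
  "Poly_Mapping.lookup (mat_mult n A B k l) 0 =
    (\<Sum>s<n. Poly_Mapping.lookup (A k s :: ('v, 'k::field) mpoly) 0 * Poly_Mapping.lookup (B s l) 0)"
  by (simp add: mat_mult_def lookup_sum lookup_mult_zero)

text \<open>As P and Z are homogeneous, taking the matching homogeneous part of every entry of a
  lift gives a lift again.\<close>

lemma homogeneous_lift:
  fixes A :: "nat \<Rightarrow> nat \<Rightarrow> ('v, 'k::field) mpoly"
  assumes A: "\<And>s l. A s l \<in> carrier (poly_ring V)"
    and eq: "\<And>k l. k < m \<Longrightarrow> l < r \<Longrightarrow> mat_mult n P A k l = Z k l"
    and P: "\<And>k s t. k < m \<Longrightarrow> s < n \<Longrightarrow> t \<in> Poly_Mapping.keys (P k s) \<Longrightarrow> d k + total_deg t = d' s"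
    and Z: "\<And>k l t. k < m \<Longrightarrow> l < r \<Longrightarrow> t \<in> Poly_Mapping.keys (Z k l) \<Longrightarrow> d k + total_deg t = e l"
  shows "\<exists>A'. (\<forall>s l. A' s l \<in> carrier (poly_ring V)) \<and>
    (\<forall>k<m. \<forall>l<r. mat_mult n P A' k l = Z k l) \<and>
    (\<forall>s l. \<forall>t\<in>Poly_Mapping.keys (A' s l). d' s + total_deg t = e l)"
proof (intro exI conjI allI impI ballI)
  let ?A = "\<lambda>s l. homogeneous_part (d' s) (e l) (A s l)"
  show "?A s l \<in> carrier (poly_ring V)" for s l by (rule homogeneous_part_carrier[OF A])
  show "d' s + total_deg t = e l" if "t \<in> Poly_Mapping.keys (?A s l)" for s l t
    using that by (simp add: keys_homogeneous_part)
  show "mat_mult n P ?A k l = Z k l" if kl: "k < m" "l < r" for k l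
  proof -
    have "mat_mult n P ?A k l = (\<Sum>s<n. homogeneous_part (d k) (e l) (P k s * A s l))"
      unfolding mat_mult_def
      by (rule sum.cong) (use P[OF kl(1)] in \<open>auto intro!: homogeneous_part_mult[symmetric]\<close>)
    also have "\<dots> = homogeneous_part (d k) (e l) (mat_mult n P A k l)"
      by (simp add: mat_mult_def homogeneous_part_sum)
    also have "\<dots> = Z k l"
      unfolding eq[OF kl] using Z[OF kl] by (rule homogeneous_part_id)
    finally show ?thesis .
  qed
qed

lemma fun_resolutionD:
  "fun_resolution V J b d P \<Longrightarrow> b 0 = 1"
  "fun_resolution V J b d P \<Longrightarrow> d 0 0 = 0"
  "fun_resolution V J b d P \<Longrightarrow> k < b i \<Longrightarrow> l < b (Suc i) \<Longrightarrow> P i k l \<in> carrier (poly_ring V)"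
  "fun_resolution V J b d P \<Longrightarrow> k < b i \<Longrightarrow> l < b (Suc i) \<Longrightarrow> t \<in> Poly_Mapping.keys (P i k l) \<Longrightarrow>
    d i k + total_deg t = d (Suc i) l"
  "fun_resolution V J b d P \<Longrightarrow> k < b (Suc i) \<Longrightarrow> l < b (Suc (Suc i)) \<Longrightarrow>
    Poly_Mapping.lookup (P (Suc i) k l) 0 = 0"
  "fun_resolution V J b d P \<Longrightarrow> (\<lambda>v. mat_apply 1 (b 1) (P 0) v 0) ` free_fun V (b 1) = J"
  "fun_resolution V J b d P \<Longrightarrow>
    {v \<in> free_fun V (b (Suc i)). mat_apply (b i) (b (Suc i)) (P i) v = 0} =
      mat_apply (b (Suc i)) (b (Suc (Suc i))) (P (Suc i)) ` free_fun V (b (Suc (Suc i)))"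
  unfolding fun_resolution_def by simp_all

text \<open>Exactness applied to each column of Z separately.\<close>

lemma kernel_lift:
  assumes res: "fun_resolution V J b d P"
    and Z: "\<And>k l. k < b (Suc i) \<Longrightarrow> l < r \<Longrightarrow> Z k l \<in> carrier (poly_ring V)"
    and ker: "\<And>k l. k < b i \<Longrightarrow> l < r \<Longrightarrow> mat_mult (b (Suc i)) (P i) Z k l = 0"
  shows "\<exists>A. (\<forall>s l. A s l \<in> carrier (poly_ring V)) \<and>
    (\<forall>k<b (Suc i). \<forall>l<r. mat_mult (b (Suc (Suc i))) (P (Suc i)) A k l = Z k l)"
proof -
  have "\<exists>w. w \<in> free_fun V (b (Suc (Suc i))) \<and>
      (l < r \<longrightarrow> (\<forall>k<b (Suc i). (\<Sum>s<b (Suc (Suc i)). P (Suc i) k s * w s) = Z k l))" for l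
  proof (cases "l < r")
    case True
    define z where "z k = (if k < b (Suc i) then Z k l else 0)" for k
    have "z \<in> free_fun V (b (Suc i))" using Z True by (auto simp: z_def free_fun_def carrier_zero)
    moreover have "mat_apply (b i) (b (Suc i)) (P i) z = 0"
    proof
      fix k
      have "(\<Sum>s<b (Suc i). P i k s * z s) = mat_mult (b (Suc i)) (P i) Z k l"
        unfolding mat_mult_def by (rule sum.cong) (auto simp: z_def)
      then show "mat_apply (b i) (b (Suc i)) (P i) z k = 0 k"
        using ker[OF _ True] by (simp add: mat_apply_def)
    qed
    ultimately have "z \<in> mat_apply (b (Suc i)) (b (Suc (Suc i))) (P (Suc i)) ` free_fun V (b (Suc (Suc i)))"
      using fun_resolutionD(7)[OF res, of i] by blast
    then obtain w where w: "w \<in> free_fun V (b (Suc (Suc i)))"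
      "z = mat_apply (b (Suc i)) (b (Suc (Suc i))) (P (Suc i)) w" by blast
    have "(\<Sum>s<b (Suc (Suc i)). P (Suc i) k s * w s) = Z k l" if "k < b (Suc i)" for k
      using fun_cong[OF w(2), of k] that by (simp add: mat_apply_def z_def)
    then show ?thesis using w(1) by blast
  next
    case False
    have "0 \<in> free_fun V (b (Suc (Suc i)))" by (simp add: free_fun_def carrier_zero)
    then show ?thesis using False by blast
  qed
  then obtain w where w: "\<And>l. w l \<in> free_fun V (b (Suc (Suc i)))"
    "\<And>l k. l < r \<Longrightarrow> k < b (Suc i) \<Longrightarrow> (\<Sum>s<b (Suc (Suc i)). P (Suc i) k s * w l s) = Z k l"
    by metis
  show ?thesis
    by (intro exI[of _ "\<lambda>s l. w l s"] conjI allI impI)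
      (use w in \<open>auto simp: free_fun_def mat_mult_def\<close>)
qed

lemma augmentation_lift:
  assumes res: "fun_resolution V J b d P"
    and Z: "\<And>l. l < r \<Longrightarrow> Z 0 l \<in> J"
  shows "\<exists>A. (\<forall>s l. A s l \<in> carrier (poly_ring V)) \<and>
    (\<forall>k<b 0. \<forall>l<r. mat_mult (b (Suc 0)) (P 0) A k l = Z k l)"
proof -
  have "\<exists>w. w \<in> free_fun V (b (Suc 0)) \<and> (l < r \<longrightarrow> (\<Sum>s<b (Suc 0). P 0 0 s * w s) = Z 0 l)" for l
  proof (cases "l < r")
    case True
    then show ?thesis using Z[OF True] fun_resolutionD(6)[OF res] by (auto simp: mat_apply_def)
  next
    case False
    have "0 \<in> free_fun V (b (Suc 0))" by (simp add: free_fun_def carrier_zero)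
    then show ?thesis using False by blast
  qed
  then obtain w where w: "\<And>l. w l \<in> free_fun V (b (Suc 0))"
    "\<And>l. l < r \<Longrightarrow> (\<Sum>s<b (Suc 0). P 0 0 s * w l s) = Z 0 l"
    by metis
  show ?thesis
    by (intro exI[of _ "\<lambda>s l. w l s"] conjI allI impI)
      (use w fun_resolutionD(1)[OF res] in \<open>auto simp: free_fun_def mat_mult_def\<close>)
qed

lemma resolution_complex:
  assumes res: "fun_resolution V J b d P" and kl: "k < b i" "l < b (Suc (Suc i))"
  shows "mat_mult (b (Suc i)) (P i) (P (Suc i)) k l = 0"
proof -
  define e where "e s = (if s = l then 1 else 0 :: ('a, 'b) mpoly)" for s
  have "e \<in> free_fun V (b (Suc (Suc i)))"
    using kl by (auto simp: e_def free_fun_def carrier_poly_ring)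
  then have *: "mat_apply (b i) (b (Suc i)) (P i) (mat_apply (b (Suc i)) (b (Suc (Suc i))) (P (Suc i)) e) = 0"
    using fun_resolutionD(7)[OF res, of i] by blast
  have "mat_apply (b (Suc i)) (b (Suc (Suc i))) (P (Suc i)) e s = P (Suc i) s l" if "s < b (Suc i)" for s
    using kl that by (simp add: mat_apply_def e_def if_distrib[of "\<lambda>x. _ * x"] cong: if_cong)
  then have "mat_mult (b (Suc i)) (P i) (P (Suc i)) k l =
      mat_apply (b i) (b (Suc i)) (P i) (mat_apply (b (Suc i)) (b (Suc (Suc i))) (P (Suc i)) e) k"
    using kl by (simp add: mat_mult_def mat_apply_def)
  then show ?thesis using * by simp
qed

lemma augmentation_column:
  assumes res: "fun_resolution V J b d P" and l: "l < b (Suc 0)"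
  shows "P 0 0 l \<in> J"
proof -
  define e where "e s = (if s = l then 1 else 0 :: ('a, 'b) mpoly)" for s
  have "e \<in> free_fun V (b 1)"
    using l by (auto simp: e_def free_fun_def carrier_poly_ring)
  moreover have "mat_apply 1 (b 1) (P 0) e 0 = P 0 0 l"
    using l by (simp add: mat_apply_def e_def if_distrib[of "\<lambda>x. _ * x"] cong: if_cong)
  ultimately show ?thesis using fun_resolutionD(6)[OF res] by force
qed

text \<open>One step of the comparison theorem. A is an arbitrary lift, which only witnesses
  solvability; its homogeneous part becomes the next component \<alpha>', and exactness supplies the
  lift A' for the step after that.\<close>

lemma lift_step:
  assumes res: "fun_resolution V J b d P" and res': "fun_resolution V J b' d' P'"
    and \<alpha>: "\<And>s l. \<alpha> s l \<in> carrier (poly_ring V)"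
      "\<And>s l t. t \<in> Poly_Mapping.keys (\<alpha> s l) \<Longrightarrow> s < b' i \<Longrightarrow> l < b i \<Longrightarrow> d' i s + total_deg t = d i l"
    and A: "\<And>s l. A s l \<in> carrier (poly_ring V)"
      "\<And>k l. k < b' i \<Longrightarrow> l < b (Suc i) \<Longrightarrow> mat_mult (b' (Suc i)) (P' i) A k l = mat_mult (b i) \<alpha> (P i) k l"
  obtains \<alpha>' A' where "\<And>s l. \<alpha>' s l \<in> carrier (poly_ring V)"
    "\<And>s l t. t \<in> Poly_Mapping.keys (\<alpha>' s l) \<Longrightarrow> d' (Suc i) s + total_deg t = d (Suc i) l"
    "\<And>k l. k < b' i \<Longrightarrow> l < b (Suc i) \<Longrightarrow> mat_mult (b' (Suc i)) (P' i) \<alpha>' k l = mat_mult (b i) \<alpha> (P i) k l"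
    "\<And>s l. A' s l \<in> carrier (poly_ring V)"
    "\<And>k l. k < b' (Suc i) \<Longrightarrow> l < b (Suc (Suc i)) \<Longrightarrow>
      mat_mult (b' (Suc (Suc i))) (P' (Suc i)) A' k l = mat_mult (b (Suc i)) \<alpha>' (P (Suc i)) k l"
proof -
  have "\<exists>\<alpha>'. (\<forall>s l. \<alpha>' s l \<in> carrier (poly_ring V)) \<and>
    (\<forall>k<b' i. \<forall>l<b (Suc i). mat_mult (b' (Suc i)) (P' i) \<alpha>' k l = mat_mult (b i) \<alpha> (P i) k l) \<and>
    (\<forall>s l. \<forall>t\<in>Poly_Mapping.keys (\<alpha>' s l). d' (Suc i) s + total_deg t = d (Suc i) l)"
  proof (rule homogeneous_lift[OF A, where d = "d' i"])
    show "d' i k + total_deg t = d' (Suc i) s"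
      if "k < b' i" "s < b' (Suc i)" "t \<in> Poly_Mapping.keys (P' i k s)" for k s t
      by (rule fun_resolutionD(4)[OF res' that])
    show "d' i k + total_deg t = d (Suc i) l"
      if k: "k < b' i" and l: "l < b (Suc i)" and t: "t \<in> Poly_Mapping.keys (mat_mult (b i) \<alpha> (P i) k l)" for k l t
    proof -
      have "Poly_Mapping.lookup (mat_mult (b i) \<alpha> (P i) k l) t \<noteq> 0" using t by (simp add: in_keys_iff)
      then obtain s where s: "s < b i" "Poly_Mapping.lookup (\<alpha> k s * P i s l) t \<noteq> 0"
        unfolding mat_mult_def lookup_sum by (metis (no_types, lifting) lessThan_iff sum.neutral)
      then have "t \<in> Poly_Mapping.keys (\<alpha> k s * P i s l)" by (simp add: in_keys_iff)
      then obtain t1 t2 where "t = t1 + t2" "t1 \<in> Poly_Mapping.keys (\<alpha> k s)" "t2 \<in> Poly_Mapping.keys (P i s l)"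
        using keys_mult by blast
      then show ?thesis
        using \<alpha>(2)[of t1 k s] fun_resolutionD(4)[OF res s(1) l, of t2] k s(1) by (simp add: total_deg_add)
    qed
  qed
  then obtain \<alpha>' where \<alpha>': "\<And>s l. \<alpha>' s l \<in> carrier (poly_ring V)"
    "\<And>k l. k < b' i \<Longrightarrow> l < b (Suc i) \<Longrightarrow> mat_mult (b' (Suc i)) (P' i) \<alpha>' k l = mat_mult (b i) \<alpha> (P i) k l"
    "\<forall>s l. \<forall>t\<in>Poly_Mapping.keys (\<alpha>' s l). d' (Suc i) s + total_deg t = d (Suc i) l"
    by blast
  have "\<exists>A'. (\<forall>s l. A' s l \<in> carrier (poly_ring V)) \<and> (\<forall>k<b' (Suc i). \<forall>l<b (Suc (Suc i)).
      mat_mult (b' (Suc (Suc i))) (P' (Suc i)) A' k l = mat_mult (b (Suc i)) \<alpha>' (P (Suc i)) k l)"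
  proof (rule kernel_lift[OF res'])
    show "mat_mult (b (Suc i)) \<alpha>' (P (Suc i)) k l \<in> carrier (poly_ring V)" if "l < b (Suc (Suc i))" for k l
      using that by (intro mat_mult_carrier \<alpha>' fun_resolutionD(3)[OF res])
    show "mat_mult (b' (Suc i)) (P' i) (mat_mult (b (Suc i)) \<alpha>' (P (Suc i))) k l = 0"
      if k: "k < b' i" and l: "l < b (Suc (Suc i))" for k l
    proof -
      have "mat_mult (b' (Suc i)) (P' i) (mat_mult (b (Suc i)) \<alpha>' (P (Suc i))) k l =
        mat_mult (b (Suc i)) (mat_mult (b' (Suc i)) (P' i) \<alpha>') (P (Suc i)) k l" by (rule mat_mult_assoc)
      also have "\<dots> = mat_mult (b (Suc i)) (mat_mult (b i) \<alpha> (P i)) (P (Suc i)) k l"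
        by (rule mat_mult_cong) (use \<alpha>'(2) k in auto)
      also have "\<dots> = mat_mult (b i) \<alpha> (mat_mult (b (Suc i)) (P i) (P (Suc i))) k l"
        by (rule mat_mult_assoc[symmetric])
      also have "\<dots> = 0"
        unfolding mat_mult_def[of "b i"] using resolution_complex[OF res _ l] by (intro sum.neutral) simp
      finally show ?thesis .
    qed
  qed
  then obtain A' where A': "\<And>s l. A' s l \<in> carrier (poly_ring V)"
    "\<And>k l. k < b' (Suc i) \<Longrightarrow> l < b (Suc (Suc i)) \<Longrightarrow>
      mat_mult (b' (Suc (Suc i))) (P' (Suc i)) A' k l = mat_mult (b (Suc i)) \<alpha>' (P (Suc i)) k l"
    by blast
  show thesis
    by (rule that[of \<alpha>' A']) (use \<alpha>' A' in simp_all)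
qed

text \<open>Comparison of two minimal resolutions: \<open>\<alpha>\<close> and \<open>\<beta>\<close> are the components in degree \<open>i\<close> of chain
  maps over the identity of \<open>J\<close>, \<open>A\<close> and \<open>B\<close> witness that both can be continued, and \<open>h\<close> is the
  component of a homotopy from \<open>\<beta> \<alpha>\<close> to the identity. By minimality the homotopy does not
  contribute to the constant terms of \<open>\<beta> \<alpha>\<close>.\<close>

definition comparison_data where
  "comparison_data V b d P b' d' P' i \<alpha> \<beta> A B h \<longleftrightarrow>
    (\<forall>s l. \<alpha> s l \<in> carrier (poly_ring V)) \<and> (\<forall>s l. \<beta> s l \<in> carrier (poly_ring V)) \<and>
    (\<forall>s l. A s l \<in> carrier (poly_ring V)) \<and> (\<forall>s l. B s l \<in> carrier (poly_ring V)) \<and>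
    (\<forall>s l. h s l \<in> carrier (poly_ring V)) \<and>
    (\<forall>s<b' i. \<forall>l<b i. \<forall>t\<in>Poly_Mapping.keys (\<alpha> s l). d' i s + total_deg t = d i l) \<and>
    (\<forall>s<b i. \<forall>l<b' i. \<forall>t\<in>Poly_Mapping.keys (\<beta> s l). d i s + total_deg t = d' i l) \<and>
    (\<forall>k<b' i. \<forall>l<b (Suc i). mat_mult (b' (Suc i)) (P' i) A k l = mat_mult (b i) \<alpha> (P i) k l) \<and>
    (\<forall>k<b i. \<forall>l<b' (Suc i). mat_mult (b (Suc i)) (P i) B k l = mat_mult (b' i) \<beta> (P' i) k l) \<and>
    (\<forall>k<b i. \<forall>l<b (Suc i). mat_mult (b i) (\<lambda>k s. mat_mult (b' i) \<beta> \<alpha> k s - (if k = s then 1 else 0) -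
        mat_mult (b (Suc i)) (P i) h k s) (P i) k l = 0) \<and>
    (\<forall>k<b i. \<forall>l<b i. Poly_Mapping.lookup (mat_mult (b' i) \<beta> \<alpha> k l) 0 = (if k = l then 1 else 0)) \<and>
    (i = 0 \<longrightarrow> h = (\<lambda>_ _. 0))" for V :: "'v set" and P :: "nat \<Rightarrow> nat \<Rightarrow> nat \<Rightarrow> ('v, 'k::field) mpoly"

lemma comparison_dataD:
  "comparison_data V b d P b' d' P' i \<alpha> \<beta> A B h \<Longrightarrow> \<alpha> s l \<in> carrier (poly_ring V)"
  "comparison_data V b d P b' d' P' i \<alpha> \<beta> A B h \<Longrightarrow> \<beta> s l \<in> carrier (poly_ring V)"
  "comparison_data V b d P b' d' P' i \<alpha> \<beta> A B h \<Longrightarrow> A s l \<in> carrier (poly_ring V)"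
  "comparison_data V b d P b' d' P' i \<alpha> \<beta> A B h \<Longrightarrow> B s l \<in> carrier (poly_ring V)"
  "comparison_data V b d P b' d' P' i \<alpha> \<beta> A B h \<Longrightarrow> h s l \<in> carrier (poly_ring V)"
  "comparison_data V b d P b' d' P' i \<alpha> \<beta> A B h \<Longrightarrow> t \<in> Poly_Mapping.keys (\<alpha> s l) \<Longrightarrow>
    s < b' i \<Longrightarrow> l < b i \<Longrightarrow> d' i s + total_deg t = d i l"
  "comparison_data V b d P b' d' P' i \<alpha> \<beta> A B h \<Longrightarrow> t \<in> Poly_Mapping.keys (\<beta> s l) \<Longrightarrow>
    s < b i \<Longrightarrow> l < b' i \<Longrightarrow> d i s + total_deg t = d' i l"
  "comparison_data V b d P b' d' P' i \<alpha> \<beta> A B h \<Longrightarrow> k < b' i \<Longrightarrow> l < b (Suc i) \<Longrightarrow>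
    mat_mult (b' (Suc i)) (P' i) A k l = mat_mult (b i) \<alpha> (P i) k l"
  "comparison_data V b d P b' d' P' i \<alpha> \<beta> A B h \<Longrightarrow> k < b i \<Longrightarrow> l < b' (Suc i) \<Longrightarrow>
    mat_mult (b (Suc i)) (P i) B k l = mat_mult (b' i) \<beta> (P' i) k l"
  "comparison_data V b d P b' d' P' i \<alpha> \<beta> A B h \<Longrightarrow> k < b i \<Longrightarrow> l < b (Suc i) \<Longrightarrow>
    mat_mult (b i) (\<lambda>k s. mat_mult (b' i) \<beta> \<alpha> k s - (if k = s then 1 else 0) -
      mat_mult (b (Suc i)) (P i) h k s) (P i) k l = 0"
  "comparison_data V b d P b' d' P' i \<alpha> \<beta> A B h \<Longrightarrow> k < b i \<Longrightarrow> l < b i \<Longrightarrow>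
    Poly_Mapping.lookup (mat_mult (b' i) \<beta> \<alpha> k l) 0 = (if k = l then 1 else 0)"
  "comparison_data V b d P b' d' P' i \<alpha> \<beta> A B h \<Longrightarrow> i = 0 \<Longrightarrow> h = (\<lambda>_ _. 0)"
  unfolding comparison_data_def by simp_all

lemma resolution_comparison:
  assumes res: "fun_resolution V J b d P" and res': "fun_resolution V J b' d' P'"
  shows "\<exists>\<alpha> \<beta> A B h. comparison_data V b d P b' d' P' i \<alpha> \<beta> A B h"
proof (induction i)
  case 0
  \<comment> \<open>In degree 0 both resolutions have the ring itself, and both chain maps start
    with its identity and the zero homotopy.\<close>
  let ?id = "\<lambda>s l. if s = l then 1 else 0 :: ('a, 'b) mpoly"
  note b0 = fun_resolutionD(1)[OF res] fun_resolutionD(1)[OF res']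
  note d0 = fun_resolutionD(2)[OF res] fun_resolutionD(2)[OF res']
  have id: "mat_mult (Suc 0) ?id Q 0 l = Q 0 l" for Q l by (simp add: mat_mult_def)
  obtain A where A: "\<And>s l. A s l \<in> carrier (poly_ring V)"
    "\<And>k l. k < b' 0 \<Longrightarrow> l < b (Suc 0) \<Longrightarrow> mat_mult (b' (Suc 0)) (P' 0) A k l = P 0 k l"
    using augmentation_lift[OF res', of "b (Suc 0)" "P 0"] augmentation_column[OF res] by blast
  obtain B where B: "\<And>s l. B s l \<in> carrier (poly_ring V)"
    "\<And>k l. k < b 0 \<Longrightarrow> l < b' (Suc 0) \<Longrightarrow> mat_mult (b (Suc 0)) (P 0) B k l = P' 0 k l"
    using augmentation_lift[OF res, of "b' (Suc 0)" "P' 0"] augmentation_column[OF res'] by blast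
  have "comparison_data V b d P b' d' P' 0 ?id ?id A B (\<lambda>_ _. 0)"
    unfolding comparison_data_def
  proof (intro conjI)
    show "\<forall>k<b 0. \<forall>l<b (Suc 0). mat_mult (b 0) (\<lambda>k s. mat_mult (b' 0) ?id ?id k s - ?id k s -
        mat_mult (b (Suc 0)) (P 0) (\<lambda>_ _. 0) k s) (P 0) k l = 0"
      by (simp add: b0 mat_mult_def)
    show "\<forall>k<b 0. \<forall>l<b 0. Poly_Mapping.lookup (mat_mult (b' 0) ?id ?id k l) 0 = (if k = l then 1 else 0)"
      by (simp add: b0 mat_mult_def)
  qed (use A B in \<open>auto simp: b0 d0 id carrier_poly_ring total_deg_def\<close>)
  then show ?case by (intro exI)
next
  case (Suc i)
  then obtain \<alpha> \<beta> A B h where cd: "comparison_data V b d P b' d' P' i \<alpha> \<beta> A B h"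
    by (elim exE)
  note ca = comparison_dataD(1)[OF cd] and cb = comparison_dataD(2)[OF cd]
    and cA = comparison_dataD(3)[OF cd] and cB = comparison_dataD(4)[OF cd]
    and ch = comparison_dataD(5)[OF cd] and ha = comparison_dataD(6)[OF cd]
    and hb = comparison_dataD(7)[OF cd] and A = comparison_dataD(8)[OF cd]
    and B = comparison_dataD(9)[OF cd] and H = comparison_dataD(10)[OF cd]
    and h0 = comparison_dataD(12)[OF cd]
  obtain \<alpha>' A' where
    ca': "\<And>s l. \<alpha>' s l \<in> carrier (poly_ring V)" and
    ha': "\<And>s l t. t\<in>Poly_Mapping.keys (\<alpha>' s l) \<Longrightarrow> d' (Suc i) s + total_deg t = d (Suc i) l" and
    comm_a: "\<And>k l. k < b' i \<Longrightarrow> l < b (Suc i) \<Longrightarrow> mat_mult (b' (Suc i)) (P' i) \<alpha>' k l = mat_mult (b i) \<alpha> (P i) k l" and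
    cA': "\<And>s l. A' s l \<in> carrier (poly_ring V)" and
    A': "\<And>k l. k < b' (Suc i) \<Longrightarrow> l < b (Suc (Suc i)) \<Longrightarrow>
      mat_mult (b' (Suc (Suc i))) (P' (Suc i)) A' k l = mat_mult (b (Suc i)) \<alpha>' (P (Suc i)) k l"
    by (rule lift_step[OF res res', where \<alpha> = \<alpha> and A = A and i = i])
      (rule ca, (rule ha; assumption), rule cA, (rule A; assumption), (rule that; assumption))
  obtain \<beta>' B' where
    cb': "\<And>s l. \<beta>' s l \<in> carrier (poly_ring V)" and
    hb': "\<And>s l t. t\<in>Poly_Mapping.keys (\<beta>' s l) \<Longrightarrow> d (Suc i) s + total_deg t = d' (Suc i) l" and
    comm_b: "\<And>k l. k < b i \<Longrightarrow> l < b' (Suc i) \<Longrightarrow> mat_mult (b (Suc i)) (P i) \<beta>' k l = mat_mult (b' i) \<beta> (P' i) k l" and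
    cB': "\<And>s l. B' s l \<in> carrier (poly_ring V)" and
    B': "\<And>k l. k < b (Suc i) \<Longrightarrow> l < b' (Suc (Suc i)) \<Longrightarrow>
      mat_mult (b (Suc (Suc i))) (P (Suc i)) B' k l = mat_mult (b' (Suc i)) \<beta>' (P' (Suc i)) k l"
    by (rule lift_step[OF res' res, where \<alpha> = \<beta> and A = B and i = i])
      (rule cb, (rule hb; assumption), rule cB, (rule B; assumption), (rule that; assumption))
  let ?id = "\<lambda>k s. if k = s then 1 else 0 :: ('a, 'b) mpoly"
  let ?\<gamma> = "mat_mult (b' (Suc i)) \<beta>' \<alpha>'"
  \<comment> \<open>The defect that the next homotopy has to absorb: \<beta>' \<alpha>' minus the
    identity minus h followed into by P i. Its columns are killed by P i, so they lift to
    h'.\<close>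
  let ?Z = "\<lambda>k l. ?\<gamma> k l - ?id k l - mat_mult (b i) h (P i) k l"
  have cid: "?id k l \<in> carrier (poly_ring V)" for k l by (simp add: carrier_poly_ring)
  have Pg: "mat_mult (b (Suc i)) (P i) ?\<gamma> k l = mat_mult (b i) (mat_mult (b' i) \<beta> \<alpha>) (P i) k l"
    if k: "k < b i" and l: "l < b (Suc i)" for k l
  proof -
    have "mat_mult (b (Suc i)) (P i) ?\<gamma> k l = mat_mult (b' (Suc i)) (mat_mult (b (Suc i)) (P i) \<beta>') \<alpha>' k l"
      by (rule mat_mult_assoc)
    also have "\<dots> = mat_mult (b' (Suc i)) (mat_mult (b' i) \<beta> (P' i)) \<alpha>' k l"
      by (rule mat_mult_cong) (use comm_b k in auto)
    also have "\<dots> = mat_mult (b' i) \<beta> (mat_mult (b' (Suc i)) (P' i) \<alpha>') k l"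
      by (rule mat_mult_assoc[symmetric])
    also have "\<dots> = mat_mult (b' i) \<beta> (mat_mult (b i) \<alpha> (P i)) k l"
      by (rule mat_mult_cong) (use comm_a l in auto)
    also have "\<dots> = mat_mult (b i) (mat_mult (b' i) \<beta> \<alpha>) (P i) k l"
      by (rule mat_mult_assoc)
    finally show ?thesis .
  qed
  have "\<exists>h'. (\<forall>s l. h' s l \<in> carrier (poly_ring V)) \<and>
    (\<forall>k<b (Suc i). \<forall>l<b (Suc i). mat_mult (b (Suc (Suc i))) (P (Suc i)) h' k l = ?Z k l)"
  proof (rule kernel_lift[OF res])
    show "?Z k l \<in> carrier (poly_ring V)" if "k < b (Suc i)" "l < b (Suc i)" for k l
      using that by (intro carrier_diff mat_mult_carrier cid ca' cb' ch fun_resolutionD(3)[OF res])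
    show "mat_mult (b (Suc i)) (P i) ?Z k l = 0" if k: "k < b i" and l: "l < b (Suc i)" for k l
    proof -
      have "mat_mult (b (Suc i)) (P i) ?Z k l =
        mat_mult (b i) (mat_mult (b' i) \<beta> \<alpha>) (P i) k l - P i k l -
        mat_mult (b i) (mat_mult (b (Suc i)) (P i) h) (P i) k l"
        by (simp add: mat_mult_diff_right Pg[OF k l] mat_mult_id_right[OF l]
          mat_mult_assoc[of "b (Suc i)" "P i" "b i" h "P i"])
      also have "\<dots> = 0"
        using H[OF k l] by (simp add: mat_mult_diff_left mat_mult_id_left[OF k])
      finally show ?thesis .
    qed
  qed
  then obtain h' where ch': "\<And>s l. h' s l \<in> carrier (poly_ring V)"
    and h': "\<And>k l. k < b (Suc i) \<Longrightarrow> l < b (Suc i) \<Longrightarrow> mat_mult (b (Suc (Suc i))) (P (Suc i)) h' k l = ?Z k l"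
    by blast
  have H': "mat_mult (b (Suc i)) (\<lambda>k s. ?\<gamma> k s - ?id k s - mat_mult (b (Suc (Suc i))) (P (Suc i)) h' k s) (P (Suc i)) k l = 0"
    if k: "k < b (Suc i)" and l: "l < b (Suc (Suc i))" for k l
  proof -
    have "mat_mult (b (Suc i)) (\<lambda>k s. ?\<gamma> k s - ?id k s - mat_mult (b (Suc (Suc i))) (P (Suc i)) h' k s) (P (Suc i)) k l =
      mat_mult (b (Suc i)) (mat_mult (b i) h (P i)) (P (Suc i)) k l"
      by (rule mat_mult_cong) (use h' k in auto)
    also have "\<dots> = mat_mult (b i) h (mat_mult (b (Suc i)) (P i) (P (Suc i))) k l"
      by (rule mat_mult_assoc[symmetric])
    also have "\<dots> = 0"
      unfolding mat_mult_def[of "b i"] using resolution_complex[OF res _ l] by (intro sum.neutral) simp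
    finally show ?thesis .
  qed
  have const: "Poly_Mapping.lookup (?\<gamma> k l) 0 = (if k = l then 1 else 0)"
    if k: "k < b (Suc i)" and l: "l < b (Suc i)" for k l
  proof -
    have 1: "Poly_Mapping.lookup (mat_mult (b (Suc (Suc i))) (P (Suc i)) h' k l) 0 = 0"
      unfolding lookup_mat_mult_zero using fun_resolutionD(5)[OF res k] by (intro sum.neutral) simp
    \<comment> \<open>For i > 0 the differential P i has no constant terms. The augmentation P 0 may
      have some, for instance for the unit ideal; there the homotopy is zero by
      construction.\<close>
    have 2: "Poly_Mapping.lookup (mat_mult (b i) h (P i) k l) 0 = 0"
    proof (cases i)
      case 0
      then show ?thesis using h0 by (simp add: mat_mult_def)
    next
      case (Suc j)
      then show ?thesis
        unfolding lookup_mat_mult_zero using fun_resolutionD(5)[OF res, of _ j l] l by (intro sum.neutral) simp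
    qed
    have "Poly_Mapping.lookup (?\<gamma> k l) 0 - Poly_Mapping.lookup (?id k l) 0 = 0"
      using 1 2 unfolding h'[OF k l] by (simp add: lookup_minus)
    then show ?thesis by (simp add: lookup_one split: if_splits)
  qed
  have "comparison_data V b d P b' d' P' (Suc i) \<alpha>' \<beta>' A' B' h'"
    unfolding comparison_data_def
    using ca' cb' cA' cB' ch' ha' hb' A' B' H' const by simp
  then show ?case by (intro exI)
qed

text \<open>A left inverse makes the columns of A independent, and compatibility with degrees places
  the columns of degree j in the span of the unit vectors of degree j. This compares the ranks
  degree by degree.\<close>

lemma card_le_of_left_inverse:
  fixes A B :: "nat \<Rightarrow> nat \<Rightarrow> 'k::field"
  assumes inv: "\<And>k l. k < n \<Longrightarrow> l < n \<Longrightarrow> (\<Sum>s<m. B k s * A s l) = (if k = l then 1 else 0)"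
    and A: "\<And>s l. s < m \<Longrightarrow> l < n \<Longrightarrow> A s l \<noteq> 0 \<Longrightarrow> e s = d l"
  shows "card {l. l < n \<and> d l = j} \<le> card {s. s < m \<and> e s = j}"
proof -
  define L where "L = {l. l < n \<and> d l = j}"
  define K where "K = {s. s < m \<and> e s = j}"
  define a where "a l = (\<lambda>s. if s < m then A s l else 0)" for l
  define u where "u s = (\<lambda>k. if k = s then 1 else 0 :: 'k)" for s :: nat
  have fin: "finite L" "finite K" by (auto simp: L_def K_def)
  have Ba: "(\<Sum>s<m. B k s * a l s) = (if k = l then 1 else 0)" if "k < n" "l < n" for k l
    using inv[OF that] by (simp add: a_def)
  have inj: "inj_on a L"
  proof (rule inj_onI)
    fix l l' assume l: "l \<in> L" "l' \<in> L" "a l = a l'"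
    then have "(if l = l then 1 else 0 :: 'k) = (if l = l' then 1 else 0)"
      using Ba[of l l] Ba[of l l'] by (simp add: L_def)
    then show "l = l'" by (simp split: if_splits)
  qed
  have "fun_vs.independent (a ` L)"
  proof (rule fun_vs.independent_if_scalars_zero)
    show "finite (a ` L)" using fin by simp
    fix f x assume *: "(\<Sum>x\<in>a ` L. (\<lambda>k. f x * x k)) = 0" and "x \<in> a ` L"
    then obtain l0 where l0: "l0 \<in> L" "x = a l0" by blast
    have s: "(\<Sum>l\<in>L. f (a l) * a l s) = 0" for s
      using fun_cong[OF *, of s] by (simp add: sum.reindex[OF inj] sum_fun_apply)
    have "0 = (\<Sum>s<m. B l0 s * (\<Sum>l\<in>L. f (a l) * a l s))" by (simp add: s)
    also have "\<dots> = (\<Sum>l\<in>L. \<Sum>s<m. B l0 s * (f (a l) * a l s))"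
      unfolding sum_distrib_left by (rule sum.swap)
    also have "\<dots> = (\<Sum>l\<in>L. f (a l) * (\<Sum>s<m. B l0 s * a l s))"
      by (simp add: sum_distrib_left algebra_simps)
    also have "\<dots> = (\<Sum>l\<in>L. if l0 = l then f (a l) else 0)"
      using l0 by (intro sum.cong) (auto simp: L_def Ba)
    also have "\<dots> = f x" using fin l0 by simp
    finally show "f x = 0" by simp
  qed
  moreover have "a ` L \<subseteq> fun_vs.span (u ` K)"
  proof
    fix x assume "x \<in> a ` L"
    then obtain l where l: "l \<in> L" "x = a l" by blast
    have "x = (\<Sum>s\<in>K. (\<lambda>k. a l s * u s k))"
    proof
      fix k
      have "(\<Sum>s\<in>K. a l s * u s k) = (\<Sum>s\<in>K. if s = k then a l k else 0)"
        by (rule sum.cong) (auto simp: u_def)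
      also have "\<dots> = (if k \<in> K then a l k else 0)" using fin by simp
      also have "\<dots> = x k" using A[of k l] l by (auto simp: a_def K_def L_def)
      finally show "x k = (\<Sum>s\<in>K. (\<lambda>k. a l s * u s k)) k" by (simp add: sum_fun_apply)
    qed
    also have "\<dots> \<in> fun_vs.span (u ` K)"
      by (intro fun_vs.span_sum fun_vs.span_scale fun_vs.span_base) auto
    finally show "x \<in> fun_vs.span (u ` K)" .
  qed
  ultimately have "card (a ` L) \<le> card (u ` K)"
    using fun_vs.independent_span_bound[of "u ` K" "a ` L"] fin by blast
  also have "\<dots> \<le> card K" using fin by (intro card_image_le)
  finally show ?thesis using card_image[OF inj] by (simp add: L_def K_def)
qed

text \<open>The constant terms of \<alpha> and \<beta> are such matrices: \<beta> \<alpha> is the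
  identity modulo the maximal ideal, and a nonzero constant entry of the homogeneous \<alpha> joins
  basis elements of equal degree.\<close>

lemma resolution_count_le:
  assumes res: "fun_resolution V J b d P" and res': "fun_resolution V J b' d' P'"
  shows "card {l. l < b i \<and> d i l = j} \<le> card {l. l < b' i \<and> d' i l = j}"
proof -
  obtain \<alpha> \<beta> A B h where cd: "comparison_data V b d P b' d' P' i \<alpha> \<beta> A B h"
    using resolution_comparison[OF res res', of i] by (elim exE)
  note ha = comparison_dataD(6)[OF cd] and c = comparison_dataD(11)[OF cd]
  show ?thesis
  proof (rule card_le_of_left_inverse[where A = "\<lambda>s l. Poly_Mapping.lookup (\<alpha> s l) 0" and B = "\<lambda>s l. Poly_Mapping.lookup (\<beta> s l) 0"])
    show "(\<Sum>s<b' i. Poly_Mapping.lookup (\<beta> k s) 0 * Poly_Mapping.lookup (\<alpha> s l) 0) = (if k = l then 1 else 0)"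
      if "k < b i" "l < b i" for k l
      using c[OF that] by (simp add: lookup_mat_mult_zero)
    show "d' i s = d i l" if "s < b' i" "l < b i" "Poly_Mapping.lookup (\<alpha> s l) 0 \<noteq> 0" for s l
      using ha[of 0 s l] that by (simp add: in_keys_iff total_deg_def)
  qed
qed

section \<open>Translation to the matrices and vectors of the resolution predicate\<close>

lemma mult_mat_vec_free_fun:
  assumes "A \<in> carrier_mat m n"
  shows "A *\<^sub>v vec n u = vec m (mat_apply m n (\<lambda>k l. A $$ (k, l)) u)"
  using assms by (intro eq_vecI) (auto simp: scalar_prod_def atLeast0LessThan mat_apply_def)

lemma free_module_eq: "free_module V n = vec n ` free_fun V n"
proof (intro equalityI subsetI)
  fix v assume v: "v \<in> free_module V n"
  then have dim: "dim_vec v = n" and c: "\<And>k. k < n \<Longrightarrow> v $ k \<in> carrier (poly_ring V)"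
    by (auto simp: free_module_def vec_set_def)
  have "v = vec n (\<lambda>k. if k < n then v $ k else 0)" using dim by (intro eq_vecI) auto
  moreover have "(\<lambda>k. if k < n then v $ k else 0) \<in> free_fun V n"
    using c by (auto simp: free_fun_def carrier_zero)
  ultimately show "v \<in> vec n ` free_fun V n" by blast
next
  fix v assume "v \<in> vec n ` free_fun V n"
  then show "v \<in> free_module V n" by (auto simp: free_module_def vec_set_def free_fun_def)
qed

lemma vec_eq_iff_fun:
  assumes "\<And>k. n \<le> k \<Longrightarrow> u k = 0" "\<And>k. n \<le> k \<Longrightarrow> w k = 0"
  shows "vec n u = vec n w \<longleftrightarrow> u = w"
proof
  assume eq: "vec n u = vec n w"
  show "u = w"
  proof
    fix k
    show "u k = w k"
    proof (cases "k < n")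
      case True
      then show ?thesis using eq by (metis index_vec)
    qed (use assms in simp)
  qed
qed simp

lemma vec_image_eq_iff:
  assumes "\<And>u. u \<in> A \<Longrightarrow> \<forall>k\<ge>n. u k = 0" "\<And>u. u \<in> B \<Longrightarrow> \<forall>k\<ge>n. u k = 0"
  shows "vec n ` A = vec n ` B \<longleftrightarrow> A = B"
proof (rule inj_on_image_eq_iff[where C = "{u. \<forall>k\<ge>n. u k = 0}"])
  show "inj_on (vec n) {u. \<forall>k\<ge>n. u k = 0}"
    by (rule inj_onI) (simp add: vec_eq_iff_fun)
qed (use assms in auto)

text \<open>Prefixing the ring, of rank 1 and degree 0, turns the augmentation into one more
  differential; its separate homogeneity condition becomes the instance 0 of the common one.\<close>

lemma minimal_graded_free_resolution_iff:
  fixes \<phi> :: "nat \<Rightarrow> ('v, 'k::field) mpoly mat"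
  assumes b0: "b 0 = 1" and d0: "d 0 0 = 0" and dim: "\<And>i. \<phi> i \<in> carrier_mat (b i) (b (Suc i))"
  shows "minimal_graded_free_resolution V J (\<lambda>i. b (Suc i)) (\<lambda>i. d (Suc i)) \<phi> \<longleftrightarrow>
    fun_resolution V J b d (\<lambda>i k l. \<phi> i $$ (k, l))"
proof -
  let ?P = "\<lambda>i k l. \<phi> i $$ (k, l)"
  have dims: "dim_row (\<phi> i) = b i" "dim_col (\<phi> i) = b (Suc i)" for i using dim[of i] by auto
  have c: "(\<forall>i. elements_mat (\<phi> i) \<subseteq> carrier (poly_ring V)) \<longleftrightarrow>
      (\<forall>i. \<forall>k<b i. \<forall>l<b (Suc i). ?P i k l \<in> carrier (poly_ring V))"
  proof (intro iffI allI impI subsetI)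
    fix i k l assume "\<forall>i. elements_mat (\<phi> i) \<subseteq> carrier (poly_ring V)" "k < b i" "l < b (Suc i)"
    then show "?P i k l \<in> carrier (poly_ring V)" using elements_matI[OF dim] by blast
  next
    fix i p assume "\<forall>i. \<forall>k<b i. \<forall>l<b (Suc i). ?P i k l \<in> carrier (poly_ring V)" "p \<in> elements_mat (\<phi> i)"
    then show "p \<in> carrier (poly_ring V)" using elements_matD[of p "\<phi> i"] by (auto simp: dims)
  qed
  have hom: "(\<forall>k<b (Suc 0). \<forall>t\<in>Poly_Mapping.keys (\<phi> 0 $$ (0, k)). total_deg t = d (Suc 0) k) \<and>
      (\<forall>i. \<forall>k<b (Suc i). \<forall>l<b (Suc (Suc i)). \<forall>t\<in>Poly_Mapping.keys (\<phi> (Suc i) $$ (k, l)).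
        d (Suc i) k + total_deg t = d (Suc (Suc i)) l) \<longleftrightarrow>
      (\<forall>i. \<forall>k<b i. \<forall>l<b (Suc i). \<forall>t\<in>Poly_Mapping.keys (?P i k l). d i k + total_deg t = d (Suc i) l)"
  proof -
    define R where "R i \<longleftrightarrow> (\<forall>k<b i. \<forall>l<b (Suc i). \<forall>t\<in>Poly_Mapping.keys (\<phi> i $$ (k, l)).
      d i k + total_deg t = d (Suc i) l)" for i
    have "(\<forall>i. R i) \<longleftrightarrow> R 0 \<and> (\<forall>i. R (Suc i))"
      by (metis not0_implies_Suc)
    then show ?thesis by (simp add: R_def b0 d0)
  qed
  have img: "{(\<phi> 0 *\<^sub>v v) $ 0 |v. v \<in> free_module V (b (Suc 0))} =
      (\<lambda>v. mat_apply 1 (b 1) (?P 0) v 0) ` free_fun V (b 1)"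
  proof -
    have "{(\<phi> 0 *\<^sub>v v) $ 0 |v. v \<in> free_module V (b (Suc 0))} =
        (\<lambda>u. (\<phi> 0 *\<^sub>v vec (b 1) u) $ 0) ` free_fun V (b 1)"
      unfolding free_module_eq by auto
    also have "\<dots> = (\<lambda>v. mat_apply 1 (b 1) (?P 0) v 0) ` free_fun V (b 1)"
      using dim[of 0] by (intro image_cong refl) (simp add: mult_mat_vec_free_fun b0)
    finally show ?thesis .
  qed
  have ex: "{v \<in> free_module V (b (Suc i)). \<phi> i *\<^sub>v v = 0\<^sub>v (dim_row (\<phi> i))} =
        {\<phi> (Suc i) *\<^sub>v w |w. w \<in> free_module V (b (Suc (Suc i)))} \<longleftrightarrow>
      {v \<in> free_fun V (b (Suc i)). mat_apply (b i) (b (Suc i)) (?P i) v = 0} =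
        mat_apply (b (Suc i)) (b (Suc (Suc i))) (?P (Suc i)) ` free_fun V (b (Suc (Suc i)))" for i
  proof -
    have z: "0\<^sub>v (dim_row (\<phi> i)) = vec (b i) (0 :: nat \<Rightarrow> ('v, 'k) mpoly)"
      by (intro eq_vecI) (auto simp: dims)
    have "\<phi> i *\<^sub>v vec (b (Suc i)) u = 0\<^sub>v (dim_row (\<phi> i)) \<longleftrightarrow> mat_apply (b i) (b (Suc i)) (?P i) u = 0" for u
      unfolding z mult_mat_vec_free_fun[OF dim]
      by (rule vec_eq_iff_fun) (simp_all add: mat_apply_def)
    then have 1: "{v \<in> free_module V (b (Suc i)). \<phi> i *\<^sub>v v = 0\<^sub>v (dim_row (\<phi> i))} =
        vec (b (Suc i)) ` {v \<in> free_fun V (b (Suc i)). mat_apply (b i) (b (Suc i)) (?P i) v = 0}"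
      unfolding free_module_eq by auto
    have 2: "{\<phi> (Suc i) *\<^sub>v w |w. w \<in> free_module V (b (Suc (Suc i)))} =
        vec (b (Suc i)) ` (mat_apply (b (Suc i)) (b (Suc (Suc i))) (?P (Suc i)) ` free_fun V (b (Suc (Suc i))))"
      by (simp add: Setcompr_eq_image free_module_eq image_image mult_mat_vec_free_fun[OF dim])
    show ?thesis
      unfolding 1 2 by (rule vec_image_eq_iff) (auto simp: free_fun_def mat_apply_def)
  qed
  show ?thesis
    unfolding minimal_graded_free_resolution_def fun_resolution_def c img ex hom[symmetric]
    using b0 d0 dim[of 0] dim by auto
qed

lemma resolution_of_frame:
  fixes c :: "nat \<Rightarrow> nat \<Rightarrow> nat \<Rightarrow> 'k::field"
  assumes fr: "frame V U b D c M" and V: "finite V"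
  shows "minimal_graded_free_resolution V (upset_ideal V U) (\<lambda>i. b (Suc i)) (\<lambda>i k. card (D (Suc i) k))
    (\<lambda>i. mat (b i) (b (Suc i)) (\<lambda>(k, l). frame_mat (D i) (D (Suc i)) (c i) k l))"
proof -
  let ?\<phi> = "\<lambda>i. mat (b i) (b (Suc i)) (\<lambda>(k, l). frame_mat (D i) (D (Suc i)) (c i) k l)"
  have b0: "b 0 = 1" "card (D 0 0) = 0" using frameD(1,2)[OF fr] by auto
  note res = frame_resolution[OF fr V]
  have ap: "mat_apply (b i) (b (Suc i)) (\<lambda>k l. ?\<phi> i $$ (k, l)) =
      mat_apply (b i) (b (Suc i)) (frame_mat (D i) (D (Suc i)) (c i))" for i
    by (auto simp: mat_apply_def fun_eq_iff intro!: sum.cong)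
  have ap0: "mat_apply 1 (b 1) (\<lambda>k l. ?\<phi> 0 $$ (k, l)) =
      mat_apply 1 (b 1) (frame_mat (D 0) (D (Suc 0)) (c 0))"
    using ap[of 0] b0 by simp
  have "fun_resolution V (upset_ideal V U) b (\<lambda>i k. card (D i k)) (\<lambda>i k l. ?\<phi> i $$ (k, l))"
    using res unfolding fun_resolution_def ap ap0 by simp
  then show ?thesis
    by (subst minimal_graded_free_resolution_iff) (simp_all add: b0)
qed

lemma resolution_count_unique:
  assumes r: "minimal_graded_free_resolution V J b d \<phi>" and r': "minimal_graded_free_resolution V J b' d' \<phi>'"
  shows "card {k. k < b i \<and> d i k = j} = card {k. k < b' i \<and> d' i k = j}"
proof -
  \<comment> \<open>\<open>case_nat\<close> puts the ring in front of the ranks and degrees.\<close>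
  have F: "fun_resolution V J (case_nat 1 b) (case_nat (\<lambda>_. 0) d) (\<lambda>i k l. \<phi> i $$ (k, l))"
    if r: "minimal_graded_free_resolution V J b d \<phi>" for b d and \<phi> :: "nat \<Rightarrow> ('a, 'b) mpoly mat"
  proof -
    have "\<phi> i \<in> carrier_mat (case_nat 1 b i) (case_nat 1 b (Suc i))" for i
      using r unfolding minimal_graded_free_resolution_def by (cases i) simp_all
    then have "minimal_graded_free_resolution V J (\<lambda>i. case_nat 1 b (Suc i)) (\<lambda>i. case_nat (\<lambda>_. 0) d (Suc i)) \<phi> \<longleftrightarrow>
      fun_resolution V J (case_nat 1 b) (case_nat (\<lambda>_. 0) d) (\<lambda>i k l. \<phi> i $$ (k, l))"
      by (intro minimal_graded_free_resolution_iff) simp_all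
    then show ?thesis using r by simp
  qed
  show ?thesis
    using resolution_count_le[OF F[OF r] F[OF r'], of "Suc i" j]
      resolution_count_le[OF F[OF r'] F[OF r], of "Suc i" j] by simp
qed

lemma graded_betti_eq:
  assumes "minimal_graded_free_resolution V J b d \<phi>"
  shows "graded_betti V J i j = card {k. k < b i \<and> d i k = j}"
  unfolding graded_betti_def
proof (rule the_equality)
  show "\<exists>b' d' \<phi>'. minimal_graded_free_resolution V J b' d' \<phi>' \<and>
      card {k. k < b i \<and> d i k = j} = card {k. k < b' i \<and> d' i k = j}"
    using assms by blast
  show "n = card {k. k < b i \<and> d i k = j}"
    if "\<exists>b' d' \<phi>'. minimal_graded_free_resolution V J b' d' \<phi>' \<and> n = card {k. k < b' i \<and> d' i k = j}" for n
    using that resolution_count_unique[OF assms] by metis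
qed

text \<open>The vanishing part of Hochster's formula. Regularity depends only on which Betti numbers
  vanish, so dimensions of homology never have to be computed.\<close>

theorem graded_betti_upset_ideal:
  fixes V :: "'v::countable set"
  assumes V: "finite V" and U: "upset U"
  shows "graded_betti V (upset_ideal V U :: ('v, 'k::field) mpoly set) i j \<noteq> 0 \<longleftrightarrow>
    (\<exists>S\<subseteq>V. card S = j \<and> \<not> exact_at (upset_family U :: 'v set \<Rightarrow> 'k set) i S)"
proof -
  obtain b D and c :: "nat \<Rightarrow> nat \<Rightarrow> nat \<Rightarrow> 'k" and M where fr: "frame V U b D c M"
    using ex_frame[OF V U] by blast
  have "graded_betti V (upset_ideal V U :: ('v, 'k) mpoly set) i j = card {k. k < b (Suc i) \<and> card (D (Suc i) k) = j}"
    by (rule graded_betti_eq[OF resolution_of_frame[OF fr V]])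
  also have "\<dots> \<noteq> 0 \<longleftrightarrow> (\<exists>k<b (Suc i). card (D (Suc i) k) = j)"
    by (simp add: card_eq_0_iff)
  also have "\<dots> \<longleftrightarrow> (\<exists>S\<subseteq>V. card S = j \<and> (\<exists>k<b (Suc i). D (Suc i) k = S))"
    using frameD(4)[OF fr] by blast
  also have "\<dots> \<longleftrightarrow> (\<exists>S\<subseteq>V. card S = j \<and> \<not> exact_at (upset_family U :: 'v set \<Rightarrow> 'k set) i S)"
    by (intro ex_cong1 conj_cong refl) (rule frame_betti_iff[OF fr V])
  finally show ?thesis .
qed

lemma exact_at_large:
  assumes "finite S" "card S < p"
  shows "exact_at M p S"
  unfolding exact_at_def
proof (intro ballI impI)
  fix f assume f: "f \<in> chains S M p"
  have "f = 0"
  proof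
    fix \<sigma>
    show "f \<sigma> = 0 \<sigma>"
      using chainsD(1,2)[OF f, of \<sigma>] assms card_mono[of S \<sigma>] by fastforce
  qed
  moreover have "0 \<in> chains S M (Suc p)" "bd S (0 :: _ \<Rightarrow> 'b) = 0"
    by (auto simp: chains_def bd_def fun_eq_iff)
  ultimately show "\<exists>g\<in>chains S M (Suc p). bd S g = f" by metis
qed

theorem regularity_upset_ideal:
  fixes V :: "'v::countable set"
  assumes V: "finite V" and U: "upset U" and le: "reg_le TYPE('k::field) U r"
    and S: "S \<subseteq> V" "card S = p + r" "\<not> exact_at (upset_family U :: 'v set \<Rightarrow> 'k set) p S"
  shows "regularity V (upset_ideal V U :: ('v, 'k) mpoly set) = int r"
proof -
  let ?B = "{int j - int i |i j. graded_betti V (upset_ideal V U :: ('v, 'k) mpoly set) i j \<noteq> 0}"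
  have B: "?B = {int (card S) - int i |i S. S \<subseteq> V \<and> \<not> exact_at (upset_family U :: 'v set \<Rightarrow> 'k set) i S}"
    unfolding graded_betti_upset_ideal[OF V U] by blast
  have ub: "x \<le> int r" if xB: "x \<in> ?B" for x
  proof -
    obtain i S where x: "x = int (card S) - int i" "S \<subseteq> V" "\<not> exact_at (upset_family U :: 'v set \<Rightarrow> 'k set) i S"
      using xB unfolding B by blast
    have "card S \<le> i + r"
      using le x(3) finite_subset[OF x(2) V] unfolding reg_le_def by blast
    then show ?thesis using x(1) by simp
  qed
  \<comment> \<open>Together with the upper bound this confines the set to a finite interval, which
    \<open>Max\<close> requires.\<close>
  have lb: "0 \<le> x" if xB: "x \<in> ?B" for x
  proof -
    obtain i S where x: "x = int (card S) - int i" "S \<subseteq> V" "\<not> exact_at (upset_family U :: 'v set \<Rightarrow> 'k set) i S"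
      using xB unfolding B by blast
    have "\<not> card S < i" using exact_at_large[of S i] x(3) finite_subset[OF x(2) V] by blast
    then show ?thesis using x(1) by simp
  qed
  have "finite ?B"
  proof (rule finite_subset)
    show "?B \<subseteq> {0..int r}"
    proof
      fix x assume "x \<in> ?B"
      from ub[OF this] lb[OF this] show "x \<in> {0..int r}" by simp
    qed
  qed simp
  moreover have "int r \<in> ?B"
    unfolding B using S by (intro CollectI exI[of _ p] exI[of _ S]) simp
  ultimately show ?thesis
    unfolding regularity_def using ub by (intro Max_eqI) auto
qed

lemma ideal_upset_ideal:
  fixes V :: "'v set"
  assumes U: "upset U"
  shows "ideal (upset_ideal V U :: ('v, 'k::field) mpoly set) (poly_ring V)"
proof (rule idealI)
  let ?R = "poly_ring V :: ('v, 'k) mpoly ring"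
  show "ring ?R" using cring_poly_ring cring.axioms(1) by blast
  interpret cring ?R by (rule cring_poly_ring)
  show "subgroup (upset_ideal V U) (add_monoid ?R)"
  proof (rule add.subgroupI)
    show "upset_ideal V U \<subseteq> carrier ?R" by (auto simp: upset_ideal_def)
    show "upset_ideal V U \<noteq> ({} :: ('v, 'k) mpoly set)"
      using carrier_zero by (force simp: upset_ideal_def)
    show "\<ominus>\<^bsub>?R\<^esub> p \<in> upset_ideal V U" if "p \<in> upset_ideal V U" for p
    proof -
      have p: "p \<in> carrier ?R" using that by (simp add: upset_ideal_def)
      have "\<ominus>\<^bsub>?R\<^esub> p = - p"
        by (rule minus_equality[OF _ p]) (use carrier_uminus[OF p] in simp_all)
      then show ?thesis using that carrier_uminus[OF p] by (simp add: upset_ideal_def)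
    qed
    show "p \<oplus>\<^bsub>?R\<^esub> q \<in> upset_ideal V U" if "p \<in> upset_ideal V U" "q \<in> upset_ideal V U" for p q
      using that keys_add[of p q] carrier_add[of p V q] by (auto simp: upset_ideal_def)
  qed
  show mult: "x \<otimes>\<^bsub>?R\<^esub> p \<in> upset_ideal V U" if p: "p \<in> upset_ideal V U" and x: "x \<in> carrier ?R" for p x
  proof -
    have "U (Poly_Mapping.keys t)" if t: "t \<in> Poly_Mapping.keys (x * p)" for t
    proof -
      obtain a s where "t = a + s" "s \<in> Poly_Mapping.keys p" using keys_mult[of x p] t by blast
      then show ?thesis using p upsetD[OF U, of "Poly_Mapping.keys s"]
        by (auto simp: upset_ideal_def keys_monomial_add)
    qed
    then show ?thesis using carrier_mult[of x V p] x p by (simp add: upset_ideal_def)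
  qed
  show "p \<otimes>\<^bsub>?R\<^esub> x \<in> upset_ideal V U" if "p \<in> upset_ideal V U" "x \<in> carrier ?R" for p x
    using mult[OF that] by (simp add: mult.commute)
qed

section \<open>Upper bound\<close>

definition edge_upset :: "'v set set \<Rightarrow> 'v set \<Rightarrow> bool" where
  "edge_upset E S \<longleftrightarrow> (\<exists>e\<in>E. e \<subseteq> S)"

definition matching_upset :: "'v set set \<Rightarrow> 'v set \<Rightarrow> bool" where
  "matching_upset E S \<longleftrightarrow> (\<exists>e\<in>E. \<exists>f\<in>E. e \<inter> f = {} \<and> e \<union> f \<subseteq> S)"

definition neighbours :: "'v set set \<Rightarrow> 'v \<Rightarrow> 'v set" where
  "neighbours E v = {u. u \<noteq> v \<and> {v, u} \<in> E}"

definition del_vertices :: "'v set set \<Rightarrow> 'v set \<Rightarrow> 'v set set" where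
  "del_vertices E A = {e \<in> E. e \<inter> A = {}}"

text \<open>If \<open>N\<close> is the neighbourhood of a vertex \<open>x\<close>, this is the colon ideal of the second square-free
  power by \<open>x\<close>, with \<open>E\<close> the edges of the graph without \<open>x\<close>.\<close>

definition pointed_upset :: "'v set set \<Rightarrow> 'v set \<Rightarrow> 'v set \<Rightarrow> bool" where
  "pointed_upset E N S \<longleftrightarrow> matching_upset E S \<or> (\<exists>b\<in>N. \<exists>e\<in>E. b \<notin> e \<and> insert b e \<subseteq> S)"

lemma upset_edge: "upset (edge_upset E)"
  unfolding upset_def edge_upset_def by blast

lemma upset_matching: "upset (matching_upset E)"
  unfolding upset_def matching_upset_def by blast

lemma upset_pointed: "upset (pointed_upset E N)"
  unfolding upset_def pointed_upset_def using upset_matching[of E] by (blast dest: upsetD)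

lemma edge_at:
  assumes "card e = 2" "v \<in> e"
  shows "\<exists>u. u \<noteq> v \<and> e = {v, u}"
  using assms by (auto simp: card_2_iff insert_commute)

lemma edge_upset_delete: "edge_upset E (S - A) = edge_upset (del_vertices E A) S"
  unfolding edge_upset_def del_vertices_def by blast

text \<open>The colon of an edge ideal by v turns the neighbours of v into variables; only edges
  outside the closed neighbourhood remain relevant.\<close>

lemma edge_upset_insert:
  assumes "\<forall>e\<in>E. card e = 2"
  shows "edge_upset E (insert v S) \<longleftrightarrow>
    S \<inter> neighbours E v \<noteq> {} \<or> edge_upset (del_vertices E (insert v (neighbours E v))) S"
proof
  assume "edge_upset E (insert v S)"
  then obtain e where e: "e \<in> E" "e \<subseteq> insert v S" by (auto simp: edge_upset_def)
  show "S \<inter> neighbours E v \<noteq> {} \<or> edge_upset (del_vertices E (insert v (neighbours E v))) S"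
  proof (cases "v \<in> e")
    case True
    then obtain u where "u \<noteq> v" "e = {v, u}"
      using assms e edge_at[of e v] by blast
    then show ?thesis using e by (auto simp: neighbours_def)
  next
    case False
    then show ?thesis using e unfolding edge_upset_def del_vertices_def by blast
  qed
next
  assume "S \<inter> neighbours E v \<noteq> {} \<or> edge_upset (del_vertices E (insert v (neighbours E v))) S"
  then show "edge_upset E (insert v S)"
  proof
    assume "S \<inter> neighbours E v \<noteq> {}"
    then obtain u where "u \<in> S" "{v, u} \<in> E" by (auto simp: neighbours_def)
    then show ?thesis unfolding edge_upset_def by (intro bexI[of _ "{v, u}"]) auto
  next
    assume "edge_upset (del_vertices E (insert v (neighbours E v))) S"
    then show ?thesis unfolding edge_upset_def del_vertices_def by blast
  qed
qed

text \<open>Combines the split at v with \<open>reg_le_variables\<close>: the neighbours that appear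
  as variables in the colon ideal do not raise its bound.\<close>

lemma reg_le_edge_split:
  assumes E: "\<forall>e\<in>E. card e = 2" and fin: "finite (neighbours E v)"
    and del: "reg_le K (edge_upset (del_vertices E {v})) (Suc (Suc k))"
    and colon: "reg_le K (edge_upset (del_vertices E (insert v (neighbours E v)))) (Suc k)"
  shows "reg_le K (edge_upset E) (Suc (Suc k))"
proof (rule reg_le_split[OF upset_edge, where x = v])
  show "reg_le K (\<lambda>S. edge_upset E (S - {v})) (Suc (Suc k))"
    using del by (simp add: edge_upset_delete)
  have "reg_le K (\<lambda>S. S \<inter> neighbours E v \<noteq> {} \<or>
      edge_upset (del_vertices E (insert v (neighbours E v))) S) (Suc k)"
  proof (rule reg_le_variables[OF upset_edge _ colon fin order_refl])
    show "edge_upset (del_vertices E (insert v (neighbours E v))) (S - neighbours E v) =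
        edge_upset (del_vertices E (insert v (neighbours E v))) S" for S
      unfolding edge_upset_def del_vertices_def by blast
  qed
  then show "reg_le K (\<lambda>S. edge_upset E (insert v S)) (Suc k)"
    by (simp only: edge_upset_insert[OF E])
qed

lemma finite_neighbours: "finite E \<Longrightarrow> finite (neighbours E v)"
proof -
  assume "finite E"
  moreover have "inj_on (\<lambda>u. {v, u}) (neighbours E v)"
    by (auto simp: inj_on_def doubleton_eq_iff)
  moreover have "(\<lambda>u. {v, u}) ` neighbours E v \<subseteq> E" by (auto simp: neighbours_def)
  ultimately show ?thesis by (rule inj_on_finite[rotated 2])
qed

text \<open>Splits at a vertex u of the last clique. Deleting u shrinks that clique, while in the
  colon ideal the whole clique disappears because it lies in the closed neighbourhood of u. Hence an
  induction on the number of cliques with an inner one on the size of the last.\<close>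

lemma reg_le_clique_cover:
  assumes "finite E" "\<forall>e\<in>E. card e = 2"
    and "\<forall>j<k. finite (Q j) \<and> (\<forall>u\<in>Q j. \<forall>v\<in>Q j. u \<noteq> v \<longrightarrow> {u, v} \<in> E)"
    and "\<forall>e\<in>E. \<exists>j<k. e \<inter> Q j \<noteq> {}"
  shows "reg_le K (edge_upset E) (Suc k)"
  using assms
proof (induction k arbitrary: E Q)
  case 0
  then have "E = {}" by auto
  then have "edge_upset E = (\<lambda>_. False)" by (auto simp: edge_upset_def)
  then show ?case by (simp add: reg_le_False)
next
  case (Suc k)
  note IH = Suc.IH
  from Suc.prems show ?case
  proof (induction "card (Q k)" arbitrary: E Q)
    case 0
    then have "Q k = {}" by auto
    then have "\<forall>e\<in>E. \<exists>j<k. e \<inter> Q j \<noteq> {}"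
      using 0 by (metis Int_empty_right less_antisym)
    moreover have "\<forall>j<k. finite (Q j) \<and> (\<forall>u\<in>Q j. \<forall>v\<in>Q j. u \<noteq> v \<longrightarrow> {u, v} \<in> E)"
      using 0(4) less_SucI by metis
    ultimately have "reg_le K (edge_upset E) (Suc k)"
      using IH[of E Q] 0(2,3) by metis
    then show ?case by (rule reg_le_mono) simp
  next
    case (Suc c)
    then have "Q k \<noteq> {}" by auto
    then obtain u where u: "u \<in> Q k" by auto
    let ?D = "insert u (neighbours E u)"
    have clique: "\<forall>v\<in>Q k. u \<noteq> v \<longrightarrow> {u, v} \<in> E" using Suc.prems(3) u lessI by blast
    show ?case
    proof (rule reg_le_edge_split[where v = u])
      show "reg_le K (edge_upset (del_vertices E {u})) (Suc (Suc k))"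
      proof (rule Suc.hyps(1)[where Q = "\<lambda>j. Q j - {u}"])
        show "c = card (Q k - {u})" using Suc.hyps(2) u by simp
        show "\<forall>e\<in>del_vertices E {u}. \<exists>j<Suc k. e \<inter> (Q j - {u}) \<noteq> {}"
        proof
          fix e assume "e \<in> del_vertices E {u}"
          then have e: "e \<in> E" "u \<notin> e" by (auto simp: del_vertices_def)
          then obtain j where "j < Suc k" "e \<inter> Q j \<noteq> {}" using Suc.prems(4) by blast
          then show "\<exists>j<Suc k. e \<inter> (Q j - {u}) \<noteq> {}" using e by blast
        qed
      qed (use Suc.prems in \<open>auto simp: del_vertices_def\<close>)
      show "reg_le K (edge_upset (del_vertices E ?D)) (Suc k)"
      proof (rule IH[where Q = "\<lambda>j. Q j - ?D"])
        show "\<forall>j<k. finite (Q j - ?D) \<and>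
          (\<forall>u\<in>Q j - ?D. \<forall>v\<in>Q j - ?D. u \<noteq> v \<longrightarrow> {u, v} \<in> del_vertices E ?D)"
        proof (intro allI impI)
          fix j assume "j < k"
          then have "finite (Q j) \<and> (\<forall>u\<in>Q j. \<forall>v\<in>Q j. u \<noteq> v \<longrightarrow> {u, v} \<in> E)"
            using Suc.prems(3) less_SucI by blast
          then show "finite (Q j - ?D) \<and>
            (\<forall>u\<in>Q j - ?D. \<forall>v\<in>Q j - ?D. u \<noteq> v \<longrightarrow> {u, v} \<in> del_vertices E ?D)"
            by (auto simp: del_vertices_def)
        qed
        show "\<forall>e\<in>del_vertices E ?D. \<exists>j<k. e \<inter> (Q j - ?D) \<noteq> {}"
        proof
          fix e assume "e \<in> del_vertices E ?D"
          then have e: "e \<in> E" "e \<inter> ?D = {}" by (auto simp: del_vertices_def)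
          then obtain j w where j: "j < Suc k" "w \<in> e" "w \<in> Q j" using Suc.prems(4) by blast
          \<comment> \<open>An edge avoiding the closed neighbourhood of u cannot meet the last
            clique, so one of the other k cliques covers it.\<close>
          have "j \<noteq> k"
          proof
            assume "j = k"
            then have "w = u \<or> {u, w} \<in> E" using clique j(3) by auto
            then have "w \<in> ?D" by (auto simp: neighbours_def)
            then show False using e j by blast
          qed
          then have "j < k" using j(1) by simp
          then show "\<exists>j<k. e \<inter> (Q j - ?D) \<noteq> {}" using e j by blast
        qed
      qed (use Suc.prems in \<open>auto simp: del_vertices_def\<close>)
    qed (use Suc.prems finite_neighbours in auto)
  qed
qed

text \<open>Pairing consecutive vertices of the path gives (n + 1) div 2 cliques with at most two
  vertices. This is the only shape of clique cover used below.\<close>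

lemma reg_le_path_cover:
  assumes E: "finite E" "\<forall>e\<in>E. card e = 2"
    and cover: "\<And>e. e \<in> E \<Longrightarrow> \<exists>i<n. w i \<in> e"
    and path: "\<And>i. Suc i < n \<Longrightarrow> {w i, w (Suc i)} \<in> E"
    and r: "Suc ((n + 1) div 2) \<le> r"
  shows "reg_le K (edge_upset E) r"
proof -
  define Q where "Q j = w ` {i. i < n \<and> (i = 2 * j \<or> i = Suc (2 * j))}" for j
  have "reg_le K (edge_upset E) (Suc ((n + 1) div 2))"
  proof (rule reg_le_clique_cover[OF E, of _ Q])
    show "\<forall>e\<in>E. \<exists>j<(n + 1) div 2. e \<inter> Q j \<noteq> {}"
    proof
      fix e assume "e \<in> E"
      then obtain i where i: "i < n" "w i \<in> e" using cover by blast
      have "i = 2 * (i div 2) \<or> i = Suc (2 * (i div 2))" by presburger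
      then have "w i \<in> Q (i div 2)" using i by (auto simp: Q_def)
      moreover have "i div 2 < (n + 1) div 2" using i by presburger
      ultimately show "\<exists>j<(n + 1) div 2. e \<inter> Q j \<noteq> {}" using i by blast
    qed
    show "\<forall>j<(n + 1) div 2. finite (Q j) \<and> (\<forall>u\<in>Q j. \<forall>v\<in>Q j. u \<noteq> v \<longrightarrow> {u, v} \<in> E)"
      using path by (auto simp: Q_def insert_commute)
  qed
  then show ?thesis using r by (rule reg_le_mono)
qed

section \<open>Colon ideals of second square-free powers\<close>

lemma matching_upset_delete: "matching_upset E (S - A) = matching_upset (del_vertices E A) S"
proof -
  have "e \<union> f \<subseteq> S - A \<longleftrightarrow> e \<inter> A = {} \<and> f \<inter> A = {} \<and> e \<union> f \<subseteq> S" for e f by blast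
  then show ?thesis by (auto simp: matching_upset_def del_vertices_def)
qed

lemma pointed_upset_delete: "pointed_upset E N (S - A) = pointed_upset (del_vertices E A) (N - A) S"
proof -
  have "insert b e \<subseteq> S - A \<longleftrightarrow> b \<notin> A \<and> e \<inter> A = {} \<and> insert b e \<subseteq> S" for b e by blast
  then show ?thesis by (auto simp: pointed_upset_def matching_upset_delete del_vertices_def)
qed

lemma pointed_upset_empty: "pointed_upset E {} = matching_upset E"
  by (auto simp: pointed_upset_def fun_eq_iff)

text \<open>At most one edge of a matching contains v. Dividing by v leaves the other end of that
  edge times a disjoint edge, or the matching itself if it avoids v.\<close>

lemma matching_upset_insert:
  assumes E: "\<forall>e\<in>E. card e = 2"
  shows "matching_upset E (insert v S) = pointed_upset (del_vertices E {v}) (neighbours E v) S"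
proof
  assume "matching_upset E (insert v S)"
  then obtain e f where ef: "e \<in> E" "f \<in> E" "e \<inter> f = {}" "e \<union> f \<subseteq> insert v S"
    unfolding matching_upset_def by blast
  have *: "pointed_upset (del_vertices E {v}) (neighbours E v) S"
    if ef: "e \<in> E" "f \<in> E" "e \<inter> f = {}" "e \<union> f \<subseteq> insert v S" "v \<in> e" for e f
  proof -
    obtain u where u: "u \<noteq> v" "e = {v, u}"
      using E ef edge_at[of e v] by blast
    then show ?thesis
      using ef unfolding pointed_upset_def
      by (intro disjI2 bexI[of _ u] bexI[of _ f]) (auto simp: neighbours_def del_vertices_def)
  qed
  consider "v \<in> e" | "v \<in> f" | "v \<notin> e" "v \<notin> f" by blast
  then show "pointed_upset (del_vertices E {v}) (neighbours E v) S"
  proof cases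
    case 1
    show ?thesis by (rule *[OF ef 1])
  next
    case 2
    show ?thesis by (rule *[of f e]) (use ef 2 in auto)
  next
    case 3
    then have "e \<in> del_vertices E {v}" "f \<in> del_vertices E {v}" "e \<union> f \<subseteq> S"
      using ef by (auto simp: del_vertices_def)
    then show ?thesis using ef(3) unfolding pointed_upset_def matching_upset_def by blast
  qed
next
  assume "pointed_upset (del_vertices E {v}) (neighbours E v) S"
  then show "matching_upset E (insert v S)"
    unfolding pointed_upset_def
  proof
    assume "matching_upset (del_vertices E {v}) S"
    then show ?thesis unfolding matching_upset_def del_vertices_def by blast
  next
    assume "\<exists>b\<in>neighbours E v. \<exists>e\<in>del_vertices E {v}. b \<notin> e \<and> insert b e \<subseteq> S"
    then obtain b e where b: "{v, b} \<in> E" "e \<in> E" "v \<notin> e" "b \<notin> e" "insert b e \<subseteq> S"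
      by (auto simp: neighbours_def del_vertices_def)
    then show ?thesis unfolding matching_upset_def
      by (intro bexI[of _ "{v, b}"] bexI[of _ e]) auto
  qed
qed

text \<open>A generator c times {b, d} with c in N loses b in the colon ideal and becomes the new
  edge {c, d}.\<close>

definition colon_edges :: "'v set set \<Rightarrow> 'v set \<Rightarrow> 'v \<Rightarrow> 'v set set" where
  "colon_edges E N b =
     del_vertices E {b} \<union> {{c, d} |c d. c \<in> N - {b} \<and> d \<in> neighbours E b \<and> c \<noteq> d}"

text \<open>A second colon lands among edge ideals again: as b is in N, every edge avoiding b is
  already in the colon ideal. This absorbs all matchings, since one of two disjoint edges avoids
  b.\<close>

lemma pointed_upset_insert:
  assumes E: "\<forall>e\<in>E. card e = 2" and b: "b \<in> N"
  shows "pointed_upset E N (insert b S) = edge_upset (colon_edges E N b) S"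
proof
  have I: "edge_upset (colon_edges E N b) S" if "e \<in> E" "b \<notin> e" "e \<subseteq> insert b S" for e
    using that unfolding edge_upset_def colon_edges_def del_vertices_def by blast
  assume "pointed_upset E N (insert b S)"
  then show "edge_upset (colon_edges E N b) S"
    unfolding pointed_upset_def
  proof
    assume "matching_upset E (insert b S)"
    then obtain e f where ef: "e \<in> E" "f \<in> E" "e \<inter> f = {}" "e \<subseteq> insert b S" "f \<subseteq> insert b S"
      unfolding matching_upset_def by blast
    then have "b \<notin> e \<or> b \<notin> f" by blast
    then show ?thesis using I ef by blast
  next
    assume "\<exists>c\<in>N. \<exists>e\<in>E. c \<notin> e \<and> insert c e \<subseteq> insert b S"
    then obtain c e where c: "c \<in> N" "e \<in> E" "c \<notin> e" "insert c e \<subseteq> insert b S" by blast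
    show ?thesis
    proof (cases "b \<in> e")
      case True
      then obtain d where d: "d \<noteq> b" "e = {b, d}"
        using E c edge_at[of e b] by blast
      then have "{c, d} \<in> colon_edges E N b" "{c, d} \<subseteq> S"
        using c by (auto simp: colon_edges_def neighbours_def)
      then show ?thesis unfolding edge_upset_def by blast
    next
      case False
      then show ?thesis using I c by blast
    qed
  qed
next
  assume "edge_upset (colon_edges E N b) S"
  then obtain e where e: "e \<in> colon_edges E N b" "e \<subseteq> S" by (auto simp: edge_upset_def)
  from e(1) have "e \<in> del_vertices E {b} \<or> (\<exists>c d. e = {c, d} \<and> c \<in> N - {b} \<and> d \<in> neighbours E b \<and> c \<noteq> d)"
    by (auto simp: colon_edges_def)
  then show "pointed_upset E N (insert b S)"
  proof (elim disjE exE conjE)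
    assume "e \<in> del_vertices E {b}"
    then show ?thesis unfolding pointed_upset_def using e b
      by (intro disjI2 bexI[of _ b] bexI[of _ e]) (auto simp: del_vertices_def)
  next
    fix c d assume "e = {c, d}" "c \<in> N - {b}" "d \<in> neighbours E b" "c \<noteq> d"
    then show ?thesis unfolding pointed_upset_def using e
      by (intro disjI2 bexI[of _ c] bexI[of _ "{b, d}"]) (auto simp: neighbours_def)
  qed
qed

lemma reg_le_matching_split:
  assumes E: "\<forall>e\<in>E. card e = 2"
    and "reg_le K (matching_upset (del_vertices E {v})) (Suc r)"
    and "reg_le K (pointed_upset (del_vertices E {v}) (neighbours E v)) r"
  shows "reg_le K (matching_upset E) (Suc r)"
  using assms by (intro reg_le_split[OF upset_matching, where x = v])
    (auto simp: matching_upset_delete matching_upset_insert)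

lemma reg_le_pointed_split:
  assumes E: "\<forall>e\<in>E. card e = 2" and "b \<in> N"
    and "reg_le K (pointed_upset (del_vertices E {b}) (N - {b})) (Suc r)"
    and "reg_le K (edge_upset (colon_edges E N b)) r"
  shows "reg_le K (pointed_upset E N) (Suc r)"
  using assms by (intro reg_le_split[OF upset_pointed, where x = b])
    (auto simp: pointed_upset_delete pointed_upset_insert)

section \<open>Whiskered paths\<close>

instance whisker_vertex :: countable by countable_datatype

text \<open>The start a is variable because removing the first path vertex shifts it. Removing an
  end vertex leaves its whisker end as an isolated vertex, which an edge set does not
  record.\<close>

definition whiskered_path :: "nat \<Rightarrow> nat \<Rightarrow> whisker_vertex set set" where
  "whiskered_path a n =
     {{X i, X (Suc i)} |i. a \<le> i \<and> Suc i < a + n} \<union> {{X i, Y i} |i. a \<le> i \<and> i < a + n}"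

lemma finite_whiskered_path: "finite (whiskered_path a n)"
proof -
  have "whiskered_path a n \<subseteq> (\<lambda>i. {X i, X (Suc i)}) ` {..<a + n} \<union> (\<lambda>i. {X i, Y i}) ` {..<a + n}"
    by (auto simp: whiskered_path_def)
  then show ?thesis by (rule finite_subset) auto
qed

lemma card_whiskered_path: "\<forall>e\<in>whiskered_path a n. card e = 2"
  by (auto simp: whiskered_path_def)

lemma whiskered_path_cases:
  assumes "e \<in> whiskered_path a n"
  obtains i where "a \<le> i" "Suc i < a + n" "e = {X i, X (Suc i)}"
  | i where "a \<le> i" "i < a + n" "e = {X i, Y i}"
  using assms by (auto simp: whiskered_path_def)

lemma del_vertices_Un: "del_vertices (E \<union> F) A = del_vertices E A \<union> del_vertices F A"
  by (auto simp: del_vertices_def)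

lemma whiskered_path_delete_last:
  "del_vertices (whiskered_path a (Suc n)) {X (a + n)} = whiskered_path a n"
  unfolding del_vertices_def whiskered_path_def
  by (auto simp: doubleton_eq_iff less_Suc_eq)

lemma whiskered_path_delete_first:
  "del_vertices (whiskered_path a (Suc n)) {X a} = whiskered_path (Suc a) n"
  unfolding del_vertices_def whiskered_path_def
  by (auto simp: doubleton_eq_iff le_Suc_eq Suc_le_eq)

lemma whiskered_path_delete_isolated:
  "a + n \<le> c \<Longrightarrow> del_vertices (whiskered_path a n) {Y c} = whiskered_path a n"
  by (auto simp: del_vertices_def whiskered_path_def)

lemma neighbours_last:
  "neighbours (whiskered_path a (Suc n)) (X (a + n)) =
     (if n = 0 then {} else {X (a + n - 1)}) \<union> {Y (a + n)}"
  by (cases n) (auto simp: neighbours_def whiskered_path_def doubleton_eq_iff)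

lemma neighbours_first:
  "neighbours (whiskered_path a (Suc (Suc n))) (X a) = {X (Suc a), Y a}"
  by (auto simp: neighbours_def whiskered_path_def doubleton_eq_iff)

lemma matching_upset_whiskered_path_short:
  assumes "n \<le> 1"
  shows "matching_upset (whiskered_path a n) = (\<lambda>_. False)"
proof -
  have "e = {X a, Y a}" if "e \<in> whiskered_path a n" for e
    using that assms by (auto simp: whiskered_path_def)
  then show ?thesis
    unfolding matching_upset_def by (intro ext) (metis Int_absorb insert_not_empty)
qed

lemma reg_le_edge_whiskered_path:
  assumes "Suc ((n + 1) div 2) \<le> r"
  shows "reg_le K (edge_upset (whiskered_path a n)) r"
proof (rule reg_le_path_cover[where w = "\<lambda>i. X (a + i)", OF finite_whiskered_path card_whiskered_path _ _ assms])
  fix e assume "e \<in> whiskered_path a n"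
  then show "\<exists>i<n. X (a + i) \<in> e"
  proof (cases rule: whiskered_path_cases)
    case (1 i) then show ?thesis by (intro exI[of _ "i - a"]) auto
  next
    case (2 i) then show ?thesis by (intro exI[of _ "i - a"]) auto
  qed
qed (auto simp: whiskered_path_def)

text \<open>The colon ideal met when the vertex following \<open>X (a + j)\<close> is split off:
  that vertex had the neighbours \<open>X (a + j)\<close> and its own whisker end, now the isolated
  vertex \<open>Y c\<close>.\<close>

lemma reg_le_pointed_whiskered_path:
  assumes j: "reg_le K (matching_upset (whiskered_path a j)) (3 + j div 2)" and c: "a + Suc j \<le> c"
  shows "reg_le K (pointed_upset (whiskered_path a (Suc j)) {X (a + j), Y c}) (3 + j div 2)"
proof -
  let ?E = "whiskered_path a (Suc j)" and ?N = "{X (a + j), Y c}"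
  have "reg_le K (pointed_upset ?E ?N) (Suc (2 + j div 2))"
  proof (rule reg_le_pointed_split[OF card_whiskered_path, where b = "X (a + j)"])
    \<comment> \<open>Without \<open>X (a + j)\<close> only the isolated \<open>Y c\<close> is left
      in N. Removing it gives the matching ideal of the shorter path, and its colon is just the edge
      ideal of that path.\<close>
    have "reg_le K (pointed_upset (whiskered_path a j) {Y c}) (Suc (2 + j div 2))"
    proof (rule reg_le_pointed_split[OF card_whiskered_path, where b = "Y c"])
      show "reg_le K (pointed_upset (del_vertices (whiskered_path a j) {Y c}) ({Y c} - {Y c})) (Suc (2 + j div 2))"
        using j c by (simp add: whiskered_path_delete_isolated pointed_upset_empty numeral_3_eq_3)
      have "colon_edges (whiskered_path a j) {Y c} (Y c) = whiskered_path a j"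
        using c by (simp add: colon_edges_def whiskered_path_delete_isolated)
      then show "reg_le K (edge_upset (colon_edges (whiskered_path a j) {Y c} (Y c))) (2 + j div 2)"
        by (simp add: reg_le_edge_whiskered_path)
    qed simp
    moreover have "?N - {X (a + j)} = {Y c}" by auto
    ultimately show "reg_le K (pointed_upset (del_vertices ?E {X (a + j)}) (?N - {X (a + j)})) (Suc (2 + j div 2))"
      by (simp add: whiskered_path_delete_last)
    \<comment> \<open>The colon graph joins \<open>Y c\<close> to \<open>X (a + j - 1)\<close> and
      \<open>Y (a + j)\<close>. So \<open>Y c\<close> prolongs the path of X vertices to a covering
      path on j + 1 vertices, with bound 1 + (j + 2) div 2 = 2 + j div 2.\<close>
    let ?w = "\<lambda>i. if i < j then X (a + i) else Y c"
    have C: "colon_edges ?E ?N (X (a + j)) =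
        whiskered_path a j \<union> (\<lambda>d. {Y c, d}) ` ((if j = 0 then {} else {X (a + j - 1)}) \<union> {Y (a + j)})"
    proof -
      have "?N - {X (a + j)} = {Y c}" by auto
      moreover have "Y c \<notin> neighbours ?E (X (a + j))" unfolding neighbours_last using c by auto
      ultimately have "{{e, d} |e d. e \<in> ?N - {X (a + j)} \<and> d \<in> neighbours ?E (X (a + j)) \<and> e \<noteq> d} =
          (\<lambda>d. {Y c, d}) ` neighbours ?E (X (a + j))" by blast
      then show ?thesis
        unfolding colon_edges_def whiskered_path_delete_last neighbours_last by simp
    qed
    have fin: "finite (colon_edges ?E ?N (X (a + j)))"
      unfolding C by (auto simp: finite_whiskered_path)
    show "reg_le K (edge_upset (colon_edges ?E ?N (X (a + j)))) (2 + j div 2)"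
    proof (rule reg_le_path_cover[where w = ?w and n = "Suc j", OF fin])
      show "\<forall>e\<in>colon_edges ?E ?N (X (a + j)). card e = 2"
        unfolding C using c card_whiskered_path[of a j] by (auto split: if_splits)
      fix e assume "e \<in> colon_edges ?E ?N (X (a + j))"
      then consider "e \<in> whiskered_path a j" | "Y c \<in> e" unfolding C by blast
      then show "\<exists>i<Suc j. ?w i \<in> e"
      proof cases
        case 1
        then show ?thesis
        proof (cases rule: whiskered_path_cases)
          case (1 i) then show ?thesis by (intro exI[of _ "i - a"]) auto
        next
          case (2 i) then show ?thesis by (intro exI[of _ "i - a"]) auto
        qed
      qed auto
    next
      fix i assume i: "Suc i < Suc j"
      show "{?w i, ?w (Suc i)} \<in> colon_edges ?E ?N (X (a + j))"
      proof (cases "Suc i < j")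
        case True
        then have "{X (a + i), X (a + Suc i)} \<in> whiskered_path a j"
          unfolding whiskered_path_def by auto
        then show ?thesis unfolding C using True by simp
      next
        case False
        with i have "j = Suc i" by simp
        then show ?thesis unfolding C by (auto simp: insert_commute)
      qed
    qed simp
  qed simp
  then show ?thesis by (simp add: numeral_3_eq_3)
qed

text \<open>Splitting off the last path vertex: deletion shortens the path by one, and the colon
  ideal reduces to the path shorter by two. This is why the bound grows by one for every two
  vertices.\<close>

lemma reg_le_matching_whiskered_path:
  "reg_le K (matching_upset (whiskered_path a n)) (3 + n div 2)"
proof (induction n rule: less_induct)
  case (less n)
  show ?case
  proof (cases "n \<le> 1")
    case True
    then show ?thesis by (simp add: matching_upset_whiskered_path_short reg_le_False)
  next
    case False
    then obtain j where n: "n = Suc (Suc j)" by (metis One_nat_def Suc_le_mono le0 not_less_eq_eq old.nat.exhaust)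
    have "reg_le K (matching_upset (whiskered_path a (Suc (Suc j)))) (Suc (3 + j div 2))"
    proof (rule reg_le_matching_split[OF card_whiskered_path, where v = "X (a + Suc j)"])
      have "reg_le K (matching_upset (whiskered_path a (Suc j))) (3 + Suc j div 2)"
        using less n by simp
      then have "reg_le K (matching_upset (whiskered_path a (Suc j))) (Suc (3 + j div 2))"
        by (rule reg_le_mono) presburger
      then show "reg_le K (matching_upset (del_vertices (whiskered_path a (Suc (Suc j))) {X (a + Suc j)})) (Suc (3 + j div 2))"
        by (simp only: whiskered_path_delete_last)
      have N: "neighbours (whiskered_path a (Suc (Suc j))) (X (a + Suc j)) = {X (a + j), Y (a + Suc j)}"
        by (simp only: neighbours_last) auto
      show "reg_le K (pointed_upset (del_vertices (whiskered_path a (Suc (Suc j))) {X (a + Suc j)})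
          (neighbours (whiskered_path a (Suc (Suc j))) (X (a + Suc j)))) (3 + j div 2)"
        unfolding whiskered_path_delete_last N
        using less n by (intro reg_le_pointed_whiskered_path) auto
    qed
    then show ?thesis using n by simp
  qed
qed

section \<open>The whiskered cycle\<close>

definition whiskered_cycle_edges :: "nat \<Rightarrow> whisker_vertex set set" where
  "whiskered_cycle_edges m = whiskered_path 1 m \<union> {{X 1, X m}}"

text \<open>Removing \<open>X m\<close> opens the cycle to a path. In the colon ideal N has the
  additional element \<open>X 1\<close>; once it is split off, the remaining ideal is of the kind
  already bounded for paths.\<close>

lemma reg_le_matching_whiskered_cycle:
  assumes "m \<ge> 3"
  shows "reg_le K (matching_upset (whiskered_cycle_edges m)) (3 + (m - 1) div 2)"
proof -
  obtain i where m: "m = Suc (Suc (Suc i))" using assms by (metis numeral_3_eq_3 Suc_le_D Suc_le_mono)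
  define j where "j = Suc i"
  have mj: "m = Suc (Suc j)" using m j_def by simp
  let ?C = "whiskered_cycle_edges m" and ?r = "2 + Suc j div 2"
  have E: "\<forall>e\<in>?C. card e = 2"
    using card_whiskered_path[of 1 m] assms by (auto simp: whiskered_cycle_edges_def)
  have D: "del_vertices ?C {X m} = whiskered_path 1 (Suc j)"
  proof -
    have "del_vertices ?C {X m} = del_vertices (whiskered_path 1 (Suc (Suc j))) {X (1 + Suc j)}"
      by (auto simp: whiskered_cycle_edges_def del_vertices_def mj)
    then show ?thesis by (simp only: whiskered_path_delete_last)
  qed
  have N: "neighbours ?C (X m) = {X 1, X (Suc j), Y m}"
  proof -
    have "neighbours ?C (X m) = insert (X 1) (neighbours (whiskered_path 1 (Suc (Suc j))) (X (1 + Suc j)))"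
      by (auto simp: whiskered_cycle_edges_def neighbours_def mj doubleton_eq_iff)
    then show ?thesis by (simp only: neighbours_last) (auto simp: mj)
  qed
  let ?P = "whiskered_path 1 (Suc j)" and ?N = "{X 1, X (Suc j), Y m}"
  have "reg_le K (pointed_upset ?P ?N) (Suc (1 + Suc j div 2))"
  proof (rule reg_le_pointed_split[OF card_whiskered_path, where b = "X 1"])
    have "?N - {X 1} = {X (2 + i), Y m}" by (auto simp: j_def)
    moreover have "reg_le K (pointed_upset (whiskered_path 2 (Suc i)) {X (2 + i), Y m}) (3 + i div 2)"
      by (rule reg_le_pointed_whiskered_path[OF reg_le_matching_whiskered_path]) (simp add: m)
    moreover have "del_vertices ?P {X 1} = whiskered_path 2 (Suc i)"
      using whiskered_path_delete_first[of 1 j] by (simp add: j_def numeral_2_eq_2)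
    moreover have "3 + i div 2 = Suc (1 + Suc j div 2)" by (simp add: j_def)
    ultimately show "reg_le K (pointed_upset (del_vertices ?P {X 1}) (?N - {X 1})) (Suc (1 + Suc j div 2))"
      by simp
    \<comment> \<open>The new edges join the remaining elements \<open>X (i + 2)\<close> and
      \<open>Y m\<close> of N to the neighbours \<open>X 2\<close> and \<open>Y 1\<close> of
      \<open>X 1\<close>, closing the graph up to a cycle again.\<close>
    let ?F = "colon_edges ?P ?N (X 1)"
    have F: "?F = whiskered_path 2 (Suc i) \<union>
        {{c, d} |c d. c \<in> {X (i + 2), Y m} \<and> d \<in> {X 2, Y 1} \<and> c \<noteq> d}"
      using whiskered_path_delete_first[of 1 j] neighbours_first[of 1 i]
      by (auto simp: colon_edges_def j_def numeral_2_eq_2)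
    have finF: "finite ?F"
    proof -
      have "{{c, d} |c d. c \<in> {X (i + 2), Y m} \<and> d \<in> {X 2, Y 1} \<and> c \<noteq> d}
        \<subseteq> (\<lambda>(c, d). {c, d}) ` ({X (i + 2), Y m} \<times> {X 2, Y 1})" by auto
      then show ?thesis unfolding F by (auto simp: finite_whiskered_path intro: finite_subset)
    qed
    have cardF: "\<forall>e\<in>?F. card e = 2"
    proof
      fix e assume "e \<in> ?F"
      then consider "e \<in> whiskered_path 2 (Suc i)" | c d where "e = {c, d}" "c \<noteq> d"
        unfolding F by blast
      then show "card e = 2" using card_whiskered_path by cases auto
    qed
    \<comment> \<open>A covering path such as \<open>X 2\<close>, ..., \<open>X (i + 2)\<close>,
      \<open>Y 1\<close> has i + 2 vertices, one too many for odd i. Splitting at \<open>X 2\<close>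
      removes one vertex from it.\<close>
    have "reg_le K (edge_upset ?F) (Suc (Suc (i div 2)))"
    proof (rule reg_le_edge_split[OF cardF finite_neighbours[OF finF], where v = "X 2"])
      let ?w = "\<lambda>l. if l < i then X (3 + l) else Y 1"
      have D2: "del_vertices ?F {X 2} = whiskered_path 3 i \<union>
        ({{c, Y 1} |c. c \<in> {X (i + 2), Y m} \<and> c \<noteq> X 2})"
      proof -
        let ?B = "{{c, d} |c d. c \<in> {X (i + 2), Y m} \<and> d \<in> {X 2, Y 1} \<and> c \<noteq> d}"
        have "del_vertices ?B {X 2} = {{c, Y 1} |c. c \<in> {X (i + 2), Y m} \<and> c \<noteq> X 2}"
        proof (intro Set.set_eqI iffI)
          fix e assume "e \<in> del_vertices ?B {X 2}"
          then have e: "e \<in> ?B" "X 2 \<notin> e" unfolding del_vertices_def by (rule CollectE, simp)+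
          from e(1) obtain c d where "e = {c, d}" "c \<in> {X (i + 2), Y m}" "d \<in> {X 2, Y 1}"
            by blast
          with e(2) have "e = {c, Y 1}" "c \<in> {X (i + 2), Y m}" "c \<noteq> X 2" by auto
          then show "e \<in> {{c, Y 1} |c. c \<in> {X (i + 2), Y m} \<and> c \<noteq> X 2}" by blast
        next
          fix e assume "e \<in> {{c, Y 1} |c. c \<in> {X (i + 2), Y m} \<and> c \<noteq> X 2}"
          then obtain c where c: "e = {c, Y 1}" "c \<in> {X (i + 2), Y m}" "c \<noteq> X 2" by blast
          have "c \<noteq> Y 1" using c(2) m by auto
          then have "e \<in> ?B"
            by (intro CollectI exI[of _ c] exI[of _ "Y 1"]) (use c in simp)
          moreover have "X 2 \<notin> e" using c by auto
          ultimately show "e \<in> del_vertices ?B {X 2}" by (simp add: del_vertices_def)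
        qed
        then have "del_vertices ?F {X 2} = del_vertices (whiskered_path 2 (Suc i)) {X 2} \<union>
            {{c, Y 1} |c. c \<in> {X (i + 2), Y m} \<and> c \<noteq> X 2}"
          unfolding F del_vertices_Un by (rule arg_cong)
        then show ?thesis
          using whiskered_path_delete_first[of 2 i] by (simp add: numeral_3_eq_3 numeral_2_eq_2)
      qed
      show "reg_le K (edge_upset (del_vertices ?F {X 2})) (Suc (Suc (i div 2)))"
      proof (rule reg_le_path_cover[where w = ?w and n = "Suc i"])
        show "finite (del_vertices ?F {X 2})" "\<forall>e\<in>del_vertices ?F {X 2}. card e = 2"
          using finF cardF by (auto simp: del_vertices_def)
        fix e assume "e \<in> del_vertices ?F {X 2}"
        then consider "e \<in> whiskered_path 3 i" | "Y 1 \<in> e" unfolding D2 by blast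
        then show "\<exists>l<Suc i. ?w l \<in> e"
        proof cases
          case 1
          then show ?thesis
          proof (cases rule: whiskered_path_cases)
            case (1 l) then show ?thesis by (intro exI[of _ "l - 3"]) auto
          next
            case (2 l) then show ?thesis by (intro exI[of _ "l - 3"]) auto
          qed
        qed auto
      next
        fix l assume l: "Suc l < Suc i"
        show "{?w l, ?w (Suc l)} \<in> del_vertices ?F {X 2}"
        proof (cases "Suc l < i")
          case True
          then show ?thesis unfolding D2 by (auto simp: whiskered_path_def)
        next
          case False
          with l have "i = Suc l" by simp
          then show ?thesis unfolding D2 by (auto simp: numeral_3_eq_3 numeral_2_eq_2)
        qed
      qed simp
      \<comment> \<open>The closed neighbourhood contains both ends \<open>X (i + 2)\<close> and
        \<open>Y m\<close> of the closing edges, and also \<open>X 3\<close> if i > 0. So all new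
        edges disappear and only a piece of the path is left.\<close>
      let ?A = "insert (X 2) (neighbours ?F (X 2))"
      have A: "X 2 \<in> ?A" "Y m \<in> ?A" "X (i + 2) \<in> ?A" "0 < i \<Longrightarrow> X 3 \<in> ?A"
      proof -
        have "{X 2, Y m} \<in> ?F"
          unfolding F by (intro UnI2 CollectI exI[of _ "Y m"] exI[of _ "X 2"]) auto
        then show "Y m \<in> ?A" by (simp add: neighbours_def)
        have "{X 2, X (i + 2)} \<in> ?F" if "i \<noteq> 0"
          unfolding F using that
          by (intro UnI2 CollectI exI[of _ "X (i + 2)"] exI[of _ "X 2"]) auto
        then show "X (i + 2) \<in> ?A" by (cases "i = 0") (simp_all add: neighbours_def)
        have "{X 2, X 3} \<in> ?F" if "0 < i"
          unfolding F unfolding whiskered_path_def using that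
          by (intro UnI1 CollectI exI[of _ 2]) auto
        then show "0 < i \<Longrightarrow> X 3 \<in> ?A" by (simp add: neighbours_def)
      qed simp
      have notA: "X l \<notin> ?A" if "4 \<le> l" "l < i + 2" for l
        unfolding neighbours_def F unfolding whiskered_path_def
        using that m by (auto simp: doubleton_eq_iff)
      show "reg_le K (edge_upset (del_vertices ?F ?A)) (Suc (i div 2))"
      \<comment> \<open>The surviving cover is \<open>X 4\<close>, ..., \<open>X (i + 1)\<close>;
        for i < 2 the truncated i - 2 correctly says that no edge is left.\<close>
      proof (rule reg_le_path_cover[where w = "\<lambda>l. X (4 + l)" and n = "i - 2"])
        show "finite (del_vertices ?F ?A)" "\<forall>e\<in>del_vertices ?F ?A. card e = 2"
          using finF cardF by (auto simp: del_vertices_def)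
        show "\<exists>l<i - 2. X (4 + l) \<in> e" if "e \<in> del_vertices ?F ?A" for e
        proof -
          from that have e: "e \<in> ?F" "e \<inter> ?A = {}" by (auto simp: del_vertices_def)
          have "e \<in> whiskered_path 2 (Suc i)" using e(1) A e(2) unfolding F by blast
          then show ?thesis
          proof (cases rule: whiskered_path_cases)
            case (1 l)
            then have "l \<noteq> 2" "l \<noteq> 3" "Suc l \<noteq> i + 2" using e(2) A by auto
            then show ?thesis using 1 by (intro exI[of _ "l - 4"]) auto
          next
            case (2 l)
            then have "l \<noteq> 2" "l \<noteq> 3 \<or> i = 0" "l \<noteq> i + 2" using e(2) A by auto
            then show ?thesis using 2 by (intro exI[of _ "l - 4"]) auto
          qed
        qed
        show "{X (4 + l), X (4 + Suc l)} \<in> del_vertices ?F ?A" if "Suc l < i - 2" for l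
        proof -
          have "{X (4 + l), X (4 + Suc l)} \<in> ?F" unfolding F unfolding whiskered_path_def using that by auto
          then show ?thesis using notA[of "4 + l"] notA[of "4 + Suc l"] that
            unfolding del_vertices_def by auto
        qed
        show "Suc ((i - 2 + 1) div 2) \<le> Suc (i div 2)" by presburger
      qed
    qed
    moreover have "Suc (Suc (i div 2)) = 1 + Suc j div 2" by (simp add: j_def)
    ultimately show "reg_le K (edge_upset ?F) (1 + Suc j div 2)" by simp
  qed simp
  then have "reg_le K (matching_upset ?C) (Suc ?r)"
    using reg_le_matching_whiskered_path[of K 1 "Suc j"] N
    by (intro reg_le_matching_split[OF E, where v = "X m"]) (simp_all add: D numeral_3_eq_3)
  then show ?thesis by (simp add: mj numeral_3_eq_3)
qed

section \<open>Lower bound\<close>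

text \<open>The boundary of \<open>t\<close> is a cycle of the ideal of \<open>U\<close> and stays nontrivial in the larger ideal of
  \<open>V\<close>. The upset \<open>W\<close> only serves to make the suspension of \<open>t\<close> by a new edge again such a chain.\<close>

definition obstruction ::
    "('v::countable set \<Rightarrow> bool) \<Rightarrow> ('v set \<Rightarrow> bool) \<Rightarrow> ('v set \<Rightarrow> bool) \<Rightarrow> nat \<Rightarrow> 'v set \<Rightarrow>
     ('v set \<Rightarrow> 'a::ab_group_add) \<Rightarrow> bool" where
  "obstruction U V W p S t \<longleftrightarrow>
     t \<in> chains S (upset_family W) (Suc p) \<and> bd S t \<in> chains S (upset_family U) p \<and>
     (\<forall>w\<in>chains S (upset_family V) (Suc p). bd S w \<noteq> bd S t)"

lemma chains_upset_iff:
  "f \<in> chains S (upset_family U) p \<longleftrightarrow> (\<forall>\<sigma>. f \<sigma> \<noteq> 0 \<longrightarrow> \<sigma> \<subseteq> S \<and> card \<sigma> = p \<and> U (S - \<sigma>))"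
  by (auto simp: chains_def upset_family_def)

text \<open>A filling inside U would also be a filling inside V.\<close>

lemma obstruction_not_exact:
  fixes t :: "'v::countable set \<Rightarrow> 'a::ab_group_add"
  assumes "finite S" "obstruction U V W p S t" "\<And>T. T \<subseteq> S \<Longrightarrow> U T \<Longrightarrow> V T"
  shows "\<not> exact_at (upset_family U :: 'v set \<Rightarrow> 'a set) p S"
proof
  assume "exact_at (upset_family U :: 'v set \<Rightarrow> 'a set) p S"
  then obtain g where g: "g \<in> chains S (upset_family U) (Suc p)" "bd S g = bd S t"
    using assms(2) bd_bd[OF assms(1), of t] unfolding exact_at_def obstruction_def by blast
  then have "g \<in> chains S (upset_family V) (Suc p)"
    using assms(3) by (auto simp: chains_upset_iff)
  then show False using g assms(2) by (auto simp: obstruction_def)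
qed

text \<open>The boundary of the cone consists of t and, up to sign, of y joined to the boundary of
  t. Faces of the first kind leave x and y in the complement, so W and the new edge together give U;
  those of the second kind only gain x there. Nontriviality is pulled back by projecting chains of
  V' to chains of V.\<close>

lemma obstruction_step:
  fixes t :: "'v::countable set \<Rightarrow> 'a::ab_group_add"
  assumes fin: "finite S" and xy: "x \<notin> S" "y \<notin> S" "x \<noteq> y"
    and ob: "obstruction U V W p S t"
    and U: "upset U" and W: "upset W"
    and UW: "\<And>T. T \<subseteq> S \<Longrightarrow> W T \<Longrightarrow> U (insert x (insert y T))"
    and V: "\<And>T. T \<subseteq> S \<Longrightarrow> V' (insert x T) \<Longrightarrow> V T" "\<And>T. T \<subseteq> S \<Longrightarrow> V' (insert y T) \<Longrightarrow> V T"
  shows "obstruction U V' W (Suc p) (insert y (insert x S)) (cone y t)"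
proof -
  define S1 where "S1 = insert x S"
  have S1: "finite S1" "y \<notin> S1" "S \<subseteq> S1" using fin xy by (auto simp: S1_def)
  have t: "\<sigma> \<subseteq> S" "card \<sigma> = Suc p" "W (S - \<sigma>)" if "t \<sigma> \<noteq> 0" for \<sigma>
    using that ob by (auto simp: obstruction_def chains_upset_iff)
  have bt: "\<sigma> \<subseteq> S" "card \<sigma> = p" "U (S - \<sigma>)" if "bd S t \<sigma> \<noteq> 0" for \<sigma>
    using that ob by (auto simp: obstruction_def chains_upset_iff)
  have bS1t: "bd S1 t \<sigma> = bd S t \<sigma>" if "\<sigma> \<subseteq> S" for \<sigma>
    using bd_insert[OF xy(1) fin that, of t] t(1)[of "insert x \<sigma>"] xy(1) by (auto simp: S1_def)
  have bS1t': "bd S1 t (insert x \<sigma>) = 0" if "\<sigma> \<subseteq> S" for \<sigma>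
  proof -
    have "(\<lambda>\<rho>. sg x \<rho> (t (insert x \<rho>))) = (\<lambda>_. 0)"
      using t(1) xy(1) by (auto simp: fun_eq_iff)
    then show ?thesis using bd_insert'[OF xy(1) fin that, of t] by (simp add: S1_def)
  qed
  have finS: "finite \<sigma>" if "\<sigma> \<subseteq> S1" for \<sigma> using that S1(1) finite_subset by blast
  show ?thesis
    unfolding obstruction_def S1_def[symmetric]
  proof (intro conjI ballI notI)
    show "cone y t \<in> chains (insert y S1) (upset_family W) (Suc (Suc p))"
      unfolding chains_upset_iff
    proof (intro allI impI)
      fix \<sigma> assume "cone y t \<sigma> \<noteq> 0"
      then have y: "y \<in> \<sigma>" "t (\<sigma> - {y}) \<noteq> 0" by (auto simp: cone_def split: if_splits)
      note * = t[OF y(2)]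
      have "insert y S1 - \<sigma> = insert x (S - (\<sigma> - {y}))" using y(1) *(1) xy S1 by (auto simp: S1_def)
      then have "W (insert y S1 - \<sigma>)" using *(3) W by (auto dest: upsetD)
      moreover have "card \<sigma> = Suc (Suc p)"
        using *(2) y(1) finS[of "\<sigma> - {y}"] *(1) S1(3) card.remove[of \<sigma> y] by auto
      moreover have "\<sigma> \<subseteq> insert y S1" using *(1) S1(3) by auto
      ultimately show "\<sigma> \<subseteq> insert y S1 \<and> card \<sigma> = Suc (Suc p) \<and> W (insert y S1 - \<sigma>)" by simp
    qed
    show "bd (insert y S1) (cone y t) \<in> chains (insert y S1) (upset_family U) (Suc p)"
      unfolding chains_upset_iff
    proof (intro allI impI)
      fix \<sigma> assume nz: "bd (insert y S1) (cone y t) \<sigma> \<noteq> 0"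
      then have sub: "\<sigma> \<subseteq> insert y S1" by (metis bd_outside)
      show "\<sigma> \<subseteq> insert y S1 \<and> card \<sigma> = Suc p \<and> U (insert y S1 - \<sigma>)"
      proof (cases "y \<in> \<sigma>")
        case False
        then have "\<sigma> \<subseteq> S1" using sub by auto
        then have "t \<sigma> \<noteq> 0" using nz bd_cone_notin[OF S1(2,1), of \<sigma> t] by simp
        note * = t[OF this]
        have "insert y S1 - \<sigma> = insert x (insert y (S - \<sigma>))" using *(1) xy by (auto simp: S1_def)
        then show ?thesis using * UW[of "S - \<sigma>"] sub by auto
      next
        case True
        define \<tau> where "\<tau> = \<sigma> - {y}"
        have \<tau>: "\<tau> \<subseteq> S1" "\<sigma> = insert y \<tau>" "y \<notin> \<tau>" using True sub by (auto simp: \<tau>_def)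
        have nz1: "bd S1 t \<tau> \<noteq> 0"
          using nz bd_cone_in[OF S1(2,1) \<tau>(1), of t] \<tau>(2) by auto
        have "x \<notin> \<tau>"
        proof
          assume "x \<in> \<tau>"
          then have "\<tau> = insert x (\<tau> - {x})" "\<tau> - {x} \<subseteq> S" using \<tau>(1) by (auto simp: S1_def)
          then show False using bS1t'[of "\<tau> - {x}"] nz1 by simp
        qed
        then have \<tau>S: "\<tau> \<subseteq> S" using \<tau>(1) by (auto simp: S1_def)
        note * = bt[of \<tau>, unfolded bS1t[OF \<tau>S, symmetric], OF nz1]
        have "insert y S1 - \<sigma> = insert x (S - \<tau>)" using \<tau> xy \<tau>S by (auto simp: S1_def)
        then have "U (insert y S1 - \<sigma>)" using *(3) U by (auto dest: upsetD)
        then show ?thesis using *(2) \<tau> finS[OF \<tau>(1)] sub by simp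
      qed
    qed
    fix w assume w: "w \<in> chains (insert y S1) (upset_family V') (Suc (Suc p))"
      and eq: "bd (insert y S1) w = bd (insert y S1) (cone y t)"
    have wD: "\<sigma> \<subseteq> insert y S1" "card \<sigma> = Suc (Suc p)" "V' (insert y S1 - \<sigma>)" if "w \<sigma> \<noteq> 0" for \<sigma>
      using w that by (auto simp: chains_upset_iff)
    define w1 where "w1 \<sigma> = sg y \<sigma> (w (insert y \<sigma>))" for \<sigma>
    define q0 where "q0 \<sigma> = sg x \<sigma> (w (insert x \<sigma>))" for \<sigma>
    have e1: "w1 \<sigma> + bd S1 w \<sigma> = t \<sigma>" if "\<sigma> \<subseteq> S1" for \<sigma>
      using bd_insert[OF S1(2,1) that, of w] bd_cone_notin[OF S1(2,1) that, of t] eq by (simp add: w1_def)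
    have e2: "bd S1 w1 \<sigma> = bd S1 t \<sigma>" if "\<sigma> \<subseteq> S1" for \<sigma>
    proof -
      have "sg y \<sigma> (bd S1 w1 \<sigma>) = sg y \<sigma> (bd S1 t \<sigma>)"
        using bd_insert'[OF S1(2,1) that, of w] bd_cone_in[OF S1(2,1) that, of t] eq
        by (simp add: w1_def[abs_def])
      then have "sg y \<sigma> (sg y \<sigma> (bd S1 w1 \<sigma>)) = sg y \<sigma> (sg y \<sigma> (bd S1 t \<sigma>))" by simp
      then show ?thesis by simp
    qed
    have e3: "sg x \<sigma> (w1 (insert x \<sigma>)) = bd S q0 \<sigma>" if "\<sigma> \<subseteq> S" for \<sigma>
    proof -
      have "insert x \<sigma> \<subseteq> S1" using that by (auto simp: S1_def)
      from e1[OF this] have "w1 (insert x \<sigma>) + bd S1 w (insert x \<sigma>) = 0"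
        using t(1)[of "insert x \<sigma>"] xy(1) by auto
      then have "w1 (insert x \<sigma>) = sg x \<sigma> (bd S q0 \<sigma>)"
        using bd_insert'[OF xy(1) fin that, of w] by (simp add: S1_def q0_def[abs_def])
      then show ?thesis by simp
    qed
    \<comment> \<open>The projection: the sum of the link parts of w at x and at y. Each leaves only
      one end of the new edge in the complement, where V' reduces to V. By \<open>e3\<close> the
      boundary of q0 is the link part of w1 at x, exactly the term by which the boundaries of w1
      over S and over S1 differ.\<close>
    define g where "g \<sigma> = (if \<sigma> \<subseteq> S then q0 \<sigma> + w1 \<sigma> else 0)" for \<sigma>
    have "bd S g = bd S t"
    proof
      fix \<sigma>
      show "bd S g \<sigma> = bd S t \<sigma>"
      proof (cases "\<sigma> \<subseteq> S")
        case True
        have "bd S g \<sigma> = bd S (\<lambda>\<rho>. q0 \<rho> + w1 \<rho>) \<sigma>"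
          using True by (intro bd_cong) (auto simp: g_def)
        also have "\<dots> = bd S q0 \<sigma> + bd S w1 \<sigma>" by (rule bd_add)
        also have "\<dots> = bd S1 w1 \<sigma>"
          using bd_insert[OF xy(1) fin True, of w1] e3[OF True] by (simp add: S1_def)
        also have "\<dots> = bd S t \<sigma>"
          using e2[of \<sigma>] bS1t[OF True] True S1(3) by auto
        finally show ?thesis .
      qed (simp add: bd_outside)
    qed
    moreover have "g \<in> chains S (upset_family V) (Suc p)"
      unfolding chains_upset_iff
    proof (intro allI impI)
      fix \<sigma> assume nz: "g \<sigma> \<noteq> 0"
      then have sub: "\<sigma> \<subseteq> S" and "q0 \<sigma> \<noteq> 0 \<or> w1 \<sigma> \<noteq> 0" by (auto simp: g_def split: if_splits)
      then have *: "w (insert x \<sigma>) \<noteq> 0 \<or> w (insert y \<sigma>) \<noteq> 0" by (auto simp: q0_def w1_def)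
      have f: "finite \<sigma>" "x \<notin> \<sigma>" "y \<notin> \<sigma>" using sub fin xy finite_subset by auto
      have D: "insert y S1 - insert x \<sigma> = insert y (S - \<sigma>)" "insert y S1 - insert y \<sigma> = insert x (S - \<sigma>)"
        using sub xy f by (auto simp: S1_def)
      from * show "\<sigma> \<subseteq> S \<and> card \<sigma> = Suc p \<and> V (S - \<sigma>)"
        using wD(2,3)[of "insert x \<sigma>"] wD(2,3)[of "insert y \<sigma>"] f sub V[of "S - \<sigma>"] by (auto simp: D)
    qed
    ultimately show False using ob by (auto simp: obstruction_def)
  qed
qed

text \<open>The indices 4, 6, ... leave gaps, so that the chosen whiskers are joined neither to each
  other nor to the path on the first four vertices.\<close>

definition witness_set :: "nat \<Rightarrow> whisker_vertex set" where
  "witness_set s = {X 1, Y 1, X 2, Y 2} \<union> (\<Union>j<s. {X (2 * j + 4), Y (2 * j + 4)})"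

definition witness_upset :: "nat \<Rightarrow> whisker_vertex set \<Rightarrow> bool" where
  "witness_upset s T \<longleftrightarrow> {X 1, Y 1, X 2, Y 2} \<subseteq> T \<or> (\<exists>j<s. {X (2 * j + 4), Y (2 * j + 4)} \<subseteq> T)"

lemma finite_witness_set: "finite (witness_set s)"
  by (simp add: witness_set_def)

lemma witness_set_Suc:
  "witness_set (Suc s) = insert (Y (2 * s + 4)) (insert (X (2 * s + 4)) (witness_set s))"
  by (auto simp: witness_set_def lessThan_Suc)

lemma witness_set_notin: "X (2 * s + 4) \<notin> witness_set s" "Y (2 * s + 4) \<notin> witness_set s"
  by (auto simp: witness_set_def)

lemma card_witness_set: "card (witness_set s) = 4 + 2 * s"
proof (induction s)
  case 0
  then show ?case by (simp add: witness_set_def)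
next
  case (Suc s)
  then show ?case using witness_set_notin[of s] by (simp add: witness_set_Suc finite_witness_set)
qed

lemma whisker_in_cycle: "1 \<le> i \<Longrightarrow> i \<le> m \<Longrightarrow> {X i, Y i} \<in> whiskered_cycle_edges m"
  by (auto simp: whiskered_cycle_edges_def whiskered_path_def)

text \<open>W is the edge ideal because an edge in the old vertices and the new whisker always form
  a matching.\<close>

lemma ex_obstruction:
  assumes "(u :: 'a::ab_group_add) \<noteq> 0" "2 * s + 3 \<le> m"
  shows "\<exists>t :: _ \<Rightarrow> 'a. obstruction (matching_upset (whiskered_cycle_edges m)) (witness_upset s)
    (edge_upset (whiskered_cycle_edges m)) s (witness_set s) t"
  using assms(2)
proof (induction s)
  case 0
  let ?S = "witness_set 0" and ?C = "whiskered_cycle_edges m"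
  \<comment> \<open>Its boundary is u on the empty face, the class of the generator of degree 4. The
    complement of \<open>X 1\<close> still contains the whisker at 2, and no face with one vertex
    belongs to the complex of the principal ideal.\<close>
  define t where "t \<sigma> = (if \<sigma> = {X 1} then u else 0)" for \<sigma> :: "whisker_vertex set"
  have S: "?S = {X 1, Y 1, X 2, Y 2}" by (simp add: witness_set_def)
  have e: "{X 1, Y 1} \<in> ?C" "{X 2, Y 2} \<in> ?C"
    using whisker_in_cycle[of _ m] 0 by auto
  have b0: "bd ?S t {} = u"
  proof -
    have "bd ?S t {} = (\<Sum>v\<in>?S. if v = X 1 then u else 0)"
      unfolding bd_def by (auto simp: t_def sg_def intro!: sum.cong)
    also have "\<dots> = u" using finite_witness_set[of 0] by (simp add: S)
    finally show ?thesis .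
  qed
  have bn: "bd ?S t \<sigma> = 0" if "\<sigma> \<noteq> {}" for \<sigma>
    unfolding bd_def t_def using that by (auto intro!: sum.neutral split: if_splits)
  have "obstruction (matching_upset ?C) (witness_upset 0) (edge_upset ?C) 0 ?S t"
    unfolding obstruction_def
  proof (intro conjI ballI)
    have "edge_upset ?C (?S - {X 1})"
      unfolding edge_upset_def S using e by (intro bexI[of _ "{X 2, Y 2}"]) auto
    then show "t \<in> chains ?S (upset_family (edge_upset ?C)) (Suc 0)"
      unfolding chains_upset_iff t_def by (auto simp: S)
    have "matching_upset ?C ?S"
      unfolding matching_upset_def S using e
      by (intro bexI[of _ "{X 1, Y 1}"] bexI[of _ "{X 2, Y 2}"]) auto
    then show "bd ?S t \<in> chains ?S (upset_family (matching_upset ?C)) 0"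
      unfolding chains_upset_iff using bn by (metis Diff_empty card.empty empty_subsetI)
    fix w :: "_ \<Rightarrow> 'a" assume w: "w \<in> chains ?S (upset_family (witness_upset 0)) (Suc 0)"
    have "w \<sigma> = 0" for \<sigma>
    proof (rule ccontr)
      assume "w \<sigma> \<noteq> 0"
      then have *: "\<sigma> \<subseteq> ?S" "card \<sigma> = 1" "?S \<subseteq> ?S - \<sigma>"
        using w by (auto simp: chains_upset_iff witness_upset_def S)
      then have "\<sigma> = {}" by blast
      then show False using *(2) by simp
    qed
    then have "bd ?S w {} = 0" by (simp add: bd_def)
    then show "bd ?S w \<noteq> bd ?S t" using b0 assms(1) by metis
  qed
  then show ?case by blast
next
  case (Suc s)
  let ?C = "whiskered_cycle_edges m" and ?x = "X (2 * s + 4)" and ?y = "Y (2 * s + 4)"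
  obtain t :: "_ \<Rightarrow> 'a" where t: "obstruction (matching_upset ?C) (witness_upset s) (edge_upset ?C) s (witness_set s) t"
    using Suc by auto
  have "obstruction (matching_upset ?C) (witness_upset (Suc s)) (edge_upset ?C) (Suc s) (witness_set (Suc s)) (cone ?y t)"
    unfolding witness_set_Suc
  proof (rule obstruction_step[OF finite_witness_set witness_set_notin _ t upset_matching upset_edge])
    fix T assume T: "T \<subseteq> witness_set s"
    show "matching_upset ?C (insert ?x (insert ?y T))" if E: "edge_upset ?C T"
    proof -
      obtain e where e: "e \<in> ?C" "e \<subseteq> T" using E by (auto simp: edge_upset_def)
      moreover have "e \<inter> {?x, ?y} = {}" using e(2) T witness_set_notin by blast
      moreover have "{?x, ?y} \<in> ?C" using Suc.prems by (intro whisker_in_cycle) auto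
      ultimately show ?thesis unfolding matching_upset_def by blast
    qed
    have "?x \<notin> T" "?y \<notin> T" using T witness_set_notin by auto
    then show "witness_upset (Suc s) (insert ?x T) \<Longrightarrow> witness_upset s T"
      "witness_upset (Suc s) (insert ?y T) \<Longrightarrow> witness_upset s T"
      by (auto simp: witness_upset_def less_Suc_eq)
  qed simp
  then show ?case by blast
qed

text \<open>Without a complete further whisker, T contains only edges of the path
  \<open>Y 1\<close>, \<open>X 1\<close>, \<open>X 2\<close>, \<open>Y 2\<close>, and the only
  disjoint pair among these is the pair of whiskers.\<close>

lemma matching_upset_witness:
  assumes m: "2 * s + 3 \<le> m" and T: "T \<subseteq> witness_set s"
    and M: "matching_upset (whiskered_cycle_edges m) T"
  shows "witness_upset s T"
proof (rule ccontr)
  assume nw: "\<not> witness_upset s T"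
  have XT: "i = 1 \<or> i = 2 \<or> (\<exists>j<s. i = 2 * j + 4)" if "X i \<in> T" for i
    using that T by (auto simp: witness_set_def)
  have edge: "e \<in> {{X 1, X 2}, {X 1, Y 1}, {X 2, Y 2}}"
    if e: "e \<in> whiskered_cycle_edges m" "e \<subseteq> T" for e
  proof -
    from e(1) consider "e = {X 1, X m}" | i where "e = {X i, X (Suc i)}" "1 \<le> i"
      | i where "e = {X i, Y i}"
      by (auto simp: whiskered_cycle_edges_def whiskered_path_def)
    then show ?thesis
    proof cases
      case 1
      then have "X m \<in> T" using e by auto
      from XT[OF this] show ?thesis using m by auto
    next
      case (2 i)
      then have "X i \<in> T" "X (Suc i) \<in> T" using e by auto
      \<comment> \<open>Apart from 1, all indices in use are even, so 1 and 2 are the only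
        consecutive ones.\<close>
      from XT[OF this(1)] XT[OF this(2)] have "i = 1" using 2(2) by presburger
      then show ?thesis using 2 by (simp add: numeral_2_eq_2)
    next
      case (3 i)
      then have "X i \<in> T" "Y i \<in> T" using e by auto
      moreover have "\<not> (\<exists>j<s. i = 2 * j + 4)"
        using nw calculation by (auto simp: witness_upset_def)
      ultimately show ?thesis using XT[of i] 3 by auto
    qed
  qed
  obtain e f where ef: "e \<in> whiskered_cycle_edges m" "f \<in> whiskered_cycle_edges m"
    "e \<inter> f = {}" "e \<subseteq> T" "f \<subseteq> T"
    using M unfolding matching_upset_def by auto
  have "e = {X 1, Y 1} \<and> f = {X 2, Y 2} \<or> e = {X 2, Y 2} \<and> f = {X 1, Y 1}"
    using edge[OF ef(1,4)] edge[OF ef(2,5)] ef(3) by (elim insertE emptyE) simp_all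
  then have "{X 1, Y 1, X 2, Y 2} \<subseteq> T"
    using ef(4,5) by auto
  then show False using nw by (simp add: witness_upset_def)
qed

lemma not_exact_matching_cycle:
  assumes "(u :: 'a::ab_group_add) \<noteq> 0" "2 * s + 3 \<le> m"
  shows "\<not> exact_at (upset_family (matching_upset (whiskered_cycle_edges m)) :: _ \<Rightarrow> 'a set) s (witness_set s)"
proof -
  obtain t :: "_ \<Rightarrow> 'a" where "obstruction (matching_upset (whiskered_cycle_edges m)) (witness_upset s)
    (edge_upset (whiskered_cycle_edges m)) s (witness_set s) t"
    using ex_obstruction[OF assms] by blast
  then show ?thesis
    by (rule obstruction_not_exact[OF finite_witness_set]) (rule matching_upset_witness[OF assms(2)])
qed

section \<open>Regularity of the second square-free power\<close>

lemma keys_monomial: "Poly_Mapping.keys (monomial t :: ('v, 'k::field) mpoly) = {t}"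
  by (simp add: monomial_def)

lemma monomial_mult: "monomial (s + t) = (monomial s * monomial t :: ('v, 'k::field) mpoly)"
  by (simp add: monomial_def mult_single)

lemma indicator_monomial_Un:
  assumes "finite A" "finite B" "A \<inter> B = {}"
  shows "indicator_monomial (A \<union> B) = indicator_monomial A + indicator_monomial B"
  unfolding indicator_monomial_def using assms by (rule sum.union_disjoint)

lemma monomial_indicator_edge:
  assumes "x \<noteq> y"
  shows "monomial (indicator_monomial {x, y}) = (indet x * indet y :: ('v, 'k::field) mpoly)"
proof -
  have "indicator_monomial {x, y} = Poly_Mapping.single x 1 + Poly_Mapping.single y 1"
    using assms by (simp add: indicator_monomial_def)
  then show ?thesis by (simp add: indet_def monomial_mult)
qed

lemma monomial_divides:
  assumes "finite A" "A \<subseteq> Poly_Mapping.keys t"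
  shows "Poly_Mapping.single t c = Poly_Mapping.single (t - indicator_monomial A) c * monomial (indicator_monomial A)"
  using monomial_minus_indicator[OF assms] by (simp add: monomial_def mult_single)

lemma edge_ideal_carrier:
  assumes "\<forall>e\<in>E. e \<subseteq> V"
  shows "{indet x * indet y |x y. {x, y} \<in> E} \<subseteq> carrier (poly_ring V :: ('v, 'k::field) mpoly ring)"
proof
  fix p :: "('v, 'k) mpoly" assume "p \<in> {indet x * indet y |x y. {x, y} \<in> E}"
  then obtain x y where p: "p = indet x * indet y" "{x, y} \<in> E" by blast
  have "indet z \<in> carrier (poly_ring V :: ('v, 'k) mpoly ring)" if "z \<in> V" for z
    using that by (simp add: indet_def carrier_poly_ring keys_monomial)
  then show "p \<in> carrier (poly_ring V)" using p assms by (auto intro!: carrier_mult)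
qed

lemma edge_ideal_subset:
  assumes E: "\<forall>e\<in>E. e \<subseteq> V"
  shows "(edge_ideal (V, E) :: ('v, 'k::field) mpoly set) \<subseteq> upset_ideal V (edge_upset E)"
  unfolding edge_ideal_def fst_conv snd_conv
proof (rule ring.genideal_minimal[OF _ ideal_upset_ideal[OF upset_edge]])
  show "ring (poly_ring V :: ('v, 'k) mpoly ring)" using cring_poly_ring cring.axioms(1) by blast
  show "{indet x * indet y |x y. {x, y} \<in> E} \<subseteq> (upset_ideal V (edge_upset E) :: ('v, 'k) mpoly set)"
  proof
    fix p :: "('v, 'k) mpoly" assume p: "p \<in> {indet x * indet y |x y. {x, y} \<in> E}"
    then obtain x y where xy: "p = indet x * indet y" "{x, y} \<in> E" by blast
    have "p = monomial (Poly_Mapping.single x 1 + Poly_Mapping.single y 1)"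
      unfolding xy(1) indet_def monomial_mult ..
    then have "Poly_Mapping.keys p = {Poly_Mapping.single x 1 + Poly_Mapping.single y 1}"
      by (simp add: keys_monomial)
    moreover have "edge_upset E (Poly_Mapping.keys (Poly_Mapping.single x (1::nat) + Poly_Mapping.single y 1))"
      unfolding keys_monomial_add edge_upset_def using xy(2) by (intro bexI[of _ "{x, y}"]) auto
    ultimately show "p \<in> upset_ideal V (edge_upset E)"
      using edge_ideal_carrier[OF E] p by (auto simp: upset_ideal_def)
  qed
qed

text \<open>A square-free monomial in the square of the edge ideal is divisible by two edges, which
  must be disjoint; conversely the product over two disjoint edges is itself a square-free
  generator.\<close>

lemma second_squarefree_power_edge_ideal:
  fixes E :: "'v set set"
  assumes E: "\<forall>e\<in>E. e \<subseteq> V \<and> card e = 2"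
  shows "(second_squarefree_power V (edge_ideal (V, E)) :: ('v, 'k::field) mpoly set) = upset_ideal V (matching_upset E)"
proof -
  let ?R = "poly_ring V :: ('v, 'k) mpoly ring"
  let ?I = "edge_ideal (V, E) :: ('v, 'k) mpoly set"
  let ?G = "{monomial t |t. squarefree_monomial t \<and> monomial t \<in> ideal_prod ?R ?I ?I} :: ('v, 'k) mpoly set"
  have EV: "\<forall>e\<in>E. e \<subseteq> V" using E by blast
  interpret cring ?R by (rule cring_poly_ring)
  have I: "ideal ?I ?R"
    unfolding edge_ideal_def fst_conv snd_conv by (rule genideal_ideal[OF edge_ideal_carrier[OF EV]])
  \<comment> \<open>What survives sums in the product ideal is a property of single monomials: each
    one factors into two monomials that are both divisible by an edge.\<close>
  have prod: "p \<in> carrier ?R \<and> (\<forall>t\<in>Poly_Mapping.keys p. \<exists>a b. t = a + b \<and>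
      edge_upset E (Poly_Mapping.keys a) \<and> edge_upset E (Poly_Mapping.keys b))"
    if "p \<in> ideal_prod ?R ?I ?I" for p
    using that
  proof (induction rule: ideal_prod.induct)
    case (prod i j)
    then have ij: "i \<in> upset_ideal V (edge_upset E)" "j \<in> upset_ideal V (edge_upset E)"
      using edge_ideal_subset[OF EV] by blast+
    have "\<exists>a b. t = a + b \<and> edge_upset E (Poly_Mapping.keys a) \<and> edge_upset E (Poly_Mapping.keys b)"
      if t: "t \<in> Poly_Mapping.keys (i * j)" for t
    proof -
      obtain a b where "t = a + b" "a \<in> Poly_Mapping.keys i" "b \<in> Poly_Mapping.keys j"
        using t keys_mult[of i j] by blast
      then show ?thesis using ij by (auto simp: upset_ideal_def)
    qed
    then show ?case using ij carrier_mult by (auto simp: upset_ideal_def)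
  next
    case (sum s1 s2)
    then show ?case using keys_add[of s1 s2] carrier_add[of s1 V s2] by auto
  qed
  have G: "?G \<subseteq> upset_ideal V (matching_upset E)"
  proof
    fix p assume "p \<in> ?G"
    then obtain t where t: "p = monomial t" "squarefree_monomial t" "monomial t \<in> ideal_prod ?R ?I ?I"
      by blast
    obtain a b where ab: "t = a + b" "edge_upset E (Poly_Mapping.keys a)" "edge_upset E (Poly_Mapping.keys b)"
      using prod[OF t(3)] by (auto simp: keys_monomial)
    have disj: "Poly_Mapping.keys a \<inter> Poly_Mapping.keys b = {}"
    proof (rule ccontr)
      assume "Poly_Mapping.keys a \<inter> Poly_Mapping.keys b \<noteq> {}"
      then obtain x where "Poly_Mapping.lookup a x \<noteq> 0" "Poly_Mapping.lookup b x \<noteq> 0"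
        by (auto simp: in_keys_iff)
      moreover have "Poly_Mapping.lookup t x = Poly_Mapping.lookup a x + Poly_Mapping.lookup b x"
        by (simp add: ab(1) lookup_add)
      moreover have "Poly_Mapping.lookup t x \<le> 1"
        using t(2) by (simp add: squarefree_monomial_def)
      ultimately show False by linarith
    qed
    obtain e f where ef: "e \<in> E" "f \<in> E" "e \<subseteq> Poly_Mapping.keys a" "f \<subseteq> Poly_Mapping.keys b"
      using ab(2,3) unfolding edge_upset_def by auto
    have "e \<inter> f = {}" using ef(3,4) disj by auto
    moreover have "e \<union> f \<subseteq> Poly_Mapping.keys t"
      unfolding ab(1) keys_monomial_add using ef(3,4) by auto
    ultimately have "matching_upset E (Poly_Mapping.keys t)"
      unfolding matching_upset_def by (intro bexI[of _ e] bexI[of _ f] conjI ef)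
    moreover have "p \<in> carrier ?R" using prod[OF t(3)] unfolding t(1) by (rule conjunct1)
    ultimately show "p \<in> upset_ideal V (matching_upset E)"
      by (simp add: upset_ideal_def t(1) keys_monomial)
  qed
  have "?G \<subseteq> carrier ?R" using prod by auto
  then have id: "ideal (Idl\<^bsub>?R\<^esub> ?G) ?R" by (rule genideal_ideal)
  have self: "?G \<subseteq> Idl\<^bsub>?R\<^esub> ?G" by (rule genideal_self[OF \<open>?G \<subseteq> carrier ?R\<close>])
  have edge: "monomial (indicator_monomial e) \<in> ?I" if "e \<in> E" for e
  proof -
    have "card e = 2" using E that by blast
    then obtain x y where xy: "e = {x, y}" "x \<noteq> y" unfolding card_2_iff by auto
    have "monomial (indicator_monomial e) \<in> {indet x * indet y |x y. {x, y} \<in> E}"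
      unfolding xy(1) monomial_indicator_edge[OF xy(2)] using that xy(1) by auto
    then show ?thesis
      unfolding edge_ideal_def fst_conv snd_conv using genideal_self[OF edge_ideal_carrier[OF EV]] by blast
  qed
  have "upset_ideal V (matching_upset E) \<subseteq> Idl\<^bsub>?R\<^esub> ?G"
  proof
    fix p :: "('v, 'k) mpoly" assume p: "p \<in> upset_ideal V (matching_upset E)"
    have single: "Poly_Mapping.single t (Poly_Mapping.lookup p t) \<in> Idl\<^bsub>?R\<^esub> ?G" if t: "t \<in> Poly_Mapping.keys p" for t
    proof -
      have tV: "Poly_Mapping.keys t \<subseteq> V" using p t by (auto simp: upset_ideal_def carrier_poly_ring)
      obtain e f where ef: "e \<in> E" "f \<in> E" "e \<inter> f = {}" "e \<union> f \<subseteq> Poly_Mapping.keys t"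
        using p t by (auto simp: upset_ideal_def matching_upset_def)
      have fin: "finite e" "finite f" using E ef(1,2) by (auto intro!: card_ge_0_finite)
      have "monomial (indicator_monomial (e \<union> f)) =
          monomial (indicator_monomial e) \<otimes>\<^bsub>?R\<^esub> monomial (indicator_monomial f)"
        using indicator_monomial_Un[OF fin ef(3)] by (simp add: monomial_mult)
      then have "monomial (indicator_monomial (e \<union> f)) \<in> ideal_prod ?R ?I ?I"
        using ideal_prod.prod[OF edge[OF ef(1)] edge[OF ef(2)], of ?R] by simp
      moreover have "squarefree_monomial (indicator_monomial (e \<union> f))"
        using fin by (simp add: squarefree_monomial_def lookup_indicator_monomial)
      ultimately have "monomial (indicator_monomial (e \<union> f)) \<in> Idl\<^bsub>?R\<^esub> ?G" using self by blast
      moreover have "Poly_Mapping.single (t - indicator_monomial (e \<union> f)) (Poly_Mapping.lookup p t) \<in> carrier ?R"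
      proof -
        have "Poly_Mapping.keys (t - indicator_monomial (e \<union> f)) \<subseteq> Poly_Mapping.keys t"
          by (auto simp: in_keys_iff lookup_minus)
        then show ?thesis using tV by (auto simp: carrier_poly_ring)
      qed
      ultimately have "Poly_Mapping.single (t - indicator_monomial (e \<union> f)) (Poly_Mapping.lookup p t) \<otimes>\<^bsub>?R\<^esub>
          monomial (indicator_monomial (e \<union> f)) \<in> Idl\<^bsub>?R\<^esub> ?G"
        by (rule ideal.I_l_closed[OF id])
      moreover have "Poly_Mapping.single t (Poly_Mapping.lookup p t) =
          Poly_Mapping.single (t - indicator_monomial (e \<union> f)) (Poly_Mapping.lookup p t) *
          monomial (indicator_monomial (e \<union> f))"
        using fin by (intro monomial_divides ef(4)) simp
      ultimately show ?thesis by (simp only: mult_poly_ring)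
    qed
    have zero: "0 \<in> Idl\<^bsub>?R\<^esub> ?G"
      using additive_subgroup.zero_closed[OF ideal.axioms(1)[OF id]] by simp
    have add: "q + q' \<in> Idl\<^bsub>?R\<^esub> ?G" if "q \<in> Idl\<^bsub>?R\<^esub> ?G" "q' \<in> Idl\<^bsub>?R\<^esub> ?G" for q q'
      using additive_subgroup.a_closed[OF ideal.axioms(1)[OF id] that] by simp
    have sums: "(\<Sum>t\<in>A. Poly_Mapping.single t (Poly_Mapping.lookup p t)) \<in> Idl\<^bsub>?R\<^esub> ?G"
      if "A \<subseteq> Poly_Mapping.keys p" for A
      using finite_subset[OF that finite_keys] that
      by (induction A rule: finite_induct) (simp_all add: zero add single)
    show "p \<in> Idl\<^bsub>?R\<^esub> ?G" using sums[OF order_refl] by (simp only: sum_single)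
  qed
  moreover have "Idl\<^bsub>?R\<^esub> ?G \<subseteq> upset_ideal V (matching_upset E)"
    by (rule genideal_minimal[OF ideal_upset_ideal[OF upset_matching] G])
  ultimately show ?thesis unfolding second_squarefree_power_def by (intro subset_antisym)
qed

lemma whiskered_cycle_eq:
  "whiskered_cycle m = (X ` {1..m} \<union> Y ` {1..m}, whiskered_cycle_edges m)"
  unfolding whiskered_cycle_def whiskered_cycle_edges_def whiskered_path_def
  by (auto simp: less_Suc_eq_le)

theorem corollary5p7:
  fixes m :: nat and G :: "whisker_vertex graph"
    and J :: "(whisker_vertex, 'k::field) mpoly set"
  assumes "m \<ge> 3"
    and "G = whiskered_cycle m"
    and "J = second_squarefree_power (fst G) (edge_ideal G)"
  shows "regularity (fst G) J = 4 + \<lfloor>(real m - 3) / 2\<rfloor>"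
proof -
  let ?V = "X ` {1..m} \<union> Y ` {1..m}" and ?E = "whiskered_cycle_edges m"
  define s where "s = (m - 3) div 2"
  \<comment> \<open>The first fact gives room for s further whiskers, the second identifies the
    upper bound 3 + (m - 1) div 2 with 4 + s.\<close>
  have m: "2 * s + 3 \<le> m" "(m - 1) div 2 = Suc s" using assms(1) by (auto simp: s_def)
  have G: "G = (?V, ?E)" using assms(2) by (simp add: whiskered_cycle_eq)
  have "card e = 2 \<and> e \<subseteq> ?V" if "e \<in> ?E" for e
    using that assms(1) by (auto simp: whiskered_cycle_edges_def whiskered_path_def)
  then have J: "J = upset_ideal ?V (matching_upset ?E)"
    using second_squarefree_power_edge_ideal[of ?E ?V] by (simp add: assms(3) G)
  have "witness_set s \<subseteq> ?V" using m(1) by (auto simp: witness_set_def)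
  \<comment> \<open>The split into homological degree s and regularity 4 + s.\<close>
  moreover have "card (witness_set s) = s + (4 + s)" by (simp add: card_witness_set)
  moreover have "reg_le TYPE('k) (matching_upset ?E) (4 + s)"
    using reg_le_matching_whiskered_cycle[OF assms(1), of "TYPE('k)"] m(2) by simp
  ultimately have "regularity ?V J = int (4 + s)"
    unfolding J using not_exact_matching_cycle[of "1 :: 'k", OF _ m(1)]
    by (intro regularity_upset_ideal upset_matching) auto
  moreover have "\<lfloor>(real m - 3) / 2\<rfloor> = int s"
    using floor_divide_of_nat_eq[of "m - 3" 2] assms(1) by (simp add: s_def of_nat_diff)
  ultimately show ?thesis by (simp add: G)
qed

end
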